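(* Assume [LJ1]–[LJ4] and let $\ell,u_0^{(1)},u_1^{(1)}>0$. Let $k_n=(k_n^1,k_n^2)$ satisfy (K) and let the sets of representative atoms $\mathcal T_n=\{t_n^0,\dots,t_n^{r_n}\}$, $0=t_n^0<\dots<t_n^{r_n}=n$, satisfy: there exists a sequence $(p_n)\subset\mathbb N$ with $\lim_{n\to\infty}\lambda_np_n=0$ and $\max_i(t_n^{i+1}-t_n^i)\le p_n$ for all $n$. Then $\hat H_n^{\ell,k_n,\mathcal T_n}$ $\Gamma$-converges with respect to the strong $L^1(0,1)$-topology to the functional $H^\ell$, where $$H^\ell(u)=\begin{cases}\int_0^1J_0^{**}(u'(x))\,dx & \text{if } u\in BV^\ell(0,1),\ D^su\ge0,\\ +\infty&\text{otherwise on } L^1(0,1).\end{cases}$$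
   Context: Potentials: $J_1,J_2:\mathbb R\to(-\infty,+\infty]$; $J_{CB}:=J_1+J_2$; $J_0(z):=J_2(z)+\frac12\inf\{J_1(z_1)+J_1(z_2):z_1+z_2=2z\}$; $J_0^{**}$ is the convex lower semicontinuous envelope of $J_0$. Hypotheses: [LJ1] $\{z:J_0(z)=J_0^{**}(z)\}\cap\{z:J_0\text{ is affine in a neighbourhood of }z\}=\emptyset$. [LJ2] for every $z$ with $J_0(z)=J_0^{**}(z)$, the set $\{(z_1,z_2):z_1+z_2=2z,\ J_0(z)=J_2(z)+\frac12(J_1(z_1)+J_1(z_2))\}$ has exactly one element. [LJ3] $J_1,J_2$ are $C^{1,\alpha}$ on their domains for some $0<\alpha\le1$, $J_0$ is $C^1$ on its domain, $\operatorname{dom}J_1=\operatorname{dom}J_2\supset(0,+\infty)$, $\lim_{z\to+\infty}J_j(z)=0$ ($j=1,2$) and $\lim_{z\to+\infty}J_0(z)=:J_0(+\infty)\in\mathbb R$. [LJ4] there is a convex $\Psi:\mathbb R\to[0,+\infty]$ with $\lim_{z\to-\infty}\Psi(z)/|z|=+\infty$ and constants $c_1,c_2>0$ with $c_1(\Psi(z)-1)\le J_j(z)\le c_2\max\{\Psi(z),|z|\}$ for all $z\in\mathbb R$, $j=1,2$; there are $\delta_1,\delta_2,\gamma>0$ with $\{\delta_j\}=\operatorname{argmin}J_j$ and $\{\gamma\}=\operatorname{argmin}J_0$; $J_j$ is strictly convex on $(-\infty,\delta_j)\cap\operatorname{dom}J_j$; $J_0(\gamma)<J_0(+\infty)$;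 and $J_0(z)=J_0^{**}(z)$ for all $z\le\gamma$. Discrete setting: $\lambda_n=1/n$; $\mathcal A_n(0,1)$ is the set of continuous $u:[0,1]\to\mathbb R$ affine on each $(i\lambda_n,(i+1)\lambda_n)$, $i=0,\dots,n-1$; $u^i:=u(i\lambda_n)$. Boundary conditions (BC): $u^0=0$, $u^1=\lambda_nu_0^{(1)}$, $u^{n-1}=\ell-\lambda_nu_1^{(1)}$, $u^n=\ell$. Quasicontinuum energy: for integers $0<k_n^1<k_n^2<n-2$ and $u\in\mathcal A_n(0,1)$ satisfying (BC), $\hat H_n^{\ell,k_n}(u)=\sum_{i=0}^{n-1}\lambda_nJ_1(\frac{u^{i+1}-u^i}{\lambda_n})+\sum_{i=0}^{k_n^1-1}\lambda_nJ_2(\frac{u^{i+2}-u^i}{2\lambda_n})+\sum_{i=k_n^1}^{k_n^2-2}\frac{\lambda_n}{2}\{J_2(\frac{u^{i+1}-u^i}{\lambda_n})+J_2(\frac{u^{i+2}-u^{i+1}}{\lambda_n})\}+\sum_{i=k_n^2-1}^{n-2}\lambda_nJ_2(\frac{u^{i+2}-u^i}{2\lambda_n})$, and $+\infty$ otherwise. For $\mathcal T_n=\{t_n^0<\dots<t_n^{r_n}\}\subset\{0,\dots,n\}$ with $t_n^0=0,t_n^{r_n}=n$, $\mathcal A_{\mathcal T_n}(0,1)$ is the set of $u$ affine on each $(t_n^i\lambda_n,t_n^{i+1}\lambda_n)$, and $\hat H_n^{\ell,k_n,\mathcal T_n}(u)=\hat H_n^{\ell,k_n}(u)$ if $u\in\mathcal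 A_{\mathcal T_n}(0,1)$, $+\infty$ otherwise. Assumption (K): $k_n^1\to\infty$, $n-k_n^2\to\infty$, $\lambda_nk_n^1\to0$, $\lambda_n(n-k_n^2)\to0$. $BV^\ell(0,1)$: functions $u$ of bounded variation with $u(0-)=0$ and $u(1+)=\ell$ (jumps at $0$ and $1$ are allowed); $D^su$ is the singular part of $Du$ with respect to Lebesgue measure. *)

theory Defs
  imports "HOL-Analysis.Analysis"
begin

section \<open>Potentials\<close>

definition edom :: "(real \<Rightarrow> ereal) \<Rightarrow> real set" where
  "edom J = {z. J z < \<infinity>}"

text \<open>J_0(z) = J_2(z) + 1/2 inf {J_1(z_1)+J_1(z_2) : z_1+z_2 = 2z}\<close>
definition J0_of :: "(real \<Rightarrow> ereal) \<Rightarrow> (real \<Rightarrow> ereal) \<Rightarrow> real \<Rightarrow> ereal" where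
  "J0_of J1 J2 z = J2 z + ereal (1/2) *
      (INF p \<in> {p. fst p + snd p = 2 * z}. J1 (fst p) + J1 (snd p))"

text \<open>Fenchel conjugate and biconjugate (the convex lsc envelope f^{**}).\<close>
definition fconj :: "(real \<Rightarrow> ereal) \<Rightarrow> real \<Rightarrow> ereal" where
  "fconj f p = (SUP z. ereal (p * z) - f z)"

definition biconj :: "(real \<Rightarrow> ereal) \<Rightarrow> real \<Rightarrow> ereal" where
  "biconj f z = (SUP p. ereal (p * z) - fconj f p)"

definition affine_near :: "(real \<Rightarrow> ereal) \<Rightarrow> real \<Rightarrow> bool" where
  "affine_near f z \<longleftrightarrow> (\<exists>e>0. \<exists>a b. \<forall>y\<in>ball z e. f y = ereal (a * y + b))"

definition strict_convex_on :: "real set \<Rightarrow> (real \<Rightarrow> real) \<Rightarrow> bool" where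
  "strict_convex_on S f \<longleftrightarrow> (\<forall>x\<in>S. \<forall>y\<in>S. \<forall>t. x \<noteq> y \<longrightarrow> 0 < t \<longrightarrow> t < 1 \<longrightarrow>
      f ((1 - t) * x + t * y) < (1 - t) * f x + t * f y)"

definition ereal_convex :: "(real \<Rightarrow> ereal) \<Rightarrow> bool" where
  "ereal_convex f \<longleftrightarrow> (\<forall>x y t. 0 \<le> t \<longrightarrow> t \<le> 1 \<longrightarrow>
      f ((1 - t) * x + t * y) \<le> ereal (1 - t) * f x + ereal t * f y)"

text \<open>C^{1,alpha} on the domain D: differentiable (relative to D) at every point of D,
  with derivative locally alpha-Hoelder continuous on D.\<close>
definition C1alpha_on :: "real \<Rightarrow> real set \<Rightarrow> (real \<Rightarrow> ereal) \<Rightarrow> bool" where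
  "C1alpha_on \<alpha> D J \<longleftrightarrow> (\<exists>J'. (\<forall>x\<in>D. ((\<lambda>y. real_of_ereal (J y)) has_real_derivative J' x) (at x within D))
      \<and> (\<forall>K. compact K \<longrightarrow> K \<subseteq> D \<longrightarrow>
            (\<exists>C. \<forall>x\<in>K. \<forall>y\<in>K. \<bar>J' x - J' y\<bar> \<le> C * \<bar>x - y\<bar> powr \<alpha>)))"

definition C1_on :: "real set \<Rightarrow> (real \<Rightarrow> ereal) \<Rightarrow> bool" where
  "C1_on D J \<longleftrightarrow> (\<exists>J'. (\<forall>x\<in>D. ((\<lambda>y. real_of_ereal (J y)) has_real_derivative J' x) (at x within D))
      \<and> continuous_on D J')"

definition LJ_hyps :: "(real \<Rightarrow> ereal) \<Rightarrow> (real \<Rightarrow> ereal) \<Rightarrow> bool" where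
  "LJ_hyps J1 J2 \<longleftrightarrow>
    (let J0 = J0_of J1 J2; J0ss = biconj J0 in
     (\<forall>z. J1 z \<noteq> -\<infinity> \<and> J2 z \<noteq> -\<infinity>) \<and>
     \<comment> \<open>[LJ1]\<close>
     ({z. J0 z = J0ss z} \<inter> {z. affine_near J0 z} = {}) \<and>
     \<comment> \<open>[LJ2] (for z in the domain of J0)\<close>
     (\<forall>z. J0 z = J0ss z \<and> J0 z < \<infinity> \<longrightarrow>
        (\<exists>!p. fst p + snd p = 2 * z \<and> J0 z = J2 z + ereal (1/2) * (J1 (fst p) + J1 (snd p)))) \<and>
     \<comment> \<open>[LJ3]\<close>
     (\<exists>\<alpha>. 0 < \<alpha> \<and> \<alpha> \<le> 1 \<and> C1alpha_on \<alpha> (edom J1) J1 \<and> C1alpha_on \<alpha> (edom J2) J2) \<and>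
     C1_on (edom J0) J0 \<and>
     edom J1 = edom J2 \<and> {0<..} \<subseteq> edom J1 \<and>
     (J1 \<longlongrightarrow> 0) at_top \<and> (J2 \<longlongrightarrow> 0) at_top \<and>
     (\<exists>L::real. (J0 \<longlongrightarrow> ereal L) at_top \<and>
     \<comment> \<open>[LJ4]\<close>
       (\<exists>\<Psi> :: real \<Rightarrow> ereal. (\<forall>z. \<Psi> z \<ge> 0) \<and> ereal_convex \<Psi> \<and>
          ((\<lambda>z. \<Psi> z / ereal \<bar>z\<bar>) \<longlongrightarrow> \<infinity>) at_bot \<and>
          (\<exists>c1 c2::real. c1 > 0 \<and> c2 > 0 \<and>
             (\<forall>z. ereal c1 * (\<Psi> z - 1) \<le> J1 z \<and> J1 z \<le> ereal c2 * max (\<Psi> z) (ereal \<bar>z\<bar>)) \<and>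
             (\<forall>z. ereal c1 * (\<Psi> z - 1) \<le> J2 z \<and> J2 z \<le> ereal c2 * max (\<Psi> z) (ereal \<bar>z\<bar>)))) \<and>
       (\<exists>\<delta>1 \<delta>2 \<gamma>::real. \<delta>1 > 0 \<and> \<delta>2 > 0 \<and> \<gamma> > 0 \<and>
          {x. \<forall>y. J1 x \<le> J1 y} = {\<delta>1} \<and> {x. \<forall>y. J2 x \<le> J2 y} = {\<delta>2} \<and>
          {x. \<forall>y. J0 x \<le> J0 y} = {\<gamma>} \<and>
          strict_convex_on ({..<\<delta>1} \<inter> edom J1) (\<lambda>z. real_of_ereal (J1 z)) \<and>
          strict_convex_on ({..<\<delta>2} \<inter> edom J2) (\<lambda>z. real_of_ereal (J2 z)) \<and>
          J0 \<gamma> < ereal L \<and>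
          (\<forall>z\<le>\<gamma>. J0 z = J0ss z))))"

section \<open>Discrete setting\<close>

text \<open>nodal value u^i = u(i lambda_n), lambda_n = 1/n\<close>
definition node :: "nat \<Rightarrow> (real \<Rightarrow> real) \<Rightarrow> nat \<Rightarrow> real" where
  "node n u i = u (real i / real n)"

text \<open>T is a set of representative atoms {t^0 < ... < t^r} \<subseteq> {0..n}, 0 and n in T.\<close>
definition atoms_ok :: "nat \<Rightarrow> nat set \<Rightarrow> bool" where
  "atoms_ok n T \<longleftrightarrow> T \<subseteq> {0..n} \<and> 0 \<in> T \<and> n \<in> T"

definition consecutive :: "nat set \<Rightarrow> nat \<Rightarrow> nat \<Rightarrow> bool" where
  "consecutive T a b \<longleftrightarrow> a \<in> T \<and> b \<in> T \<and> a < b \<and> (\<forall>t\<in>T. \<not> (a < t \<and> t < b))"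

text \<open>A_T(0,1): continuous on [0,1], affine on each [t^i lambda_n, t^{i+1} lambda_n].
  A_n(0,1) is the case T = {0..n}.\<close>
definition A_T :: "nat \<Rightarrow> nat set \<Rightarrow> (real \<Rightarrow> real) set" where
  "A_T n T = {u. continuous_on {0..1} u \<and>
     (\<forall>a b. consecutive T a b \<longrightarrow>
        (\<exists>\<alpha> \<beta>. \<forall>x\<in>{real a / real n .. real b / real n}. u x = \<alpha> * x + \<beta>))}"

definition BC :: "nat \<Rightarrow> real \<Rightarrow> real \<Rightarrow> real \<Rightarrow> (real \<Rightarrow> real) \<Rightarrow> bool" where
  "BC n ell u0 u1 u \<longleftrightarrow> node n u 0 = 0 \<and> node n u 1 = u0 / real n \<and>
     node n u (n - 1) = ell - u1 / real n \<and> node n u n = ell"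

text \<open>The quasicontinuum energy (formula part), for u in A_n with (BC).\<close>
definition QC_energy :: "(real \<Rightarrow> ereal) \<Rightarrow> (real \<Rightarrow> ereal) \<Rightarrow> nat \<Rightarrow> nat \<Rightarrow> nat \<Rightarrow> (real \<Rightarrow> real) \<Rightarrow> ereal" where
  "QC_energy J1 J2 n k1 k2 u =
     (let lam = 1 / real n; v = node n u in
      (\<Sum>i\<in>{0..<n}. ereal lam * J1 ((v (i+1) - v i) / lam))
    + (\<Sum>i\<in>{0..<k1}. ereal lam * J2 ((v (i+2) - v i) / (2 * lam)))
    + (\<Sum>i\<in>{k1..k2 - 2}. ereal (lam / 2) *
          (J2 ((v (i+1) - v i) / lam) + J2 ((v (i+2) - v (i+1)) / lam)))
    + (\<Sum>i\<in>{k2 - 1..n - 2}. ereal lam * J2 ((v (i+2) - v i) / (2 * lam))))"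

text \<open>hat H_n^{l,k_n,T_n}, as a functional on (representatives of) L^1(0,1):
  finite only on functions a.e. equal on (0,1) to some u in A_T satisfying (BC).\<close>
definition H_disc :: "(real \<Rightarrow> ereal) \<Rightarrow> (real \<Rightarrow> ereal) \<Rightarrow> real \<Rightarrow> real \<Rightarrow> real \<Rightarrow>
     nat \<Rightarrow> nat \<Rightarrow> nat \<Rightarrow> nat set \<Rightarrow> (real \<Rightarrow> real) \<Rightarrow> ereal" where
  "H_disc J1 J2 ell u0 u1 n k1 k2 T w =
     (INF v \<in> {v. v \<in> A_T n T \<and> BC n ell u0 u1 v \<and>
                  (AE x in lborel. x \<in> {0<..<1} \<longrightarrow> w x = v x)}.
        QC_energy J1 J2 n k1 k2 v)"

section \<open>Continuum functional\<close>

text \<open>Integral over (0,1) of a function with values in (-infinity, +infinity].\<close>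
definition eint01 :: "(real \<Rightarrow> ereal) \<Rightarrow> ereal" where
  "eint01 f = enn2ereal (\<integral>\<^sup>+ x. e2ennreal (f x) * indicator {0<..<1} x \<partial>lborel)
            - enn2ereal (\<integral>\<^sup>+ x. e2ennreal (- f x) * indicator {0<..<1} x \<partial>lborel)"

text \<open>(g, mu) represents the distributional derivative Du on [0,1] of u in BV^l(0,1)
  with D^s u >= 0: Du = g dx + mu, mu a finite nonnegative Borel measure on [0,1]
  singular w.r.t. Lebesgue measure (it may have atoms at 0 and 1, i.e. the jumps
  at the boundary), u(0-) = 0, u(1+) = l.\<close>
definition BV_rep :: "real \<Rightarrow> (real \<Rightarrow> real) \<Rightarrow> (real \<Rightarrow> real) \<Rightarrow> real measure \<Rightarrow> bool" where
  "BV_rep ell u g \<mu> \<longleftrightarrow>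
     set_integrable lborel {0..1} g \<and>
     sets \<mu> = sets borel \<and> emeasure \<mu> {0..1} < \<infinity> \<and> emeasure \<mu> (UNIV - {0..1}) = 0 \<and>
     (\<exists>N \<in> sets borel. emeasure lborel N = 0 \<and> emeasure \<mu> (UNIV - N) = 0) \<and>
     (AE x in lborel. x \<in> {0<..<1} \<longrightarrow> u x = (LINT t:{0..x}|lborel. g t) + measure \<mu> {0..x}) \<and>
     (LINT t:{0..1}|lborel. g t) + measure \<mu> {0..1} = ell"

definition H_lim :: "(real \<Rightarrow> ereal) \<Rightarrow> (real \<Rightarrow> ereal) \<Rightarrow> real \<Rightarrow> (real \<Rightarrow> real) \<Rightarrow> ereal" where
  "H_lim J1 J2 ell u =
     (INF g \<in> {g. \<exists>\<mu>. BV_rep ell u g \<mu>}. eint01 (\<lambda>x. biconj (J0_of J1 J2) (g x)))"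

section \<open>Gamma-convergence in strong L^1(0,1)\<close>

definition L1_01 :: "(real \<Rightarrow> real) set" where
  "L1_01 = {u. set_integrable lborel {0<..<1} u}"

definition L1_tendsto :: "(nat \<Rightarrow> real \<Rightarrow> real) \<Rightarrow> (real \<Rightarrow> real) \<Rightarrow> bool" where
  "L1_tendsto v u \<longleftrightarrow> (\<lambda>n. LINT x:{0<..<1}|lborel. \<bar>v n x - u x\<bar>) \<longlonglongrightarrow> 0"

definition Gamma_L1 :: "(nat \<Rightarrow> (real \<Rightarrow> real) \<Rightarrow> ereal) \<Rightarrow> ((real \<Rightarrow> real) \<Rightarrow> ereal) \<Rightarrow> bool" where
  "Gamma_L1 F G \<longleftrightarrow>
     (\<forall>u\<in>L1_01. \<forall>v. (\<forall>n. v n \<in> L1_01) \<and> L1_tendsto v u \<longrightarrow>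
         G u \<le> liminf (\<lambda>n. F n (v n))) \<and>
     (\<forall>u\<in>L1_01. \<exists>v. (\<forall>n. v n \<in> L1_01) \<and> L1_tendsto v u \<and>
         limsup (\<lambda>n. F n (v n)) \<le> G u)"

end

theory Submission
  imports Defs
begin

text \<open>The envelope $f = J_0^{**}$ is nonincreasing, constant equal to $m = J_0(\gamma)$ on
  $[\gamma,\infty)$, superlinear at $-\infty$, and, because the minimal pair in [LJ2] is unique and the
  problem is symmetric in the pair, it equals $J_1 + J_2$ on its domain left of $\gamma$.

  Lower bound. The energy dominates the sum of $f$ over averaged slopes. Splitting these slopes as
  $\gamma - h + \beta$ with $h, \beta \ge 0$, the energy controls $f(\gamma - h)$, which makes $h$
  uniformly integrable, while $\beta$ only produces an increasing function. The admissible $h$ form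
  convex sets, from which a sequence converging almost everywhere is selected; Fatou's lemma bounds
  the limiting energy, and the limit of the increasing parts is the distribution function of a
  measure, whose Lebesgue decomposition gives $D^s u \ge 0$. Since $f$ is nonincreasing, the
  absolutely continuous part of that measure only lowers the energy.

  Upper bound. By Jensen's inequality $u$ can be replaced by a function that is affine with slope at
  most $\gamma$ on finitely many equal blocks, with a strictly positive jump at every interior block
  boundary. Interpolating it at the representative atoms costs energy $f$ inside the blocks; the few
  elements that meet a block boundary have slopes tending to $+\infty$, where the potentials vanish,
  and the jumps absorb the corrections forced by the boundary conditions.\<close>

text \<open>On a long mesh element the slope is constant, so the atoms cannot alternate between the
  two members of a minimal pair, and each cell pays \<open>J1 + J2\<close> instead of J0. The coarse
  model can share the atomistic limit because the minimal pair is diagonal wherever J0 is finite and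
  equals its envelope; this is the role of [LJ2]. Both forms of the second-neighbour energy are
  bounded below by the same envelope, so the position of the interfaces does not enter the lower
  bound. In the upper bound the atomistic pairs see only finitely many slopes, chosen independently
  of n; each pair costs a bounded excess, and their number is o(n). The difficult point is
  compactness: nothing prevents positive slopes from concentrating, and superlinear growth is
  available at -\<infinity> only. This is why the deficit below \<gamma> is treated apart and the
  remainder is used only as an increasing function. The excess energy over m is valued in
  \<open>ennreal\<close>, where Fatou's lemma and convexity apply without integrability
  conditions.\<close>

section \<open>Piecewise affine functions\<close>

definition ramp :: "real \<Rightarrow> real" where "ramp x = max x 0"

text \<open>\<open>s i\<close> is the slope on [i/n, (i+1)/n]. A sum of clipped ramps is defined and
  continuous on the whole line, vanishes at 0 and is linear in the slopes, so that no case
  distinction on cells is built in.\<close>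

definition pwa :: "nat \<Rightarrow> (nat \<Rightarrow> real) \<Rightarrow> real \<Rightarrow> real" where
  "pwa n s x = (\<Sum>i<n. s i * (ramp (x - real i / real n) - ramp (x - real (Suc i) / real n)))"

lemma continuous_on_pwa [continuous_intros]: "continuous_on A (pwa n s)"
  unfolding pwa_def ramp_def by (intro continuous_intros)

lemma pwa_0 [simp]: "pwa n s 0 = 0"
  unfolding pwa_def ramp_def by (intro sum.neutral) (auto simp: max_def)

lemma ramp_telescope:
  assumes "a \<le> b"
  shows "(\<Sum>i\<in>{a..<b}. ramp (x - real i / real n) - ramp (x - real (Suc i) / real n))
    = ramp (x - real a / real n) - ramp (x - real b / real n)"
  using assms
proof (induction b rule: dec_induct)
  case (step k)
  then show ?case by simp
qed simp

lemma ramp_cell_nonneg: "0 \<le> ramp (x - real i / real n) - ramp (x - real (Suc i) / real n)"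
proof -
  have "real i / real n \<le> real (Suc i) / real n" by (intro divide_right_mono) auto
  thus ?thesis by (simp add: ramp_def max_def)
qed

text \<open>At such an x, a cell left of a has used up its full length 1/n and a cell right of b has
  not started; between them the ramps telescope. A run of equal slopes covers a whole mesh element
  as well as a single cell.\<close>

lemma pwa_const_between:
  assumes "0 < n" "a < b" "b \<le> n" and s: "\<And>i. a \<le> i \<Longrightarrow> i < b \<Longrightarrow> s i = \<sigma>"
    and x: "real a / real n \<le> x" "x \<le> real b / real n"
  shows "pwa n s x = (\<Sum>i<a. s i) / real n + \<sigma> * (x - real a / real n)"
proof -
  let ?r = "\<lambda>i. ramp (x - real i / real n) - ramp (x - real (Suc i) / real n)"
  have split: "{..<n} = {..<a} \<union> ({a..<b} \<union> {b..<n})" using assms by auto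
  have "pwa n s x = (\<Sum>i<a. s i * ?r i) + ((\<Sum>i\<in>{a..<b}. s i * ?r i) + (\<Sum>i\<in>{b..<n}. s i * ?r i))"
    unfolding pwa_def split using assms(2)
    by (subst sum.union_disjoint, (auto)[3], subst sum.union_disjoint, auto)
  moreover have "(\<Sum>i<a. s i * ?r i) = (\<Sum>i<a. s i) / real n"
    unfolding sum_divide_distrib
  proof (rule sum.cong)
    fix i assume "i \<in> {..<a}"
    then have "real (Suc i) / real n \<le> real a / real n" by (intro divide_right_mono) auto
    moreover have "real i / real n \<le> real (Suc i) / real n" by (intro divide_right_mono) auto
    ultimately have "?r i = real (Suc i) / real n - real i / real n"
      using x unfolding ramp_def by linarith
    also have "\<dots> = 1 / real n" by (simp add: diff_divide_distrib[symmetric])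
    finally show "s i * ?r i = s i / real n" by simp
  qed simp
  moreover have "(\<Sum>i\<in>{b..<n}. s i * ?r i) = 0"
  proof (rule sum.neutral, intro ballI)
    fix i assume "i \<in> {b..<n}"
    then have "real b / real n \<le> real i / real n" by (intro divide_right_mono) auto
    moreover have "real i / real n \<le> real (Suc i) / real n" by (intro divide_right_mono) auto
    ultimately show "s i * ?r i = 0" using x by (simp add: ramp_def max_def)
  qed
  moreover have "(\<Sum>i\<in>{a..<b}. s i * ?r i) = \<sigma> * (x - real a / real n)"
  proof -
    have "(\<Sum>i\<in>{a..<b}. s i * ?r i) = (\<Sum>i\<in>{a..<b}. \<sigma> * ?r i)"
      using s by (intro sum.cong) auto
    also have "\<dots> = \<sigma> * (\<Sum>i\<in>{a..<b}. ?r i)" by (simp add: sum_distrib_left)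
    also have "(\<Sum>i\<in>{a..<b}. ?r i) = ramp (x - real a / real n) - ramp (x - real b / real n)"
      using assms(2) by (intro ramp_telescope) simp
    also have "\<dots> = x - real a / real n" using x by (simp add: ramp_def max_def)
    finally show ?thesis .
  qed
  ultimately show ?thesis by simp
qed

lemma pwa_cell:
  assumes "i < n" "real i / real n \<le> x" "x \<le> real (Suc i) / real n"
  shows "pwa n s x = (\<Sum>j<i. s j) / real n + s i * (x - real i / real n)"
  using assms by (intro pwa_const_between[where b="Suc i"]) (auto simp: le_less_Suc_eq)

lemma pwa_node:
  assumes "0 < n" "i \<le> n"
  shows "pwa n s (real i / real n) = (\<Sum>j<i. s j) / real n"
proof (cases "i < n")
  case True
  then show ?thesis by (subst pwa_cell[where i=i]) (auto intro: divide_right_mono)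
next
  case False
  then obtain k where k: "i = Suc k" "i = n" "k < n" using assms by (cases i) auto
  have "real (Suc k) / real n - real k / real n = 1 / real n"
    by (simp add: diff_divide_distrib[symmetric])
  moreover have "pwa n s (real i / real n) = (\<Sum>j<k. s j) / real n + s k * (real i / real n - real k / real n)"
    using k by (intro pwa_cell) (auto intro: divide_right_mono)
  ultimately have "pwa n s (real i / real n) = (\<Sum>j<k. s j) / real n + s k / real n"
    using k by simp
  moreover have "(\<Sum>j<i. s j) = (\<Sum>j<k. s j) + s k" unfolding k(1) by simp
  ultimately show ?thesis by (simp add: add_divide_distrib)
qed

lemma pwa_mult_add: "pwa n (\<lambda>i. a * s i + b * t i) x = a * pwa n s x + b * pwa n t x"
  unfolding pwa_def by (simp add: sum.distrib[symmetric] sum_distrib_left algebra_simps)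

lemma pwa_const: assumes "0 < n" "0 \<le> x" "x \<le> 1" shows "pwa n (\<lambda>i. c) x = c * x"
  using pwa_const_between[of n 0 n "\<lambda>i. c" c x] assms by simp

lemma pwa_mono_slopes:
  assumes "\<And>i. i < n \<Longrightarrow> s i \<le> t i" shows "pwa n s x \<le> pwa n t x"
  unfolding pwa_def using assms ramp_cell_nonneg by (intro sum_mono mult_right_mono) auto

lemma pwa_mono:
  assumes "\<And>i. i < n \<Longrightarrow> 0 \<le> s i" "x \<le> y"
  shows "pwa n s x \<le> pwa n s y"
  unfolding pwa_def
proof (intro sum_mono mult_left_mono)
  fix i assume "i \<in> {..<n}"
  have "real i / real n \<le> real (Suc i) / real n" by (intro divide_right_mono) auto
  then show "ramp (x - real i / real n) - ramp (x - real (Suc i) / real n)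
      \<le> ramp (y - real i / real n) - ramp (y - real (Suc i) / real n)"
    using assms(2) by (auto simp: ramp_def max_def)
qed (use assms in auto)

text \<open>The ramp of each cell grows by a nonnegative amount from x to y. Replacing the slopes by
  B therefore bounds the difference by that of the constant slope B, which is linear.\<close>

lemma pwa_increment_abs_le:
  assumes "0 < n" "\<And>i. i < n \<Longrightarrow> \<bar>s i\<bar> \<le> B" "0 \<le> x" "x \<le> y" "y \<le> 1"
  shows "\<bar>pwa n s y - pwa n s x\<bar> \<le> B * (y - x)"
proof -
  let ?d = "\<lambda>i. (ramp (y - real i / real n) - ramp (y - real (Suc i) / real n))
      - (ramp (x - real i / real n) - ramp (x - real (Suc i) / real n))"
  have d: "0 \<le> ?d i" for i
  proof -
    have "real i / real n \<le> real (Suc i) / real n" by (intro divide_right_mono) auto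
    thus ?thesis using assms(4) by (auto simp: ramp_def max_def)
  qed
  have eq: "pwa n s y - pwa n s x = (\<Sum>i<n. s i * ?d i)"
    unfolding pwa_def sum_subtractf[symmetric] by (intro sum.cong refl) (simp add: right_diff_distrib)
  have "\<bar>pwa n s y - pwa n s x\<bar> \<le> (\<Sum>i<n. \<bar>s i * ?d i\<bar>)" unfolding eq by (rule sum_abs)
  moreover have "(\<Sum>i<n. \<bar>s i * ?d i\<bar>) \<le> (\<Sum>i<n. B * ?d i)"
  proof (rule sum_mono)
    fix i assume "i \<in> {..<n}"
    then have "\<bar>s i\<bar> * ?d i \<le> B * ?d i" using assms(2) d by (intro mult_right_mono) auto
    then show "\<bar>s i * ?d i\<bar> \<le> B * ?d i" using d[of i] by (simp only: abs_mult abs_of_nonneg)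
  qed
  moreover have "(\<Sum>i<n. B * ?d i) = pwa n (\<lambda>i. B) y - pwa n (\<lambda>i. B) x"
    unfolding pwa_def sum_subtractf[symmetric] by (intro sum.cong refl) (simp add: right_diff_distrib)
  moreover have "pwa n (\<lambda>i. B) y - pwa n (\<lambda>i. B) x = B * (y - x)"
    using assms by (simp add: pwa_const algebra_simps)
  ultimately show ?thesis by linarith
qed

section \<open>Cells\<close>

text \<open>The index i with i/n \<le> x < (i+1)/n when 0 \<le> x < 1. At x = 1 the value is n,
  beyond the last cell, so the right end point needs separate treatment.\<close>

definition cell :: "nat \<Rightarrow> real \<Rightarrow> nat" where "cell n x = nat \<lfloor>real n * x\<rfloor>"

lemma cell_bounds:
  assumes "0 < n" "0 \<le> x" "x < 1"
  shows "cell n x < n" "real (cell n x) / real n \<le> x" "x < real (Suc (cell n x)) / real n"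
proof -
  have nn: "0 \<le> real n * x" using assms by simp
  have l: "real (cell n x) \<le> real n * x"
    unfolding cell_def using nn by linarith
  have g: "real n * x < real (Suc (cell n x))"
    unfolding cell_def using nn by linarith
  have "real (cell n x) < real n" using l assms
    by (smt (verit) mult_less_cancel_left2 of_nat_0_less_iff)
  then show "cell n x < n" by simp
  show "real (cell n x) / real n \<le> x" "x < real (Suc (cell n x)) / real n"
    using l g assms by (auto simp: field_simps)
qed

lemma cell_eqI:
  assumes "0 < n" "real i / real n \<le> x" "x < real (Suc i) / real n"
  shows "cell n x = i"
proof -
  have "real i \<le> real n * x" "real n * x < real i + 1" using assms by (auto simp: field_simps)
  then have "\<lfloor>real n * x\<rfloor> = int i" by (intro floor_unique) auto
  then show ?thesis by (simp add: cell_def)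
qed

lemma cell_mono: "x \<le> y \<Longrightarrow> cell n x \<le> cell n y"
  unfolding cell_def by (intro nat_mono floor_mono mult_left_mono) auto

lemma measurable_cell [measurable]: "cell n \<in> measurable borel (count_space UNIV)"
  unfolding cell_def by measurable

text \<open>Stated over a semiring so that it serves real step functions and \<open>ennreal\<close>
  integrands alike.\<close>

lemma cell_indicator_sum:
  fixes \<phi> :: "nat \<Rightarrow> 'a::semiring_1"
  assumes "0 < n" "0 \<le> x" "x < 1"
  shows "\<phi> (cell n x) = (\<Sum>i<n. \<phi> i * indicator {real i / real n..<real (Suc i) / real n} x)"
proof -
  note c = cell_bounds[OF assms]
  have "(\<Sum>i<n. \<phi> i * indicator {real i / real n..<real (Suc i) / real n} x)
      = (\<Sum>i<n. if i = cell n x then \<phi> i else 0)"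
  proof (rule sum.cong)
    fix i assume "i \<in> {..<n}"
    have "x \<in> {real i / real n..<real (Suc i) / real n} \<longleftrightarrow> i = cell n x"
      using c cell_eqI[of n i x] assms(1) unfolding atLeastLessThan_iff by metis
    then show "\<phi> i * indicator {real i / real n..<real (Suc i) / real n} x = (if i = cell n x then \<phi> i else 0)"
      by (simp only: indicator_def if_distrib mult_1_right mult_zero_right of_bool_def cong: if_cong) simp
  qed simp
  also have "\<dots> = \<phi> (cell n x)" using c(1) by simp
  finally show ?thesis by (rule sym)
qed

section \<open>Lebesgue measure on the open unit interval\<close>

definition U01 :: "real measure" where "U01 = density lborel (indicator {0<..<1})"

lemma sets_U01 [simp, measurable_cong]: "sets U01 = sets borel" by (simp add: U01_def)
lemma space_U01 [simp]: "space U01 = UNIV" by (simp add: U01_def)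

lemma nn_integral_U01:
  "f \<in> borel_measurable borel \<Longrightarrow> (\<integral>\<^sup>+x. f x \<partial>U01) = (\<integral>\<^sup>+x. f x * indicator {0<..<1} x \<partial>lborel)"
  unfolding U01_def by (subst nn_integral_density) (auto simp: mult.commute)

lemma AE_U01: "(AE x in U01. P x) \<longleftrightarrow> (AE x in lborel. x \<in> {0<..<1} \<longrightarrow> P x)"
  unfolding U01_def by (subst AE_density) (auto simp: indicator_def intro!: AE_cong)

lemma emeasure_U01: "A \<in> sets borel \<Longrightarrow> emeasure U01 A = emeasure lborel (A \<inter> {0<..<1})"
  unfolding U01_def by (subst emeasure_density) (auto simp: mult.commute nn_integral_set_ennreal indicator_inter_arith[symmetric] Int_commute)

lemma finite_measure_U01: "finite_measure U01"
  by (intro finite_measureI) (simp add: emeasure_U01)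

lemma AE_U01_in: "AE x in U01. 0 < x \<and> x < 1"
  unfolding AE_U01 by auto

lemma nn_integral_cell:
  assumes "0 < n"
  shows "(\<integral>\<^sup>+x. \<phi> (cell n x) \<partial>U01) = (\<Sum>i<n. \<phi> i) * ennreal (1 / real n)"
proof -
  have ae: "AE x in U01. \<phi> (cell n x) = (\<Sum>i<n. \<phi> i * indicator {real i / real n..<real (Suc i) / real n} x)"
    using AE_U01_in by eventually_elim (use assms in \<open>intro cell_indicator_sum; auto\<close>)
  have em: "emeasure U01 {real i / real n..<real (Suc i) / real n} = ennreal (1 / real n)" if "i < n" for i
  proof -
    have le: "real (Suc i) / real n \<le> 1" using that assms by (simp add: divide_simps)
    have le2: "real i / real n \<le> real (Suc i) / real n" by (intro divide_right_mono) auto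
    have "emeasure U01 {real i / real n..<real (Suc i) / real n}
        = emeasure lborel ({real i / real n..<real (Suc i) / real n} \<inter> {0<..<1})"
      by (simp add: emeasure_U01)
    also have "\<dots> = emeasure lborel {real i / real n..<real (Suc i) / real n}"
    proof (rule emeasure_eq_AE)
      have "AE x in lborel. x \<noteq> (0::real)" by (rule AE_lborel_singleton)
      then show "AE x in lborel. (x \<in> {real i / real n..<real (Suc i) / real n} \<inter> {0<..<1})
          = (x \<in> {real i / real n..<real (Suc i) / real n})"
      proof eventually_elim
        case (elim x)
        have "0 \<le> real i / real n" by simp
        then show ?case using elim le by (smt (verit) Int_iff atLeastLessThan_iff greaterThanLessThan_iff)
      qed
    qed auto
    also have "\<dots> = ennreal (1 / real n)" using le2 by (simp add: diff_divide_distrib[symmetric])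
    finally show ?thesis .
  qed
  have "(\<integral>\<^sup>+x. \<phi> (cell n x) \<partial>U01)
      = (\<integral>\<^sup>+x. (\<Sum>i<n. \<phi> i * indicator {real i / real n..<real (Suc i) / real n} x) \<partial>U01)"
    using ae by (rule nn_integral_cong_AE)
  also have "\<dots> = (\<Sum>i<n. \<phi> i * emeasure U01 {real i / real n..<real (Suc i) / real n})"
    by (subst nn_integral_sum) (auto intro!: sum.cong nn_integral_cmult_indicator)
  also have "\<dots> = (\<Sum>i<n. \<phi> i) * ennreal (1 / real n)"
    using em by (simp add: sum_distrib_right)
  finally show ?thesis .
qed

lemma set_integral_step:
  fixes s :: "nat \<Rightarrow> real"
  assumes "0 < n" "0 \<le> x" "x \<le> 1"
  defines "h \<equiv> (\<lambda>t. if 0 \<le> t \<and> t < 1 then s (cell n t) else 0)"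
  shows "set_integrable lborel {0..x} h" "(LINT t:{0..x}|lborel. h t) = pwa n s x"
proof -
  let ?I = "\<lambda>i. {real i / real n..<real (Suc i) / real n}"
  have le1: "real (Suc i) / real n \<le> 1" if "i < n" for i using that assms by (simp add: divide_simps)
  have h: "h t = (\<Sum>i<n. s i * indicator (?I i) t)" for t
  proof (cases "0 \<le> t \<and> t < 1")
    case True
    then show ?thesis unfolding h_def using cell_indicator_sum[of n t s] assms(1) by simp
  next
    case False
    have "t \<notin> ?I i" if "i < n" for i
      using False le1[OF that] by (smt (verit) atLeastLessThan_iff divide_nonneg_nonneg of_nat_0_le_iff)
    then have "(\<Sum>i<n. s i * indicator (?I i) t) = 0" by (intro sum.neutral) (simp add: indicator_def)
    moreover have "h t = 0" unfolding h_def using False by auto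
    ultimately show ?thesis by simp
  qed
  have b: "{0..x} \<inter> ?I i \<in> sets lborel" for i by simp
  have fin: "emeasure lborel ({0..x} \<inter> ?I i) < \<infinity>" for i
    by (rule le_less_trans[OF emeasure_mono[of _ "{0..x}"]]) (auto simp: assms)
  have eq: "(\<lambda>t. indicator {0..x} t *\<^sub>R h t) = (\<lambda>t. \<Sum>i<n. s i * indicator ({0..x} \<inter> ?I i) t)"
    by (intro ext) (simp only: h real_scaleR_def sum_distrib_left indicator_inter_arith mult_ac)
  have int: "integrable lborel (\<lambda>t. s i * indicator ({0..x} \<inter> ?I i) t)" for i
    using fin[of i] by (intro integrable_mult_right integrable_real_indicator) auto
  show "set_integrable lborel {0..x} h"
    unfolding set_integrable_def eq using int by (intro Bochner_Integration.integrable_sum) auto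
  have meas: "measure lborel ({0..x} \<inter> ?I i) = ramp (x - real i / real n) - ramp (x - real (Suc i) / real n)" (is "?l = ?r") for i
  proof -
    have nn: "0 \<le> y" if "real i / real n \<le> y" for y by (rule order_trans[OF _ that]) simp
    have le2: "real i / real n \<le> real (Suc i) / real n" by (intro divide_right_mono) auto
    consider "x < real i / real n" | "real i / real n \<le> x" "x < real (Suc i) / real n" | "real (Suc i) / real n \<le> x"
      by linarith
    then show ?thesis
    proof cases
      case 1
      then have "{0..x} \<inter> ?I i = {}" by auto
      then show ?thesis using 1 le2 by (simp add: ramp_def max_def)
    next
      case 2
      then have "{0..x} \<inter> ?I i = {real i / real n..x}" using nn by auto
      then show ?thesis using 2 by (simp add: ramp_def max_def)
    next
      case 3
      then have "{0..x} \<inter> ?I i = ?I i" using nn by auto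
      then show ?thesis using 3 le2 by (simp add: ramp_def max_def)
    qed
  qed
  have "(LINT t:{0..x}|lborel. h t) = (\<Sum>i<n. (LINT t|lborel. s i * indicator ({0..x} \<inter> ?I i) t))"
    unfolding set_lebesgue_integral_def eq using int by (intro Bochner_Integration.integral_sum) auto
  also have "\<dots> = (\<Sum>i<n. s i * measure lborel ({0..x} \<inter> ?I i))"
    by (intro sum.cong refl) simp
  also have "\<dots> = pwa n s x" unfolding pwa_def meas ..
  finally show "(LINT t:{0..x}|lborel. h t) = pwa n s x" .
qed

section \<open>Suprema of affine functions\<close>

text \<open>The envelope of $J_0$ will be represented as \<^term>\<open>\<lambda>z. ereal m + enn2ereal (supaff b (\<gamma> - z))\<close>.\<close>

definition supaff :: "(real \<Rightarrow> real) \<Rightarrow> real \<Rightarrow> ennreal" where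
  "supaff b q = (SUP p\<in>{0..}. ennreal (p * q - b p))"

lemma supaff_upper: "0 \<le> p \<Longrightarrow> ennreal (p * q - b p) \<le> supaff b q"
  unfolding supaff_def by (intro SUP_upper) auto

lemma supaff_mono: "q \<le> q' \<Longrightarrow> supaff b q \<le> supaff b q'"
  unfolding supaff_def by (intro SUP_subset_mono) (auto intro!: ennreal_leI mult_left_mono)

lemma ennreal_add_le: "ennreal (x + y) \<le> ennreal x + ennreal y"
  by (cases "0 \<le> x"; cases "0 \<le> y")
     (auto simp: ennreal_plus[symmetric] ennreal_neg intro!: ennreal_leI simp del: ennreal_plus)

text \<open>With p = 1 this bounds the L^1 norm of a nonnegative deficit by its energy.\<close>

lemma supaff_superlinear: "0 \<le> p \<Longrightarrow> ennreal (p * q) \<le> supaff b q + ennreal \<bar>b p\<bar>"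
proof -
  assume "0 \<le> p"
  have "ennreal (p * q) \<le> ennreal (p * q - b p) + ennreal (b p)"
    using ennreal_add_le[of "p * q - b p" "b p"] by simp
  also have "\<dots> \<le> supaff b q + ennreal \<bar>b p\<bar>"
    using supaff_upper[OF \<open>0 \<le> p\<close>] by (intro add_mono ennreal_leI) auto
  finally show ?thesis .
qed

lemma supaff_convex:
  assumes "0 \<le> t" "t \<le> 1"
  shows "supaff b ((1 - t) * q + t * q') \<le> ennreal (1 - t) * supaff b q + ennreal t * supaff b q'"
  unfolding supaff_def[of b "(1 - t) * q + t * q'"]
proof (rule SUP_least)
  fix p :: real assume "p \<in> {0..}"
  have "ennreal (p * ((1 - t) * q + t * q') - b p) = ennreal ((1 - t) * (p * q - b p) + t * (p * q' - b p))"
    by (simp add: algebra_simps)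
  also have "\<dots> \<le> ennreal ((1 - t) * (p * q - b p)) + ennreal (t * (p * q' - b p))"
    by (rule ennreal_add_le)
  also have "\<dots> = ennreal (1 - t) * ennreal (p * q - b p) + ennreal t * ennreal (p * q' - b p)"
    using assms by (simp add: ennreal_mult')
  also have "\<dots> \<le> ennreal (1 - t) * supaff b q + ennreal t * supaff b q'"
    using \<open>p \<in> {0..}\<close> by (intro add_mono mult_left_mono supaff_upper) auto
  finally show "ennreal (p * ((1 - t) * q + t * q') - b p) \<le> \<dots>" .
qed

lemma supaff_midpoint:
  "supaff b ((q + q') / 2) \<le> ennreal (1/2) * supaff b q + ennreal (1/2) * supaff b q'"
  using supaff_convex[of "1/2" b q q'] by (simp add: field_simps)

lemma supaff_le_liminf:
  assumes "x \<longlonglongrightarrow> y"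
  shows "supaff b y \<le> liminf (\<lambda>n. supaff b (x n))"
  unfolding supaff_def[of b y]
proof (rule SUP_least)
  fix p :: real assume p: "p \<in> {0..}"
  have "(\<lambda>n. ennreal (p * x n - b p)) \<longlonglongrightarrow> ennreal (p * y - b p)"
    using assms by (intro tendsto_intros)
  then have "ennreal (p * y - b p) = liminf (\<lambda>n. ennreal (p * x n - b p))"
    by (simp add: lim_imp_Liminf)
  also have "\<dots> \<le> liminf (\<lambda>n. supaff b (x n))"
    using p by (intro Liminf_mono always_eventually allI supaff_upper) auto
  finally show "ennreal (p * y - b p) \<le> \<dots>" .
qed

text \<open>The supremum runs over uncountably many p, so measurability comes from lower
  semicontinuity: the superlevel sets are unions of open sets.\<close>

lemma measurable_supaff [measurable]: "supaff b \<in> borel_measurable borel"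
proof (rule borel_measurableI_greater)
  fix y :: ennreal
  have "{q. y < supaff b q} = (\<Union>p\<in>{0..}. {q. y < ennreal (p * q - b p)})"
    unfolding supaff_def less_SUP_iff by auto
  moreover have "open {q. y < ennreal (p * q - b p)}" for p
    by (intro open_Collect_less continuous_intros continuous_on_ennreal)
  ultimately have "open {q. y < supaff b q}" by auto
  then show "{q \<in> space borel. y < supaff b q} \<in> sets borel" by simp
qed

section \<open>A compactness lemma\<close>

text \<open>Measures the strict convexity of exp(-x): a small gap at the midpoint forces exp(-x/2)
  and exp(-y/2) to be close. The half exponents make the gap a perfect square.\<close>

lemma midpoint_exp_identity:
  "exp (- x) / 2 + exp (- y) / 2 - exp (- ((x + y) / 2)) = (exp (- (x / 2)) - exp (- (y / 2)))\<^sup>2 / (2::real)"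
proof -
  have "exp (- x) = exp (- (x/2)) ^ 2" "exp (- y) = exp (- (y/2)) ^ 2"
    by (simp_all add: power2_eq_square exp_add[symmetric])
  moreover have "exp (- ((x + y) / 2)) = exp (- (x/2)) * exp (- (y/2))"
    by (simp add: exp_add[symmetric] field_simps)
  ultimately show ?thesis by (simp add: power2_diff field_simps)
qed

text \<open>The sum of the increments has a finite integral, hence is finite almost
  everywhere.\<close>

lemma AE_convergent_of_summable_L1_increments:
  fixes f :: "nat \<Rightarrow> 'a \<Rightarrow> real"
  assumes [measurable]: "\<And>n. f n \<in> borel_measurable M"
    and bnd: "\<And>n. (\<integral>\<^sup>+x. ennreal \<bar>f (Suc n) x - f n x\<bar> \<partial>M) \<le> ennreal (a n)"
    and a: "\<And>n. 0 \<le> a n" "summable a"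
  shows "AE x in M. convergent (\<lambda>n. f n x)"
proof -
  have "(\<integral>\<^sup>+x. (\<Sum>n. ennreal \<bar>f (Suc n) x - f n x\<bar>) \<partial>M)
      = (\<Sum>n. \<integral>\<^sup>+x. ennreal \<bar>f (Suc n) x - f n x\<bar> \<partial>M)"
    by (intro nn_integral_suminf) auto
  also have "\<dots> \<le> (\<Sum>n. ennreal (a n))" by (intro suminf_le bnd) auto
  also have "\<dots> < \<infinity>" using suminf_ennreal2[OF a] by simp
  finally have "AE x in M. (\<Sum>n. ennreal \<bar>f (Suc n) x - f n x\<bar>) \<noteq> \<infinity>"
    by (intro nn_integral_PInf_AE) auto
  then show ?thesis
  proof eventually_elim
    case (elim x)
    then have "summable (\<lambda>n. \<bar>f (Suc n) x - f n x\<bar>)"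
      by (intro summable_suminf_not_top) auto
    then have "summable (\<lambda>n. f (Suc n) x - f n x)" by (rule summable_rabs_cancel)
    then have "convergent (\<lambda>n. \<Sum>k<n. f (Suc k) x - f k x)" by (simp add: summable_iff_convergent)
    then have "convergent (\<lambda>n. f n x - f 0 x)" by (simp add: sum_lessThan_telescope[of "\<lambda>k. f k x"])
    then have "convergent (\<lambda>n. (f n x - f 0 x) + f 0 x)"
      by (intro convergent_add convergent_const)
    then show ?case by simp
  qed
qed

text \<open>A substitute for weak $L^1$ compactness: almost minimising the strictly convex functional
  \<^term>\<open>\<lambda>c. \<integral>x. exp (- c x) \<partial>M\<close> over shrinking convex sets yields almost everywhere convergence.\<close>

lemma midpoint_convex_AE_convergent_selection:
  fixes C :: "nat \<Rightarrow> ('a \<Rightarrow> real) set"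
  assumes "finite_measure M"
    and dec: "\<And>m n. m \<le> n \<Longrightarrow> C n \<subseteq> C m"
    and ne: "\<And>n. C n \<noteq> {}"
    and meas: "\<And>n c. c \<in> C n \<Longrightarrow> c \<in> borel_measurable M"
    and nonneg: "\<And>n c x. c \<in> C n \<Longrightarrow> 0 \<le> c x"
    and mid: "\<And>n c d. c \<in> C n \<Longrightarrow> d \<in> C n \<Longrightarrow> (\<lambda>x. (c x + d x) / 2) \<in> C n"
    and bound: "\<And>c. c \<in> C 0 \<Longrightarrow> (\<integral>\<^sup>+x. ennreal (c x) \<partial>M) \<le> ennreal B"
  obtains c h where "\<And>n. c n \<in> C n" "h \<in> borel_measurable M" "\<And>x. 0 \<le> h x"
    "AE x in M. (\<lambda>n. c n x) \<longlonglongrightarrow> h x"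
proof -
  interpret finite_measure M by fact
  define I where "I c = (\<integral>x. exp (- c x) \<partial>M)" for c :: "'a \<Rightarrow> real"
  have int: "integrable M (\<lambda>x. exp (- c x))" if "c \<in> C n" for c n
    using meas[OF that] nonneg[OF that] by (intro integrable_const_bound[where B=1]) auto
  have I0: "0 \<le> I c" for c unfolding I_def by (intro Bochner_Integration.integral_nonneg) auto
  have I1: "I c \<le> measure M (space M)" if "c \<in> C n" for c n
  proof -
    have "I c \<le> (\<integral>x. 1 \<partial>M)" unfolding I_def
      using int[OF that] nonneg[OF that] by (intro integral_mono) auto
    then show ?thesis by simp
  qed
  define i where "i n = Inf (I ` C n)" for n
  have bdd: "bdd_below (I ` C n)" for n using I0 by (intro bdd_belowI[where m=0]) auto
  have i_le: "i n \<le> I c" if "c \<in> C n" for n c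
    unfolding i_def using that bdd by (intro cInf_lower) auto
  have i_mono: "i m \<le> i n" if "m \<le> n" for m n
    unfolding i_def using dec[OF that] ne bdd by (intro cInf_superset_mono) auto
  have i_bdd: "i n \<le> measure M (space M)" for n
    using ne[of n] i_le[of _ n] I1[of _ n] by (meson all_not_in_conv order_trans)
  obtain L where L: "i \<longlonglongrightarrow> L" "\<And>n. i n \<le> L"
    using incseq_convergent[of i "measure M (space M)"] i_mono i_bdd by (auto simp: incseq_def)
  \<comment> \<open>The index r is taken so large that the infimum over \<open>C r\<close> is within
    the tolerance of the limit \<open>L\<close>. Midpoints of consecutive choices lie in the earlier
    of their two sets and so cannot fall far below \<open>L\<close>. The rate 1/4 leaves room for
    the factor 2^n lost below.\<close>
  have "\<exists>c r. r \<ge> n \<and> c \<in> C r \<and> L - (1/4)^n < i r \<and> I c < L + (1/4)^n" for n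
  proof -
    have "\<forall>\<^sub>F r in sequentially. L - (1/4)^n < i r"
      using L(1) by (rule order_tendstoD) simp
    then obtain N where N: "\<And>r. r \<ge> N \<Longrightarrow> L - (1/4)^n < i r" by (auto simp: eventually_sequentially)
    define r where "r = max N n"
    have "Inf (I ` C r) < L + (1/4)^n" using L(2)[of r] unfolding i_def
      by (smt (verit) zero_less_power zero_less_divide_1_iff)
    then obtain y where "y \<in> I ` C r" "y < L + (1/4)^n"
      using ne by (subst (asm) cInf_less_iff) (auto simp: bdd)
    then obtain c where "c \<in> C r" "I c < L + (1/4)^n" by auto
    then show ?thesis using N[of r] by (auto simp: r_def intro!: exI[of _ r] exI[of _ c])
  qed
  then obtain c r where r: "\<And>n. r n \<ge> n" and cr: "\<And>n. c n \<in> C (r n)"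
    and ir: "\<And>n. L - (1/4)^n < i (r n)" and Ic: "\<And>n. I (c n) < L + (1/4)^n"
    by metis
  have c: "c n \<in> C n" for n using cr dec[OF r] by auto
  have [measurable]: "c n \<in> borel_measurable M" for n using meas[OF c] .
  define f where "f n x = exp (- (c n x / 2))" for n x
  have [measurable]: "f n \<in> borel_measurable M" for n unfolding f_def by measurable
  have pow: "(1/4::real) ^ Suc n \<le> (1/4) ^ n" for n by simp
  have sq: "(\<integral>x. (f n x - f (Suc n) x)\<^sup>2 \<partial>M) \<le> 4 * (1/4)^n"
    and sqi: "integrable M (\<lambda>x. (f n x - f (Suc n) x)\<^sup>2)" for n
  proof -
    define R where "R = min (r n) (r (Suc n))"
    have "c n \<in> C R" "c (Suc n) \<in> C R" using cr dec[of R "r n"] dec[of R "r (Suc n)"] by (auto simp: R_def)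
    then have m: "(\<lambda>x. (c n x + c (Suc n) x) / 2) \<in> C R" by (rule mid)
    have "L - (1/4)^n < i R" using ir[of n] ir[of "Suc n"] pow[of n] unfolding R_def min_def
      by (smt (verit))
    also have "i R \<le> I (\<lambda>x. (c n x + c (Suc n) x) / 2)" using m by (rule i_le)
    finally have low: "L - (1/4)^n < I (\<lambda>x. (c n x + c (Suc n) x) / 2)" .
    have i1: "integrable M (\<lambda>x. exp (- c n x))" "integrable M (\<lambda>x. exp (- c (Suc n) x))"
      "integrable M (\<lambda>x. exp (- ((c n x + c (Suc n) x) / 2)))"
      using int[OF c] int[OF m] by auto
    have eq: "(\<lambda>x. (f n x - f (Suc n) x)\<^sup>2) =
      (\<lambda>x. exp (- c n x) + exp (- c (Suc n) x) - 2 * exp (- ((c n x + c (Suc n) x) / 2)))"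
    proof (rule ext)
      fix x
      show "(f n x - f (Suc n) x)\<^sup>2 =
        exp (- c n x) + exp (- c (Suc n) x) - 2 * exp (- ((c n x + c (Suc n) x) / 2))"
        using midpoint_exp_identity[of "c n x" "c (Suc n) x"] unfolding f_def by linarith
    qed
    show "integrable M (\<lambda>x. (f n x - f (Suc n) x)\<^sup>2)" unfolding eq using i1 by auto
    have "(\<integral>x. (f n x - f (Suc n) x)\<^sup>2 \<partial>M)
        = I (c n) + I (c (Suc n)) - 2 * I (\<lambda>x. (c n x + c (Suc n) x) / 2)"
      unfolding eq I_def using i1 by simp
    also have "\<dots> \<le> 4 * (1/4)^n" using low Ic[of n] Ic[of "Suc n"] pow[of n] by linarith
    finally show "(\<integral>x. (f n x - f (Suc n) x)\<^sup>2 \<partial>M) \<le> 4 * (1/4)^n" .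
  qed
  define K where "K = measure M (space M)"
  have inc: "(\<integral>\<^sup>+x. ennreal \<bar>f (Suc n) x - f n x\<bar> \<partial>M) \<le> ennreal ((K + 4) * (1/2)^n)" for n
  proof -
    \<comment> \<open>Splitting at the threshold 2^-n turns the bound of order 4^-n on the integral
      of the square into one of order 2^-n on the integral of the modulus, which is
      summable.\<close>
    have pt: "\<bar>f (Suc n) x - f n x\<bar> \<le> (1/2)^n + 2^n * (f n x - f (Suc n) x)\<^sup>2" for x
    proof -
      let ?d = "\<bar>f (Suc n) x - f n x\<bar>"
      have "?d \<le> (1/2)^n + 2^n * ?d\<^sup>2"
      proof (cases "?d \<le> (1/2)^n")
        case True
        then show ?thesis by (smt (verit) zero_le_power2 zero_le_power mult_nonneg_nonneg)
      next
        case False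
        then have "1 \<le> 2^n * ?d" by (simp add: field_simps power_divide)
        then have "?d * 1 \<le> ?d * (2^n * ?d)" by (intro mult_left_mono) auto
        then show ?thesis by (simp add: power2_eq_square mult_ac) (smt (verit) zero_le_power zero_le_divide_1_iff)
      qed
      then show ?thesis by (simp add: power2_commute)
    qed
    have "(\<integral>\<^sup>+x. ennreal \<bar>f (Suc n) x - f n x\<bar> \<partial>M)
        \<le> (\<integral>\<^sup>+x. ennreal ((1/2)^n + 2^n * (f n x - f (Suc n) x)\<^sup>2) \<partial>M)"
      using pt by (intro nn_integral_mono ennreal_leI)
    also have "\<dots> = ennreal (\<integral>x. (1/2)^n + 2^n * (f n x - f (Suc n) x)\<^sup>2 \<partial>M)"
      using sqi by (intro nn_integral_eq_integral) auto
    also have "(\<integral>x. (1/2)^n + 2^n * (f n x - f (Suc n) x)\<^sup>2 \<partial>M) = K * (1/2)^n + 2^n * (\<integral>x. (f n x - f (Suc n) x)\<^sup>2 \<partial>M)"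
      using sqi by (simp add: K_def)
    also have "\<dots> \<le> K * (1/2)^n + 2^n * (4 * (1/4)^n)"
      using sq by (intro add_left_mono mult_left_mono) auto
    also have "2^n * (4 * (1/4::real)^n) = 4 * (1/2)^n"
      by (simp add: power_divide field_simps power_mult_distrib[symmetric])
    finally show ?thesis by (simp add: algebra_simps ennreal_leI)
  qed
  have conv: "AE x in M. convergent (\<lambda>n. f n x)"
  proof (rule AE_convergent_of_summable_L1_increments[where a="\<lambda>n. (K + 4) * (1/2)^n"])
    show "(\<integral>\<^sup>+x. ennreal \<bar>f (Suc n) x - f n x\<bar> \<partial>M) \<le> ennreal ((K + 4) * (1/2)^n)" for n
      by (rule inc)
    show "0 \<le> (K + 4) * (1/2)^n" for n by (simp add: K_def)
    show "summable (\<lambda>n. (K + 4) * (1/2)^n)" by (intro summable_mult summable_geometric) simp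
  qed simp
  \<comment> \<open>If exp(-c/2) tended to 0, then c would tend to \<infinity>; the uniform L^1
    bound and Fatou's lemma exclude this almost everywhere.\<close>
  have "(\<integral>\<^sup>+x. liminf (\<lambda>n. ennreal (c n x)) \<partial>M) \<le> liminf (\<lambda>n. \<integral>\<^sup>+x. ennreal (c n x) \<partial>M)"
    by (intro nn_integral_liminf) auto
  also have "\<dots> \<le> liminf (\<lambda>n. ennreal B)"
    using c dec[of 0] by (intro Liminf_mono always_eventually allI bound) blast
  also have "\<dots> < \<infinity>" by (simp add: Liminf_const)
  finally have fin: "AE x in M. liminf (\<lambda>n. ennreal (c n x)) \<noteq> \<infinity>"
    by (intro nn_integral_PInf_AE) auto
  define h where "h x = max 0 (lim (\<lambda>n. c n x))" for x
  have "AE x in M. (\<lambda>n. c n x) \<longlonglongrightarrow> h x"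
    using conv fin
  proof eventually_elim
    case (elim x)
    obtain l where l: "(\<lambda>n. f n x) \<longlonglongrightarrow> l" using elim(1) by (auto simp: convergent_def)
    have "0 \<le> l" by (rule LIMSEQ_le_const[OF l]) (auto simp: f_def)
    have cf: "c n x = - (2 * ln (f n x))" for n by (simp add: f_def)
    show ?case
    proof (cases "l = 0")
      case True
      have "filterlim (\<lambda>n. f n x) (at_right 0) sequentially"
        using l True by (auto simp: filterlim_at f_def)
      then have "filterlim (\<lambda>n. ln (f n x)) at_bot sequentially"
        by (rule filterlim_compose[OF ln_at_0])
      then have "filterlim (\<lambda>n. - (2 * ln (f n x))) at_top sequentially"
        unfolding filterlim_uminus_at_top minus_minus
        by (rule filterlim_tendsto_pos_mult_at_bot[OF tendsto_const zero_less_numeral])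
      then have top: "filterlim (\<lambda>n. c n x) at_top sequentially" by (simp only: cf)
      have "(\<lambda>n. ennreal (c n x)) \<longlonglongrightarrow> \<infinity>"
        unfolding infinity_ennreal_def by (rule ennreal_tendsto_top_eq_at_top[THEN iffD2, OF top])
      then have "liminf (\<lambda>n. ennreal (c n x)) = \<infinity>" by (simp add: lim_imp_Liminf)
      then show ?thesis using elim(2) by simp
    next
      case False
      then have "(\<lambda>n. - (2 * ln (f n x))) \<longlonglongrightarrow> - (2 * ln l)"
        using l by (intro tendsto_intros) auto
      then have lim: "(\<lambda>n. c n x) \<longlonglongrightarrow> - (2 * ln l)" by (simp only: cf)
      moreover have "0 \<le> - (2 * ln l)" by (rule LIMSEQ_le_const[OF lim]) (use nonneg[OF c] in auto)
      ultimately show ?thesis unfolding h_def by (simp add: limI max_def)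
    qed
  qed
  moreover have "h \<in> borel_measurable M" unfolding h_def by measurable
  ultimately show ?thesis using that[of c h] c by (auto simp: h_def)
qed

text \<open>Lower semicontinuity and Fatou's lemma give the first claim. The second is Vitali's
  argument: truncations converge by dominated convergence, and superlinearity of
  \<open>supaff\<close> makes the tails above a large level uniformly small.\<close>

lemma supaff_bounded_L1_convergence:
  fixes c :: "nat \<Rightarrow> 'a \<Rightarrow> real"
  assumes "finite_measure M"
    and [measurable]: "\<And>n. c n \<in> borel_measurable M" "h \<in> borel_measurable M"
    and nonneg: "\<And>n x. 0 \<le> c n x" "\<And>x. 0 \<le> h x"
    and lim: "AE x in M. (\<lambda>n. c n x) \<longlonglongrightarrow> h x"
    and bnd: "\<And>n. (\<integral>\<^sup>+x. supaff b (c n x) \<partial>M) \<le> ennreal (D n)"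
    and D: "D \<longlonglongrightarrow> D0" "\<And>n. D n \<le> D1"
  shows "(\<integral>\<^sup>+x. supaff b (h x) \<partial>M) \<le> ennreal D0"
    and "(\<lambda>n. \<integral>\<^sup>+x. ennreal \<bar>c n x - h x\<bar> \<partial>M) \<longlonglongrightarrow> 0"
proof -
  interpret finite_measure M by fact
  have "(\<integral>\<^sup>+x. supaff b (h x) \<partial>M) \<le> (\<integral>\<^sup>+x. liminf (\<lambda>n. supaff b (c n x)) \<partial>M)"
    using lim by (intro nn_integral_mono_AE) (auto elim!: eventually_mono intro: supaff_le_liminf)
  also have "\<dots> \<le> liminf (\<lambda>n. \<integral>\<^sup>+x. supaff b (c n x) \<partial>M)" by (intro nn_integral_liminf) auto
  also have "\<dots> \<le> liminf (\<lambda>n. ennreal (D n))" by (intro Liminf_mono always_eventually allI bnd)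
  also have "\<dots> = ennreal D0" using D by (intro lim_imp_Liminf) (auto intro: tendsto_intros)
  finally show h: "(\<integral>\<^sup>+x. supaff b (h x) \<partial>M) \<le> ennreal D0" .
  have D01: "D0 \<le> D1" using D by (intro LIMSEQ_le_const2[OF D(1)]) auto
  define E where "E = max 0 D1"
  \<comment> \<open>The affine function of slope p vanishes no later than at |b p| / p, so the part
    of k above that level is at most \<open>supaff b (k x)\<close> divided by p.\<close>
  have tail: "(\<integral>\<^sup>+x. ennreal (max 0 (k x - \<bar>b p\<bar> / p)) \<partial>M) \<le> ennreal (E / p)"
    if p: "0 < p" and [measurable]: "k \<in> borel_measurable M" and kb: "(\<integral>\<^sup>+x. supaff b (k x) \<partial>M) \<le> ennreal E" for p and k :: "'a \<Rightarrow> real"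
  proof -
    have "ennreal (max 0 (k x - \<bar>b p\<bar> / p)) \<le> ennreal (1/p) * supaff b (k x)" for x
    proof -
      have "ennreal (max 0 (k x - \<bar>b p\<bar> / p)) = ennreal (k x - \<bar>b p\<bar> / p)" by (auto simp: max_def ennreal_neg)
      also have "\<dots> \<le> ennreal ((1/p) * (p * k x - b p))"
        using p by (intro ennreal_leI) (simp add: field_simps)
      also have "\<dots> = ennreal (1/p) * ennreal (p * k x - b p)" using p by (intro ennreal_mult') simp
      also have "\<dots> \<le> ennreal (1/p) * supaff b (k x)" using p by (intro mult_left_mono supaff_upper) auto
      finally show ?thesis .
    qed
    then have "(\<integral>\<^sup>+x. ennreal (max 0 (k x - \<bar>b p\<bar> / p)) \<partial>M) \<le> (\<integral>\<^sup>+x. ennreal (1/p) * supaff b (k x) \<partial>M)"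
      by (intro nn_integral_mono)
    also have "\<dots> = ennreal (1/p) * (\<integral>\<^sup>+x. supaff b (k x) \<partial>M)" by (intro nn_integral_cmult) simp
    also have "\<dots> \<le> ennreal (1/p) * ennreal E" by (intro mult_left_mono kb) simp
    also have "\<dots> = ennreal (E / p)" using p by (simp add: ennreal_mult'[symmetric])
    finally show ?thesis .
  qed
  have cb: "(\<integral>\<^sup>+x. supaff b (c n x) \<partial>M) \<le> ennreal E" for n
    using bnd[of n] D(2)[of n] by (auto simp: E_def intro!: order_trans[OF bnd] ennreal_leI)
  have hb: "(\<integral>\<^sup>+x. supaff b (h x) \<partial>M) \<le> ennreal E"
    using D01 by (auto simp: E_def intro!: order_trans[OF h] ennreal_leI)
  have lims: "limsup (\<lambda>n. \<integral>\<^sup>+x. ennreal \<bar>c n x - h x\<bar> \<partial>M) \<le> 0 + ennreal e" if "0 < e" for e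
  proof -
    \<comment> \<open>The tails of \<open>c n\<close> and of h are at most E/p each, and 2 E / p = e
      E / (E + 1) does not exceed e; the added 1 keeps p positive when E = 0.\<close>
    define p where "p = 2 * (E + 1) / e"
    have p: "0 < p" using that by (auto simp: p_def E_def)
    define R where "R = \<bar>b p\<bar> / p"
    have R: "0 \<le> R" using p by (simp add: R_def)
    have two: "ennreal (E / p) + ennreal (E / p) \<le> ennreal e"
    proof -
      have "0 \<le> E / p" using p by (simp add: E_def)
      then have "ennreal (E / p) + ennreal (E / p) = ennreal (E / p + E / p)"
        by (intro ennreal_plus[symmetric])
      moreover have "0 < E + 1" by (simp add: E_def)
      moreover have "E / p + E / p = e * (E / (E + 1))"
      proof -
        have "E / p = e * (E / (E + 1)) / 2" by (simp add: p_def mult.commute)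
        then show ?thesis by (simp only: field_sum_of_halves)
      qed
      moreover have "e * (E / (E + 1)) \<le> e * 1" using that by (intro mult_left_mono) (auto simp: E_def)
      ultimately show ?thesis by (simp add: ennreal_leI)
    qed
    have dom: "(\<lambda>n. \<integral>\<^sup>+x. ennreal \<bar>min (c n x) R - min (h x) R\<bar> \<partial>M) \<longlonglongrightarrow> (\<integral>\<^sup>+x. 0 \<partial>M)"
    proof (rule nn_integral_dominated_convergence[where w="\<lambda>x. ennreal R"])
      show "AE x in M. ennreal \<bar>min (c j x) R - min (h x) R\<bar> \<le> ennreal R" for j
      proof (intro AE_I2 ennreal_leI)
        fix x
        show "\<bar>min (c j x) R - min (h x) R\<bar> \<le> R" using nonneg(1)[of j x] nonneg(2)[of x] R by linarith
      qed
      have "emeasure M (space M) < \<infinity>" by (metis emeasure_finite infinity_ennreal_def less_top)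
      then show "(\<integral>\<^sup>+x. ennreal R \<partial>M) < \<infinity>" by (simp add: ennreal_mult_less_top)
      show "AE x in M. (\<lambda>i. ennreal \<bar>min (c i x) R - min (h x) R\<bar>) \<longlonglongrightarrow> 0"
        using lim
      proof eventually_elim
        case (elim x)
        have "(\<lambda>i. ennreal \<bar>min (c i x) R - min (h x) R\<bar>) \<longlonglongrightarrow> ennreal \<bar>min (h x) R - min (h x) R\<bar>"
          using elim by (intro tendsto_intros)
        then show ?case by simp
      qed
    qed auto
    have "(\<integral>\<^sup>+x. ennreal \<bar>c n x - h x\<bar> \<partial>M) \<le> (\<integral>\<^sup>+x. ennreal \<bar>min (c n x) R - min (h x) R\<bar> \<partial>M) + ennreal e" for n
    proof -
      have "(\<integral>\<^sup>+x. ennreal \<bar>c n x - h x\<bar> \<partial>M) \<le> (\<integral>\<^sup>+x. ennreal \<bar>min (c n x) R - min (h x) R\<bar>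
          + (ennreal (max 0 (c n x - R)) + ennreal (max 0 (h x - R))) \<partial>M)"
      proof (rule nn_integral_mono)
        fix x
        have "\<bar>c n x - h x\<bar> \<le> \<bar>min (c n x) R - min (h x) R\<bar> + (max 0 (c n x - R) + max 0 (h x - R))"
          by (auto simp: min_def max_def abs_if)
        then have "ennreal \<bar>c n x - h x\<bar> \<le> ennreal (\<bar>min (c n x) R - min (h x) R\<bar> + (max 0 (c n x - R) + max 0 (h x - R)))"
          by (rule ennreal_leI)
        then show "ennreal \<bar>c n x - h x\<bar> \<le> ennreal \<bar>min (c n x) R - min (h x) R\<bar>
          + (ennreal (max 0 (c n x - R)) + ennreal (max 0 (h x - R)))"
          by (simp only: ennreal_plus abs_ge_zero max.cobounded1 add_nonneg_nonneg)
      qed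
      also have "\<dots> = (\<integral>\<^sup>+x. ennreal \<bar>min (c n x) R - min (h x) R\<bar> \<partial>M)
          + ((\<integral>\<^sup>+x. ennreal (max 0 (c n x - R)) \<partial>M) + (\<integral>\<^sup>+x. ennreal (max 0 (h x - R)) \<partial>M))"
        by (simp add: nn_integral_add)
      also have "\<dots> \<le> (\<integral>\<^sup>+x. ennreal \<bar>min (c n x) R - min (h x) R\<bar> \<partial>M) + (ennreal (E / p) + ennreal (E / p))"
        unfolding R_def using p cb hb by (intro add_left_mono add_mono tail) auto
      also have "\<dots> \<le> (\<integral>\<^sup>+x. ennreal \<bar>min (c n x) R - min (h x) R\<bar> \<partial>M) + ennreal e"
        by (intro add_left_mono two)
      finally show ?thesis .
    qed
    then have "limsup (\<lambda>n. \<integral>\<^sup>+x. ennreal \<bar>c n x - h x\<bar> \<partial>M)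
      \<le> limsup (\<lambda>n. (\<integral>\<^sup>+x. ennreal \<bar>min (c n x) R - min (h x) R\<bar> \<partial>M) + ennreal e)"
      by (intro Limsup_mono always_eventually allI)
    also have "\<dots> = 0 + ennreal e"
      using dom by (intro lim_imp_Limsup tendsto_add) auto
    finally show ?thesis .
  qed
  have "limsup (\<lambda>n. \<integral>\<^sup>+x. ennreal \<bar>c n x - h x\<bar> \<partial>M) \<le> 0"
    by (rule ennreal_le_epsilon, rule lims)
  then show "(\<lambda>n. \<integral>\<^sup>+x. ennreal \<bar>c n x - h x\<bar> \<partial>M) \<longlonglongrightarrow> 0"
    by (intro tendsto_0_if_Limsup_eq_0_ennreal) auto
qed

section \<open>Measures on the unit interval\<close>

text \<open>Exhaustion: N is a Lebesgue null set of largest possible mass. What remains off N is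
  then absolutely continuous and has a Radon-Nikodym density; restriction to N gives the singular
  part.\<close>

lemma Lebesgue_decomposition_borel:
  fixes \<mu>0 :: "real measure"
  assumes sets0: "sets \<mu>0 = sets borel" and fin: "finite_measure \<mu>0"
  obtains \<beta> \<mu> N where "\<beta> \<in> borel_measurable borel" "\<And>x. 0 \<le> \<beta> x" "integrable lborel \<beta>"
    "sets \<mu> = sets borel" "finite_measure \<mu>" "\<And>A. A \<in> sets borel \<Longrightarrow> emeasure \<mu> A \<le> emeasure \<mu>0 A"
    "N \<in> sets borel" "emeasure lborel N = 0" "emeasure \<mu> (UNIV - N) = 0"
    "\<And>A. A \<in> sets borel \<Longrightarrow> measure \<mu>0 A = (LINT x:A|lborel. \<beta> x) + measure \<mu> A"
proof -
  interpret m0: finite_measure \<mu>0 by fact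
  have sp0: "space \<mu>0 = UNIV" using sets_eq_imp_space_eq[OF sets0] by simp
  note [measurable_cong] = sets0
  have fin0: "emeasure \<mu>0 B < top" for B by (metis m0.emeasure_finite infinity_ennreal_def less_top)
  define S where "S = {A \<in> sets borel. emeasure lborel (A :: real set) = 0}"
  have S_bdd: "bdd_above (measure \<mu>0 ` S)"
    using m0.bounded_measure by (intro bdd_aboveI[where M="measure \<mu>0 (space \<mu>0)"]) auto
  have S_ne: "measure \<mu>0 ` S \<noteq> {}" by (auto simp: S_def intro!: exI[of _ "{}"])
  define s where "s = Sup (measure \<mu>0 ` S)"
  have "\<exists>A\<in>S. s - 1 / Suc k < measure \<mu>0 A" for k :: nat
  proof -
    have "s - 1 / Suc k < s" by simp
    then show ?thesis unfolding s_def using less_cSup_iff[OF S_ne S_bdd] by (metis imageE)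
  qed
  then obtain A where A: "\<And>k. A k \<in> S" "\<And>k::nat. s - 1 / Suc k < measure \<mu>0 (A k)" by metis
  define N where "N = (\<Union>k. A k)"
  have N: "N \<in> sets borel" "emeasure lborel N = 0"
  proof -
    show "N \<in> sets borel" using A(1) by (auto simp: N_def S_def)
    have "N \<in> null_sets lborel" unfolding N_def using A(1) by (intro null_sets_UN) (auto simp: S_def null_sets_def)
    then show "emeasure lborel N = 0" by auto
  qed
  note [measurable] = N(1)
  have sN: "s \<le> measure \<mu>0 N"
  proof (rule field_le_epsilon)
    fix e :: real assume "0 < e"
    then obtain k :: nat where k: "1 / Suc k < e" using nat_approx_posE by blast
    have "measure \<mu>0 (A k) \<le> measure \<mu>0 N"
      using A(1) N(1) by (intro m0.finite_measure_mono) (auto simp: N_def S_def sets0)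
    then show "s \<le> measure \<mu>0 N + e" using A(2)[of k] k by linarith
  qed
  define \<nu> where "\<nu> = density \<mu>0 (indicator (UNIV - N))"
  have sets\<nu>: "sets \<nu> = sets borel" by (simp add: \<nu>_def sets0)
  have em\<nu>: "emeasure \<nu> B = emeasure \<mu>0 (B - N)" if [measurable]: "B \<in> sets borel" for B
  proof -
    have "indicator (UNIV - N) x * indicator B x = (indicator (B - N) x :: ennreal)" for x
      by (auto simp: indicator_def)
    then show ?thesis unfolding \<nu>_def by (subst emeasure_density) simp_all
  qed
  \<comment> \<open>If a null set B had positive mass off N, then N \<union> B would be a null set
    whose mass exceeds the supremum s.\<close>
  have "absolutely_continuous lborel \<nu>"
    unfolding absolutely_continuous_def
  proof
    fix B :: "real set" assume B: "B \<in> null_sets lborel"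
    then have Bb [measurable]: "B \<in> sets borel" by auto
    have "N \<union> B \<in> null_sets lborel" using B N by (intro null_sets.Un) auto
    then have "N \<union> B \<in> S" by (auto simp: S_def)
    then have "measure \<mu>0 (N \<union> B) \<le> s" unfolding s_def using S_bdd by (intro cSup_upper) auto
    moreover have "measure \<mu>0 (N \<union> B) = measure \<mu>0 N + measure \<mu>0 (B - N)"
      using N(1) Bb m0.finite_measure_Union'[of N B] by (simp add: sets0)
    ultimately have "measure \<mu>0 (B - N) = 0" using sN measure_nonneg[of \<mu>0 "B - N"] by linarith
    then show "B \<in> null_sets \<nu>" using Bb by (simp add: null_sets_def em\<nu> sets\<nu> m0.emeasure_eq_measure)
  qed
  then obtain f where f: "f \<in> borel_measurable lborel" "density lborel f = \<nu>"
    using sigma_finite_measure.Radon_Nikodym[OF sigma_finite_lborel, of \<nu>] sets\<nu> by auto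
  have [measurable]: "f \<in> borel_measurable borel" using f(1) by simp
  have fA: "(\<integral>\<^sup>+x. f x * indicator B x \<partial>lborel) = emeasure \<mu>0 (B - N)" if [measurable]: "B \<in> sets borel" for B
    using em\<nu>[OF that] by (subst (asm) f(2)[symmetric]) (simp add: emeasure_density)
  have "(\<integral>\<^sup>+x. f x \<partial>lborel) < \<infinity>" using fA[of UNIV] fin0[of "UNIV - N"] by simp
  then have ffin: "AE x in lborel. f x \<noteq> \<infinity>" by (intro nn_integral_PInf_AE) auto
  define \<beta> where "\<beta> x = enn2real (f x)" for x
  have [measurable]: "\<beta> \<in> borel_measurable borel" unfolding \<beta>_def by measurable
  have \<beta>0: "0 \<le> \<beta> x" for x by (simp add: \<beta>_def)
  have \<beta>A: "(\<integral>\<^sup>+x. ennreal (indicator B x * \<beta> x) \<partial>lborel) = emeasure \<mu>0 (B - N)" if [measurable]: "B \<in> sets borel" for B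
  proof -
    have "(\<integral>\<^sup>+x. ennreal (indicator B x * \<beta> x) \<partial>lborel) = (\<integral>\<^sup>+x. f x * indicator B x \<partial>lborel)"
      using ffin by (intro nn_integral_cong_AE, eventually_elim)
        (auto simp: \<beta>_def indicator_def less_top[symmetric])
    then show ?thesis by (simp add: fA)
  qed
  have \<beta>int: "integrable lborel (\<lambda>x. indicator B x * \<beta> x)" if [measurable]: "B \<in> sets borel" for B
    using \<beta>A[of B] fin0[of "B - N"] \<beta>0 by (intro integrableI_nonneg) auto
  have \<beta>L: "(LINT x:B|lborel. \<beta> x) = measure \<mu>0 (B - N)" if [measurable]: "B \<in> sets borel" for B
  proof -
    have "(LINT x:B|lborel. \<beta> x) = enn2real (\<integral>\<^sup>+x. ennreal (indicator B x * \<beta> x) \<partial>lborel)"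
      unfolding set_lebesgue_integral_def real_scaleR_def using \<beta>0 by (intro integral_eq_nn_integral) auto
    then show ?thesis by (simp add: \<beta>A measure_def)
  qed
  define \<mu> where "\<mu> = density \<mu>0 (indicator N)"
  have em: "emeasure \<mu> B = emeasure \<mu>0 (B \<inter> N)" if [measurable]: "B \<in> sets borel" for B
  proof -
    have "indicator N x * indicator B x = (indicator (B \<inter> N) x :: ennreal)" for x
      by (auto simp: indicator_def)
    then show ?thesis unfolding \<mu>_def by (subst emeasure_density) simp_all
  qed
  show thesis
  proof (rule that)
    show "\<beta> \<in> borel_measurable borel" by simp
    show "0 \<le> \<beta> x" for x by (rule \<beta>0)
    show "integrable lborel \<beta>" using \<beta>int[of UNIV] by simp
    show "sets \<mu> = sets borel" by (simp add: \<mu>_def sets0)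
    show "finite_measure \<mu>" using em[of UNIV] m0.emeasure_finite[of N]
      by (intro finite_measureI) (simp add: \<mu>_def sp0)
    show "emeasure \<mu> B \<le> emeasure \<mu>0 B" if [measurable]: "B \<in> sets borel" for B
      unfolding em[OF that] by (intro emeasure_mono) auto
    show "N \<in> sets borel" "emeasure lborel N = 0" by fact+
    have "(UNIV - N) \<inter> N = {}" by auto
    then show "emeasure \<mu> (UNIV - N) = 0" by (subst em) (simp_all only: emeasure_empty N sets.compl_sets Compl_eq_Diff_UNIV[symmetric] borel_comp)
    show "measure \<mu>0 B = (LINT x:B|lborel. \<beta> x) + measure \<mu> B" if [measurable]: "B \<in> sets borel" for B
    proof -
      have "measure \<mu>0 B = measure \<mu>0 ((B - N) \<union> (B \<inter> N))" by (intro arg_cong[where f="measure \<mu>0"]) auto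
      also have "\<dots> = measure \<mu>0 (B - N) + measure \<mu>0 (B \<inter> N)"
        by (intro m0.finite_measure_Union) (auto simp: sets0)
      finally show ?thesis by (simp add: \<beta>L em measure_def)
    qed
  qed
qed

lemma AE_U01_dense:
  assumes "AE x in U01. x \<in> G" "0 \<le> a" "a < b" "b \<le> 1"
  obtains y where "y \<in> G" "a < y" "y < b"
proof -
  have "AE x in lborel. x \<in> {0<..<1} \<longrightarrow> x \<in> G" using assms(1) by (simp add: AE_U01)
  have "\<exists>y\<in>G. a < y \<and> y < b"
  proof (rule ccontr)
    assume neg: "\<not> ?thesis"
    have "AE x in lborel. x \<notin> {a<..<b}"
      using \<open>AE x in lborel. x \<in> {0<..<1} \<longrightarrow> x \<in> G\<close>
      by eventually_elim (use neg assms in auto)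
    then have "emeasure lborel {a<..<b} = 0"
      using AE_iff_measurable[of "{a<..<b}" lborel "\<lambda>x. x \<notin> {a<..<b}"] by (simp add: greaterThanLessThan_eq lessThan_def greaterThan_def Collect_conj_eq[symmetric])
    then show False using assms by simp
  qed
  then show ?thesis using that by auto
qed

text \<open>Q is monotone only on a set of full measure, so it is replaced by its right limits along
  G. These form a monotone right-continuous function, hence a Stieltjes measure, and agree with Q
  off a null set because the discontinuities are countable.\<close>

lemma monotone_AE_eq_measure:
  fixes Q :: "real \<Rightarrow> real"
  assumes G: "AE x in U01. x \<in> G" "G \<subseteq> {0<..<1}"
    and mono: "\<And>x y. x \<in> G \<Longrightarrow> y \<in> G \<Longrightarrow> x \<le> y \<Longrightarrow> Q x \<le> Q y"
    and range: "\<And>x. x \<in> G \<Longrightarrow> 0 \<le> Q x \<and> Q x \<le> K"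
  obtains \<mu>0 where "sets \<mu>0 = sets borel" "finite_measure \<mu>0" "emeasure \<mu>0 (UNIV - {0..1}) = 0"
    "measure \<mu>0 {0..1} = K" "AE x in U01. Q x = measure \<mu>0 {0..x}"
proof -
  \<comment> \<open>The value 0 left of 0 and the value K from 1 on turn the boundary jumps into
    atoms at 0 and 1 and fix the total mass at K.\<close>
  define R where "R x = (if x < 0 then 0 else if 1 \<le> x then K else Inf (Q ` (G \<inter> {x<..})))" for x
  have ne: "Q ` (G \<inter> {x<..}) \<noteq> {}" if "0 \<le> x" "x < 1" for x
    using AE_U01_dense[OF G(1) that] by auto
  have bdd: "bdd_below (Q ` (G \<inter> {x<..}))" for x
    using range by (intro bdd_belowI[where m=0]) auto
  have R_le: "R x \<le> Q y" if "y \<in> G" "x < y" for x y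
    using that G(2) range[of y] bdd[of x] by (auto simp: R_def intro!: cInf_lower)
  have R_ge: "c \<le> R x" if "\<And>y. y \<in> G \<Longrightarrow> x < y \<Longrightarrow> c \<le> Q y" "0 \<le> x" "x < 1" for x c
    using that ne[OF that(2,3)] by (auto simp: R_def intro!: cInf_greatest)
  have K0: "0 \<le> K" using ne[of 0] range by fastforce
  have R0: "0 \<le> R x" for x
    by (cases "0 \<le> x \<and> x < 1") (use R_ge[of x 0] range K0 in \<open>auto simp: R_def\<close>)
  have RK: "R x \<le> K" for x
  proof (cases "0 \<le> x \<and> x < 1")
    case True
    then obtain y where "y \<in> G" "x < y" using AE_U01_dense[OF G(1), of x 1] by auto
    then show ?thesis using R_le[of y x] range[of y] by linarith
  qed (use K0 in \<open>auto simp: R_def\<close>)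
  have R_mono: "R x \<le> R y" if "x \<le> y" for x y
  proof -
    consider "x < 0" | "1 \<le> y" | "0 \<le> x" "y < 1" by linarith
    then show ?thesis
    proof cases
      case 1 then show ?thesis using R0[of y] by (simp add: R_def)
    next
      case 2 then show ?thesis using RK[of x] K0 by (simp add: R_def)
    next
      case 3 then show ?thesis using that by (intro R_ge R_le) auto
    qed
  qed
  have R_right: "continuous (at_right a) R" for a
    unfolding continuous_within
  proof (rule order_tendstoI)
    fix c assume "c < R a"
    then have "c < R x" if "a < x" for x using R_mono[of a x] that by linarith
    then show "\<forall>\<^sub>F x in at_right a. c < R x" by (intro eventually_at_rightI[of a "a+1"]) auto
  next
    fix c assume c: "R a < c"
    have "\<exists>y>a. \<forall>x. a < x \<longrightarrow> x < y \<longrightarrow> R x < c"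
    proof -
      consider "a < 0" | "1 \<le> a" | "0 \<le> a" "a < 1" by linarith
      then show ?thesis
      proof cases
        case 1
        then show ?thesis using c by (intro exI[of _ 0]) (auto simp: R_def)
      next
        case 2
        then show ?thesis using c by (intro exI[of _ "a+1"]) (auto simp: R_def)
      next
        case 3
        then have "Inf (Q ` (G \<inter> {a<..})) < c" using c by (simp add: R_def)
        then obtain y where "y \<in> G" "a < y" "Q y < c"
          using cInf_less_iff[OF ne[OF 3] bdd] by auto
        then show ?thesis using R_le[of y] by (intro exI[of _ y]) (auto intro: le_less_trans)
      qed
    qed
    then show "\<forall>\<^sub>F x in at_right a. R x < c" by (auto simp: eventually_at_right_field)
  qed
  define \<mu>0 where "\<mu>0 = interval_measure R"
  have Ioc: "emeasure \<mu>0 {a<..c} = ennreal (R c - R a)" if "a \<le> c" for a c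
    unfolding \<mu>0_def using that R_mono R_right by (intro emeasure_interval_measure_Ioc) auto
  have sets0: "sets \<mu>0 = sets borel" by (simp add: \<mu>0_def)
  have neg: "{..<0} \<in> null_sets \<mu>0"
  proof -
    have eq: "{..<0::real} = (\<Union>n::nat. {- real (Suc n)<..- 1 / real (Suc n)})"
    proof (intro set_eqI iffI)
      fix x :: real assume "x \<in> {..<0}"
      then obtain n1 n2 :: nat where "- x < real n1" "1 / Suc n2 < - x"
        using reals_Archimedean2 nat_approx_posE[of "- x"] by (metis lessThan_iff neg_0_less_iff_less)
      moreover have "1 / real (Suc (max n1 n2)) \<le> 1 / real (Suc n2)" by (intro divide_left_mono) auto
      moreover have "real n1 \<le> real (Suc (max n1 n2))" by simp
      ultimately show "x \<in> (\<Union>n::nat. {- real (Suc n)<..- 1 / real (Suc n)})"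
        by (intro UN_I[of "max n1 n2"]) auto
    next
      fix x :: real assume "x \<in> (\<Union>n::nat. {- real (Suc n)<..- 1 / real (Suc n)})"
      then obtain n :: nat where "x \<le> - 1 / real (Suc n)" by auto
      moreover have "- 1 / real (Suc n) < 0" by simp
      ultimately show "x \<in> {..<0}" by (metis lessThan_iff le_less_trans)
    qed
    have nl: "{- real (Suc n)<..- 1 / real (Suc n)} \<in> null_sets \<mu>0" for n
    proof -
      have "1 / real (Suc n) \<le> 1" by simp
      then have le: "- real (Suc n) \<le> - 1 / real (Suc n)" by (simp add: field_simps)
      have "R (- 1 / real (Suc n)) = 0" "R (- real (Suc n)) = 0" by (auto simp: R_def)
      then show ?thesis using Ioc[OF le] by (simp add: null_sets_def sets0)
    qed
    show ?thesis unfolding eq by (intro null_sets_UN nl)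
  qed
  have pos: "{1<..} \<in> null_sets \<mu>0"
  proof -
    have eq: "{1::real<..} = (\<Union>n::nat. {1<..1 + real n})"
    proof (intro set_eqI iffI)
      fix x :: real assume "x \<in> {1<..}"
      then show "x \<in> (\<Union>n::nat. {1<..1 + real n})" using real_arch_simple[of "x - 1"] by (auto simp: algebra_simps)
    qed auto
    have nl: "{1<..1 + real n} \<in> null_sets \<mu>0" for n
      using Ioc[of 1 "1 + real n"] by (simp add: null_sets_def sets0 R_def)
    show ?thesis unfolding eq by (intro null_sets_UN nl)
  qed
  have Icc: "emeasure \<mu>0 {0..x} = ennreal (R x)" if "0 \<le> x" for x
  proof -
    have "{-1<..<0} \<in> null_sets \<mu>0"
      using neg by (rule null_sets_subset) (auto simp: sets0)
    moreover have "{-1<..x} = {0..x} \<union> {-1<..<0}" using that by auto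
    ultimately have "emeasure \<mu>0 {-1<..x} = emeasure \<mu>0 {0..x}"
      by (simp add: emeasure_Un_null_set sets0)
    then show ?thesis using Ioc[of "-1" x] that by (simp add: R_def)
  qed
  have out: "UNIV - {0..1} \<in> null_sets \<mu>0"
  proof -
    have "UNIV - {0..1::real} = {..<0} \<union> {1<..}" by auto
    then show ?thesis using neg pos by auto
  qed
  have "AE x in lborel. isCont R x"
  proof -
    have "countable {x. \<not> isCont R x}" using R_mono by (intro mono_ctble_discont) (auto simp: mono_def)
    then have "{x. \<not> isCont R x} \<in> null_sets lborel" by (rule countable_imp_null_set_lborel)
    then show ?thesis by (rule AE_I') auto
  qed
  then have "AE x in U01. isCont R x" unfolding AE_U01 by (rule AE_mp) simp
  with G(1) have AEQ: "AE x in U01. Q x = measure \<mu>0 {0..x}"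
  proof eventually_elim
    case (elim x)
    then have x: "x \<in> G" "0 < x" "x < 1" using G(2) by auto
    have "Q x \<le> R x" using x mono by (intro R_ge) auto
    \<comment> \<open>At a continuity point, R x > Q x would persist at some y < x, whereas R y
      \<le> Q x because x is a point of G to the right of y.\<close>
    moreover have "R x \<le> Q x"
    proof (rule ccontr)
      assume "\<not> R x \<le> Q x"
      then have "Q x < R x" by simp
      then have "\<forall>\<^sub>F y in at x. Q x < R y" using elim(2) by (intro order_tendstoD(1)) (auto simp: isCont_def)
      then have "\<forall>\<^sub>F y in at_left x. Q x < R y" by (rule filter_leD[OF at_le, rotated]) auto
      then obtain y where "y < x" "Q x < R y"
        unfolding eventually_at_left_field using dense by blast
      then show False using R_le[OF x(1), of y] by linarith
    qed
    ultimately show ?case using Icc[of x] x R0[of x] by (simp add: measure_def)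
  qed
  have fin: "finite_measure \<mu>0"
  proof (rule finite_measureI)
    have "emeasure \<mu>0 (space \<mu>0) = emeasure \<mu>0 ({0..1} \<union> (UNIV - {0..1}))"
      by (intro arg_cong[where f="emeasure \<mu>0"]) (auto simp: \<mu>0_def)
    also have "\<dots> = emeasure \<mu>0 {0..1}" using out by (intro emeasure_Un_null_set) (auto simp: sets0)
    finally show "emeasure \<mu>0 (space \<mu>0) \<noteq> \<infinity>" using Icc[of 1] by simp
  qed
  show thesis
  proof (rule that[OF sets0 fin _ _ AEQ])
    show "emeasure \<mu>0 (UNIV - {0..1}) = 0" using out by auto
    show "measure \<mu>0 {0..1} = K" using Icc[of 1] K0 by (simp add: measure_def R_def)
  qed
qed

lemma set_integrable_of_U01:
  assumes [measurable]: "h \<in> borel_measurable borel" and "(\<integral>\<^sup>+x. ennreal \<bar>h x\<bar> \<partial>U01) < \<infinity>"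
  shows "set_integrable lborel {0..1} (h :: real \<Rightarrow> real)"
  unfolding set_integrable_def
proof (rule integrableI_bounded)
  have "(\<integral>\<^sup>+x. ennreal (norm (indicator {0..1} x *\<^sub>R h x)) \<partial>lborel)
      = (\<integral>\<^sup>+x. ennreal \<bar>h x\<bar> * indicator {0<..<1} x \<partial>lborel)"
    using AE_lborel_singleton[of "0::real"] AE_lborel_singleton[of "1::real"]
    by (intro nn_integral_cong_AE, eventually_elim) (auto simp: indicator_def)
  also have "\<dots> < \<infinity>" using assms(2) by (simp add: nn_integral_U01)
  finally show "(\<integral>\<^sup>+x. ennreal (norm (indicator {0..1} x *\<^sub>R h x)) \<partial>lborel) < \<infinity>" .
qed simp

lemma set_integral_diff_le_U01:
  fixes a b :: "real \<Rightarrow> real"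
  assumes [measurable]: "a \<in> borel_measurable borel" "b \<in> borel_measurable borel"
    and "set_integrable lborel {0..1} a" "set_integrable lborel {0..1} b" "x \<le> 1"
  shows "ennreal \<bar>(LINT t:{0..x}|lborel. a t) - (LINT t:{0..x}|lborel. b t)\<bar> \<le> (\<integral>\<^sup>+t. ennreal \<bar>a t - b t\<bar> \<partial>U01)"
proof -
  have i: "set_integrable lborel {0..x} a" "set_integrable lborel {0..x} b"
    using assms by (auto intro: set_integrable_subset)
  have "(LINT t:{0..x}|lborel. a t) - (LINT t:{0..x}|lborel. b t) = (LINT t:{0..x}|lborel. a t - b t)"
    using i by (simp add: set_integral_diff)
  moreover have "ennreal \<bar>LINT t:{0..x}|lborel. a t - b t\<bar> \<le> (\<integral>\<^sup>+t. ennreal (norm (indicator {0..x} t *\<^sub>R (a t - b t))) \<partial>lborel)"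
    using integral_norm_bound_ennreal[OF set_integral_diff(1)[OF i, unfolded set_integrable_def]]
    by (simp add: set_lebesgue_integral_def)
  moreover have "\<dots> \<le> (\<integral>\<^sup>+t. ennreal \<bar>a t - b t\<bar> * indicator {0<..<1} t \<partial>lborel)"
    using AE_lborel_singleton[of "0::real"] AE_lborel_singleton[of "1::real"]
    by (intro nn_integral_mono_AE, eventually_elim) (use assms(5) in \<open>auto simp: indicator_def\<close>)
  ultimately show ?thesis by (simp add: nn_integral_U01)
qed

section \<open>Limits of functions with bounded energy\<close>

text \<open>Slope deficits $h = (\gamma - u')^+$ of functions close to \<^term>\<open>u\<close> with energy at most
  $m + D$, up to an error \<^term>\<open>\<delta>\<close>. The condition is phrased through the increasing function
  \<^term>\<open>P\<close> so that it is convex in \<^term>\<open>h\<close>.\<close>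

definition competitors ::
  "(real \<Rightarrow> real) \<Rightarrow> real \<Rightarrow> real \<Rightarrow> real \<Rightarrow> (real \<Rightarrow> real) \<Rightarrow> real \<Rightarrow> (real \<Rightarrow> real) set" where
  "competitors b ell \<gamma> D u \<delta> = {h. h \<in> borel_measurable borel \<and> (\<forall>x. 0 \<le> h x) \<and>
     (\<integral>\<^sup>+x. supaff b (h x) \<partial>U01) \<le> ennreal (D + \<delta>) \<and>
     (\<exists>P\<in>borel_measurable borel. (\<forall>x y. 0 < x \<longrightarrow> x \<le> y \<longrightarrow> y < 1 \<longrightarrow> P x \<le> P y) \<and>
       (\<forall>x. 0 < x \<longrightarrow> x < 1 \<longrightarrow> 0 \<le> P x \<and> P x \<le> ell - \<gamma> + (LINT t:{0..1}|lborel. h t) + \<delta>) \<and>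
       (\<integral>\<^sup>+x. ennreal \<bar>u x - \<gamma> * x + (LINT t:{0..x}|lborel. h t) - P x\<bar> \<partial>U01) \<le> ennreal \<delta>)}"

lemma competitors_L1_bound:
  assumes "h \<in> competitors b ell \<gamma> D u \<delta>"
  shows "(\<integral>\<^sup>+x. ennreal (h x) \<partial>U01) \<le> ennreal (max 0 (D + \<delta>) + \<bar>b 1\<bar>)"
proof -
  interpret finite_measure U01 by (rule finite_measure_U01)
  have [measurable]: "h \<in> borel_measurable borel" using assms by (simp add: competitors_def)
  have "(\<integral>\<^sup>+x. ennreal (h x) \<partial>U01) \<le> (\<integral>\<^sup>+x. supaff b (h x) + ennreal \<bar>b 1\<bar> \<partial>U01)"
    using supaff_superlinear[of 1 _ b] by (intro nn_integral_mono) auto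
  also have "\<dots> = (\<integral>\<^sup>+x. supaff b (h x) \<partial>U01) + ennreal \<bar>b 1\<bar>"
    by (subst nn_integral_add) (auto simp: emeasure_U01)
  also have "\<dots> \<le> ennreal (max 0 (D + \<delta>)) + ennreal \<bar>b 1\<bar>"
    using assms unfolding competitors_def by (intro add_right_mono) (auto intro: order_trans[OF _ ennreal_leI])
  also have "\<dots> = ennreal (max 0 (D + \<delta>) + \<bar>b 1\<bar>)" by simp
  finally show ?thesis .
qed

lemma competitors_set_integrable:
  assumes "h \<in> competitors b ell \<gamma> D u \<delta>"
  shows "set_integrable lborel {0..1} h"
proof (rule set_integrable_of_U01)
  show "h \<in> borel_measurable borel" using assms by (simp add: competitors_def)
  have "\<bar>h x\<bar> = h x" for x using assms by (simp add: competitors_def)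
  then show "(\<integral>\<^sup>+x. ennreal \<bar>h x\<bar> \<partial>U01) < \<infinity>"
    using le_less_trans[OF competitors_L1_bound[OF assms]] by simp
qed

lemma competitors_mono:
  assumes "\<delta> \<le> \<delta>'" shows "competitors b ell \<gamma> D u \<delta> \<subseteq> competitors b ell \<gamma> D u \<delta>'"
proof
  fix h assume h: "h \<in> competitors b ell \<gamma> D u \<delta>"
  then obtain P where P: "P \<in> borel_measurable borel" "\<forall>x y. 0 < x \<longrightarrow> x \<le> y \<longrightarrow> y < 1 \<longrightarrow> P x \<le> P y"
    "\<forall>x. 0 < x \<longrightarrow> x < 1 \<longrightarrow> 0 \<le> P x \<and> P x \<le> ell - \<gamma> + (LINT t:{0..1}|lborel. h t) + \<delta>"
    "(\<integral>\<^sup>+x. ennreal \<bar>u x - \<gamma> * x + (LINT t:{0..x}|lborel. h t) - P x\<bar> \<partial>U01) \<le> ennreal \<delta>"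
    unfolding competitors_def by auto
  have e: "ennreal \<delta> \<le> ennreal \<delta>'" "ennreal (D + \<delta>) \<le> ennreal (D + \<delta>')" using assms by (auto intro: ennreal_leI)
  have P3: "\<forall>x. 0 < x \<longrightarrow> x < 1 \<longrightarrow> 0 \<le> P x \<and> P x \<le> ell - \<gamma> + (LINT t:{0..1}|lborel. h t) + \<delta>'"
    using P(3) assms by (smt (verit))
  show "h \<in> competitors b ell \<gamma> D u \<delta>'"
    unfolding competitors_def
    using h P(1,2) P3 order_trans[OF P(4) e(1)] e(2) unfolding competitors_def by (auto intro: order_trans)
qed

lemma measurable_set_integral_upto [measurable]:
  fixes h :: "real \<Rightarrow> real"
  assumes [measurable]: "h \<in> borel_measurable borel"
  shows "(\<lambda>x. LINT t:{0..x}|lborel. h t) \<in> borel_measurable borel"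
  unfolding set_lebesgue_integral_def
proof -
  interpret sigma_finite_measure "lborel :: real measure" by (rule sigma_finite_lborel)
  have "(\<lambda>x. \<integral>t. (if 0 \<le> t \<and> t \<le> x then h t else 0) \<partial>lborel) \<in> borel_measurable borel"
    by measurable
  moreover have "(\<lambda>x. \<integral>t. indicator {0..x} t *\<^sub>R h t \<partial>lborel) = (\<lambda>x. \<integral>t. (if 0 \<le> t \<and> t \<le> x then h t else 0) \<partial>lborel)"
    by (intro ext Bochner_Integration.integral_cong) (auto simp: indicator_def)
  ultimately show "(\<lambda>x. \<integral>t. indicator {0..x} t *\<^sub>R h t \<partial>lborel) \<in> borel_measurable borel" by simp
qed

text \<open>Every condition is convex in the pair (h, P), so averaging the two witnesses gives a
  witness for the average.\<close>

lemma competitors_midpoint: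
  assumes [measurable]: "u \<in> borel_measurable borel"
    and h: "h \<in> competitors b ell \<gamma> D u \<delta>" and k: "k \<in> competitors b ell \<gamma> D u \<delta>"
  shows "(\<lambda>x. (h x + k x) / 2) \<in> competitors b ell \<gamma> D u \<delta>"
proof -
  have [measurable]: "h \<in> borel_measurable borel" "k \<in> borel_measurable borel"
    using h k by (auto simp: competitors_def)
  obtain P where P [measurable]: "P \<in> borel_measurable borel" and P': "\<forall>x y. 0 < x \<longrightarrow> x \<le> y \<longrightarrow> y < 1 \<longrightarrow> P x \<le> P y"
    "\<forall>x. 0 < x \<longrightarrow> x < 1 \<longrightarrow> 0 \<le> P x \<and> P x \<le> ell - \<gamma> + (LINT t:{0..1}|lborel. h t) + \<delta>"
    "(\<integral>\<^sup>+x. ennreal \<bar>u x - \<gamma> * x + (LINT t:{0..x}|lborel. h t) - P x\<bar> \<partial>U01) \<le> ennreal \<delta>"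
    using h unfolding competitors_def by auto
  obtain R where R [measurable]: "R \<in> borel_measurable borel" and R': "\<forall>x y. 0 < x \<longrightarrow> x \<le> y \<longrightarrow> y < 1 \<longrightarrow> R x \<le> R y"
    "\<forall>x. 0 < x \<longrightarrow> x < 1 \<longrightarrow> 0 \<le> R x \<and> R x \<le> ell - \<gamma> + (LINT t:{0..1}|lborel. k t) + \<delta>"
    "(\<integral>\<^sup>+x. ennreal \<bar>u x - \<gamma> * x + (LINT t:{0..x}|lborel. k t) - R x\<bar> \<partial>U01) \<le> ennreal \<delta>"
    using k unfolding competitors_def by auto
  have half: "ennreal (1/2 * a) = ennreal (1/2) * ennreal a" for a by (rule ennreal_mult') simp
  have "ennreal (1/2) + ennreal (1/2) = 1" by (subst ennreal_plus[symmetric]) auto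
  then have halves: "ennreal (1/2) * ennreal a + ennreal (1/2) * ennreal a = ennreal a" for a
    by (simp only: distrib_right[symmetric] mult_1_left)
  have abs_half: "\<bar>w + (p + q) / 2 - (r + s) / 2\<bar> \<le> 1/2 * \<bar>w + p - r\<bar> + 1/2 * \<bar>w + q - s\<bar>"
    for w p q r s :: real
    by (simp add: abs_if field_simps)
  have lin: "(LINT t:{0..x}|lborel. (h t + k t) / 2) = ((LINT t:{0..x}|lborel. h t) + (LINT t:{0..x}|lborel. k t)) / 2"
    if "x \<le> 1" for x
  proof -
    have "set_integrable lborel {0..x} h" "set_integrable lborel {0..x} k"
      using that competitors_set_integrable[OF h] competitors_set_integrable[OF k] by (auto intro: set_integrable_subset)
    then show ?thesis by (simp add: set_integral_add)
  qed
  have "(\<integral>\<^sup>+x. supaff b ((h x + k x) / 2) \<partial>U01)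
      \<le> (\<integral>\<^sup>+x. ennreal (1/2) * supaff b (h x) + ennreal (1/2) * supaff b (k x) \<partial>U01)"
    by (intro nn_integral_mono supaff_midpoint)
  also have "\<dots> = ennreal (1/2) * (\<integral>\<^sup>+x. supaff b (h x) \<partial>U01) + ennreal (1/2) * (\<integral>\<^sup>+x. supaff b (k x) \<partial>U01)"
    by (simp add: nn_integral_add nn_integral_cmult)
  also have "\<dots> \<le> ennreal (1/2) * ennreal (D + \<delta>) + ennreal (1/2) * ennreal (D + \<delta>)"
    using h k unfolding competitors_def by (intro add_mono mult_left_mono) auto
  finally have F: "(\<integral>\<^sup>+x. supaff b ((h x + k x) / 2) \<partial>U01) \<le> ennreal (D + \<delta>)" unfolding halves .
  let ?e = "\<lambda>h P x. \<bar>u x - \<gamma> * x + (LINT t:{0..x}|lborel. h t) - P x\<bar>"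
  have "(\<integral>\<^sup>+x. ennreal (?e (\<lambda>x. (h x + k x) / 2) (\<lambda>x. (P x + R x) / 2) x) \<partial>U01)
      \<le> (\<integral>\<^sup>+x. ennreal (1/2) * ennreal (?e h P x) + ennreal (1/2) * ennreal (?e k R x) \<partial>U01)"
  proof (rule nn_integral_mono_AE)
    show "AE x in U01. ennreal (?e (\<lambda>x. (h x + k x) / 2) (\<lambda>x. (P x + R x) / 2) x)
      \<le> ennreal (1/2) * ennreal (?e h P x) + ennreal (1/2) * ennreal (?e k R x)"
      using AE_U01_in
    proof eventually_elim
      case (elim x)
      have "?e (\<lambda>x. (h x + k x) / 2) (\<lambda>x. (P x + R x) / 2) x \<le> (1/2) * ?e h P x + (1/2) * ?e k R x"
      proof -
        have "x \<le> 1" using elim by simp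
        show ?thesis unfolding lin[OF \<open>x \<le> 1\<close>] by (rule abs_half)
      qed
      then have "ennreal (?e (\<lambda>x. (h x + k x) / 2) (\<lambda>x. (P x + R x) / 2) x) \<le> ennreal ((1/2) * ?e h P x + (1/2) * ?e k R x)"
        by (rule ennreal_leI)
      also have "\<dots> = ennreal (1/2) * ennreal (?e h P x) + ennreal (1/2) * ennreal (?e k R x)"
        by (subst ennreal_plus) (simp_all only: half, simp_all)
      finally show ?case .
    qed
  qed
  also have "\<dots> = ennreal (1/2) * (\<integral>\<^sup>+x. ennreal (?e h P x) \<partial>U01) + ennreal (1/2) * (\<integral>\<^sup>+x. ennreal (?e k R x) \<partial>U01)"
    by (simp add: nn_integral_add nn_integral_cmult)
  also have "\<dots> \<le> ennreal (1/2) * ennreal \<delta> + ennreal (1/2) * ennreal \<delta>"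
    using P'(3) R'(3) by (intro add_mono mult_left_mono) auto
  finally have E: "(\<integral>\<^sup>+x. ennreal (?e (\<lambda>x. (h x + k x) / 2) (\<lambda>x. (P x + R x) / 2) x) \<partial>U01) \<le> ennreal \<delta>"
    unfolding halves .
  have mono: "\<forall>x y. 0 < x \<longrightarrow> x \<le> y \<longrightarrow> y < 1 \<longrightarrow> (P x + R x) / 2 \<le> (P y + R y) / 2"
    using P'(1) R'(1) by (simp add: add_mono)
  have rng: "\<forall>x. 0 < x \<longrightarrow> x < 1 \<longrightarrow> 0 \<le> (P x + R x) / 2 \<and>
      (P x + R x) / 2 \<le> ell - \<gamma> + (LINT t:{0..1}|lborel. (h t + k t) / 2) + \<delta>"
  proof (intro allI impI)
    have average: "0 \<le> (p + r) / 2 \<and> (p + r) / 2 \<le> A + (a + c) / 2 + d"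
      if "0 \<le> p" "p \<le> A + a + d" "0 \<le> r" "r \<le> A + c + d" for p r A a c d :: real
      using that by (simp add: field_simps)
    fix x :: real assume "0 < x" "x < 1"
    then have "0 \<le> P x" "P x \<le> ell - \<gamma> + (LINT t:{0..1}|lborel. h t) + \<delta>"
      "0 \<le> R x" "R x \<le> ell - \<gamma> + (LINT t:{0..1}|lborel. k t) + \<delta>" using P'(2) R'(2) by blast+
    then show "0 \<le> (P x + R x) / 2 \<and>
      (P x + R x) / 2 \<le> ell - \<gamma> + (LINT t:{0..1}|lborel. (h t + k t) / 2) + \<delta>"
      unfolding lin[OF order_refl] by (rule average)
  qed
  have nn: "\<forall>x. 0 \<le> (h x + k x) / 2" using h k by (auto simp: competitors_def)
  show ?thesis unfolding competitors_def mem_Collect_eq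
    using nn F E mono rng by (intro conjI bexI[of _ "\<lambda>x. (P x + R x) / 2"]) auto
qed

text \<open>The selected deficits converge in L^1, so their primitives converge at every point and
  the functions P converge almost everywhere. The limit inherits monotonicity and bounds, which is
  all that the construction of a measure asks for.\<close>

theorem competitors_limit:
  assumes [measurable]: "u \<in> borel_measurable borel" and "0 \<le> D"
    and ne: "\<And>\<delta>. 0 < \<delta> \<Longrightarrow> competitors b ell \<gamma> D u \<delta> \<noteq> {}"
  obtains g \<mu> where "g \<in> borel_measurable borel" "BV_rep ell u g \<mu>"
    "(\<integral>\<^sup>+x. supaff b (\<gamma> - g x) \<partial>U01) \<le> ennreal D"
proof -
  \<comment> \<open>Summable tolerances, so that the L^1 errors of the functions P tend to 0 almost
    everywhere along the whole sequence.\<close>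
  define \<delta> where "\<delta> n = (1/2::real)^n" for n :: nat
  have \<delta>0: "0 < \<delta> n" "\<delta> n \<le> 1" for n by (auto simp: \<delta>_def power_le_one)
  have \<delta>_lim: "\<delta> \<longlonglongrightarrow> 0" unfolding \<delta>_def by (intro LIMSEQ_power_zero) simp
  define C where "C n = competitors b ell \<gamma> D u (\<delta> n)" for n
  obtain c h where c: "\<And>n. c n \<in> C n" and h [measurable]: "h \<in> borel_measurable U01" and h0: "\<And>x. 0 \<le> h x"
    and ch: "AE x in U01. (\<lambda>n. c n x) \<longlonglongrightarrow> h x"
  proof (rule midpoint_convex_AE_convergent_selection[of U01 C "max 0 (D + \<delta> 0) + \<bar>b 1\<bar>"])
    show "C n \<subseteq> C m" if "m \<le> n" for m n
      unfolding C_def using that by (intro competitors_mono) (auto simp: \<delta>_def intro: power_decreasing)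
    show "C n \<noteq> {}" for n unfolding C_def using \<delta>0 by (intro ne)
    show "c \<in> borel_measurable U01" "0 \<le> c x" if "c \<in> C n" for n c x
      using that by (auto simp: C_def competitors_def)
    show "(\<lambda>x. (c x + d x) / 2) \<in> C n" if "c \<in> C n" "d \<in> C n" for n c d
      using that unfolding C_def by (intro competitors_midpoint) auto
    show "(\<integral>\<^sup>+x. ennreal (c x) \<partial>U01) \<le> ennreal (max 0 (D + \<delta> 0) + \<bar>b 1\<bar>)" if "c \<in> C 0" for c
      using that unfolding C_def by (rule competitors_L1_bound)
  qed (rule finite_measure_U01 | (rule that; assumption))+
  have [measurable]: "h \<in> borel_measurable borel" using h by simp
  have cm [measurable]: "c n \<in> borel_measurable borel" and c0: "0 \<le> c n x"
    and cF: "(\<integral>\<^sup>+x. supaff b (c n x) \<partial>U01) \<le> ennreal (D + \<delta> n)" for n x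
    using c[of n] by (auto simp: C_def competitors_def)
  have Dlim: "(\<lambda>n. D + \<delta> n) \<longlonglongrightarrow> D" using tendsto_add[OF tendsto_const \<delta>_lim, of D] by simp
  have hF: "(\<integral>\<^sup>+x. supaff b (h x) \<partial>U01) \<le> ennreal D"
    and L1: "(\<lambda>n. \<integral>\<^sup>+x. ennreal \<bar>c n x - h x\<bar> \<partial>U01) \<longlonglongrightarrow> 0"
    using supaff_bounded_L1_convergence[OF finite_measure_U01 _ _ c0 h0 ch cF Dlim, of "D + 1"] \<delta>0 by auto
  have hint: "set_integrable lborel {0..1} h"
  proof (rule set_integrable_of_U01)
    have "(\<integral>\<^sup>+x. ennreal \<bar>h x\<bar> \<partial>U01) \<le> (\<integral>\<^sup>+x. supaff b (h x) + ennreal \<bar>b 1\<bar> \<partial>U01)"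
      using supaff_superlinear[of 1 _ b] h0 by (intro nn_integral_mono) auto
    also have "\<dots> = (\<integral>\<^sup>+x. supaff b (h x) \<partial>U01) + ennreal \<bar>b 1\<bar>"
      by (subst nn_integral_add) (auto simp: emeasure_U01)
    also have "\<dots> < \<infinity>" using le_less_trans[OF hF, of top] by simp
    finally show "(\<integral>\<^sup>+x. ennreal \<bar>h x\<bar> \<partial>U01) < \<infinity>" .
  qed simp
  have cint: "set_integrable lborel {0..1} (c n)" for n
    using c[of n] unfolding C_def by (rule competitors_set_integrable)
  have Hlim: "(\<lambda>n. LINT t:{0..x}|lborel. c n t) \<longlonglongrightarrow> (LINT t:{0..x}|lborel. h t)" if "x \<le> 1" for x
  proof -
    have "(\<lambda>n. ennreal \<bar>(LINT t:{0..x}|lborel. c n t) - (LINT t:{0..x}|lborel. h t)\<bar>) \<longlonglongrightarrow> 0"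
      by (rule tendsto_sandwich[OF _ _ tendsto_const L1])
         (use that cint hint in \<open>auto intro!: always_eventually set_integral_diff_le_U01\<close>)
    then have "(\<lambda>n. \<bar>(LINT t:{0..x}|lborel. c n t) - (LINT t:{0..x}|lborel. h t)\<bar>) \<longlonglongrightarrow> 0"
      by (subst (asm) tendsto_ennreal_iff[of _ _ 0, simplified]) auto
    then show ?thesis by (subst LIM_zero_iff[symmetric], subst tendsto_rabs_zero_iff[symmetric])
  qed
  define good where "good n P \<longleftrightarrow> P \<in> borel_measurable borel \<and> (\<forall>x y. 0 < x \<longrightarrow> x \<le> y \<longrightarrow> y < 1 \<longrightarrow> P x \<le> P y) \<and>
       (\<forall>x. 0 < x \<longrightarrow> x < 1 \<longrightarrow> 0 \<le> P x \<and> P x \<le> ell - \<gamma> + (LINT t:{0..1}|lborel. c n t) + \<delta> n) \<and>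
       (\<integral>\<^sup>+x. ennreal \<bar>u x - \<gamma> * x + (LINT t:{0..x}|lborel. c n t) - P x\<bar> \<partial>U01) \<le> ennreal (\<delta> n)" for n P
  have "\<exists>P. good n P" for n
    using c[of n] unfolding C_def competitors_def good_def by auto
  then obtain P where P: "\<And>n. good n (P n)" by metis
  have Pm [measurable]: "\<And>n. P n \<in> borel_measurable borel"
    and Pmono: "\<And>n x y. 0 < x \<Longrightarrow> x \<le> y \<Longrightarrow> y < 1 \<Longrightarrow> P n x \<le> P n y"
    and P0: "\<And>n x. 0 < x \<Longrightarrow> x < 1 \<Longrightarrow> 0 \<le> P n x"
    and P1: "\<And>n x. 0 < x \<Longrightarrow> x < 1 \<Longrightarrow> P n x \<le> ell - \<gamma> + (LINT t:{0..1}|lborel. c n t) + \<delta> n"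
    and Perr: "\<And>n. (\<integral>\<^sup>+x. ennreal \<bar>u x - \<gamma> * x + (LINT t:{0..x}|lborel. c n t) - P n x\<bar> \<partial>U01) \<le> ennreal (\<delta> n)"
    using P unfolding good_def by (blast, blast, blast, blast, blast)
  define X where "X n x = u x - \<gamma> * x + (LINT t:{0..x}|lborel. c n t) - P n x" for n x
  have [measurable]: "X n \<in> borel_measurable borel" for n unfolding X_def by measurable
  have "(\<integral>\<^sup>+x. (\<Sum>n. ennreal \<bar>X n x\<bar>) \<partial>U01) = (\<Sum>n. \<integral>\<^sup>+x. ennreal \<bar>X n x\<bar> \<partial>U01)"
    by (intro nn_integral_suminf) auto
  also have "\<dots> \<le> (\<Sum>n. ennreal (\<delta> n))" 
  proof (rule suminf_le)
    show "(\<integral>\<^sup>+x. ennreal \<bar>X n x\<bar> \<partial>U01) \<le> ennreal (\<delta> n)" for n using Perr[of n] by (simp only: X_def)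
  qed simp_all
  also have "\<dots> < \<infinity>"
  proof -
    have "summable \<delta>" unfolding \<delta>_def by (rule summable_geometric) simp
    then have "(\<Sum>n. ennreal (\<delta> n)) = ennreal (suminf \<delta>)"
      using \<delta>0(1) less_imp_le by (intro suminf_ennreal2) blast+
    then show ?thesis by simp
  qed
  finally have "AE x in U01. (\<Sum>n. ennreal \<bar>X n x\<bar>) \<noteq> \<infinity>" by (intro nn_integral_PInf_AE) auto
  then have Xlim: "AE x in U01. (\<lambda>n. X n x) \<longlonglongrightarrow> 0"
  proof eventually_elim
    case (elim x)
    then have "summable (\<lambda>n. \<bar>X n x\<bar>)" by (intro summable_suminf_not_top) auto
    then have "(\<lambda>n. \<bar>X n x\<bar>) \<longlonglongrightarrow> 0" by (rule summable_LIMSEQ_zero)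
    then show ?case by (simp add: tendsto_rabs_zero_iff)
  qed
  define Q where "Q x = u x - \<gamma> * x + (LINT t:{0..x}|lborel. h t)" for x
  \<comment> \<open>The mass left for the increasing part: g and \<mu> must add up to
    \<open>ell\<close>, and \<gamma> - h alone contributes \<gamma> minus the integral of h.\<close>
  define K where "K = ell - \<gamma> + (LINT t:{0..1}|lborel. h t)"
  define G where "G = {x. 0 < x \<and> x < 1 \<and> (\<lambda>n. P n x) \<longlonglongrightarrow> Q x}"
  have G: "AE x in U01. x \<in> G"
    using Xlim AE_U01_in
  proof eventually_elim
    case (elim x)
    have "(\<lambda>n. u x - \<gamma> * x + (LINT t:{0..x}|lborel. c n t) - X n x) \<longlonglongrightarrow> u x - \<gamma> * x + (LINT t:{0..x}|lborel. h t) - 0"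
      using elim by (intro tendsto_intros Hlim) auto
    then show ?case using elim by (simp add: G_def Q_def X_def)
  qed
  have Gmono: "Q x \<le> Q y" if "x \<in> G" "y \<in> G" "x \<le> y" for x y
    using that Pmono by (intro LIMSEQ_le[of "\<lambda>n. P n x" _ "\<lambda>n. P n y"]) (auto simp: G_def)
  have Grange: "0 \<le> Q x \<and> Q x \<le> K" if "x \<in> G" for x
  proof
    have x: "0 < x" "x < 1" "(\<lambda>n. P n x) \<longlonglongrightarrow> Q x" using that by (auto simp: G_def)
    show "0 \<le> Q x" using x P0 by (intro LIMSEQ_le_const[OF x(3)]) auto
    have "(\<lambda>n. ell - \<gamma> + (LINT t:{0..1}|lborel. c n t) + \<delta> n) \<longlonglongrightarrow> ell - \<gamma> + (LINT t:{0..1}|lborel. h t) + 0"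
      by (intro tendsto_intros Hlim \<delta>_lim) simp
    then show "Q x \<le> K" unfolding K_def using x P1 by (intro LIMSEQ_le[OF x(3)]) auto
  qed
  obtain \<mu>0 where \<mu>0: "sets \<mu>0 = sets borel" "finite_measure \<mu>0" "emeasure \<mu>0 (UNIV - {0..1}) = 0"
    "measure \<mu>0 {0..1} = K" "AE x in U01. Q x = measure \<mu>0 {0..x}"
  proof -
    have "G \<subseteq> {0<..<1}" by (auto simp: G_def)
    from monotone_AE_eq_measure[of G Q K, OF G this Gmono Grange] show ?thesis using that by blast
  qed
  obtain \<beta> \<mu> N where \<beta> [measurable]: "\<beta> \<in> borel_measurable borel" and \<beta>0: "\<And>x. 0 \<le> \<beta> x" and \<beta>i: "integrable lborel \<beta>"
    and \<mu>: "sets \<mu> = sets borel" "finite_measure \<mu>" "\<And>A. A \<in> sets borel \<Longrightarrow> emeasure \<mu> A \<le> emeasure \<mu>0 A"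
    and N: "N \<in> sets borel" "emeasure lborel N = 0" "emeasure \<mu> (UNIV - N) = 0"
    and dec: "\<And>A. A \<in> sets borel \<Longrightarrow> measure \<mu>0 A = (LINT x:A|lborel. \<beta> x) + measure \<mu> A"
    using Lebesgue_decomposition_borel[OF \<mu>0(1,2)] by blast
  define g where "g x = \<gamma> - h x + \<beta> x" for x
  have [measurable]: "g \<in> borel_measurable borel" unfolding g_def by measurable
  have \<beta>s: "set_integrable lborel A \<beta>" if "A \<in> sets borel" for A
    using set_integrable_subset[of lborel UNIV \<beta> A] that \<beta>i by (simp add: set_integrable_def)
  have \<gamma>s: "set_integrable lborel {0..x} (\<lambda>_. \<gamma>)" for x :: real
    unfolding set_integrable_def 
    by (intro integrable_scaleR_left integrable_real_indicator) (simp_all add: emeasure_lborel_Icc_eq)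
  have hs: "set_integrable lborel {0..x} h" if "x \<le> 1" for x
    using hint by (rule set_integrable_subset) (use that in auto)
  have gs: "set_integrable lborel {0..x} g" and gL: "(LINT t:{0..x}|lborel. g t) = \<gamma> * x - (LINT t:{0..x}|lborel. h t) + (LINT t:{0..x}|lborel. \<beta> t)"
    if "0 \<le> x" "x \<le> 1" for x
  proof -
    have 1: "set_integrable lborel {0..x} (\<lambda>t. \<gamma> - h t)" using \<gamma>s hs[OF that(2)] by (rule set_integral_diff)
    show "set_integrable lborel {0..x} g" unfolding g_def using 1 \<beta>s by (intro set_integral_add) auto
    have "(LINT t:{0..x}|lborel. \<gamma>) = \<gamma> * x" using that by (simp add: set_integral_const)
    then show "(LINT t:{0..x}|lborel. g t) = \<gamma> * x - (LINT t:{0..x}|lborel. h t) + (LINT t:{0..x}|lborel. \<beta> t)"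
      unfolding g_def using 1 \<beta>s[of "{0..x}"] \<gamma>s hs[OF that(2)] by (simp add: set_integral_add set_integral_diff)
  qed
  have "BV_rep ell u g \<mu>"
    unfolding BV_rep_def
  proof (intro conjI)
    show "set_integrable lborel {0..1} g" by (rule gs) auto
    show "sets \<mu> = sets borel" by fact
    show "emeasure \<mu> {0..1} < \<infinity>" using finite_measure.emeasure_finite[OF \<mu>(2)] by (simp add: less_top[symmetric])
    show "emeasure \<mu> (UNIV - {0..1}) = 0" using \<mu>(3)[of "UNIV - {0..1}"] \<mu>0(3) by simp
    show "\<exists>N\<in>sets borel. emeasure lborel N = 0 \<and> emeasure \<mu> (UNIV - N) = 0" using N by auto
    have "AE x in U01. u x = (LINT t:{0..x}|lborel. g t) + measure \<mu> {0..x}"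
      using \<mu>0(5) AE_U01_in
    proof eventually_elim
      case (elim x)
      then show ?case using dec[of "{0..x}"] gL[of x] by (simp add: Q_def)
    qed
    then show "AE x in lborel. x \<in> {0<..<1} \<longrightarrow> u x = (LINT t:{0..x}|lborel. g t) + measure \<mu> {0..x}"
      by (simp add: AE_U01)
    show "(LINT t:{0..1}|lborel. g t) + measure \<mu> {0..1} = ell"
      using dec[of "{0..1}"] gL[of 1] \<mu>0(4) by (simp add: K_def)
  qed
  moreover have "(\<integral>\<^sup>+x. supaff b (\<gamma> - g x) \<partial>U01) \<le> ennreal D"
    using \<beta>0 by (intro order_trans[OF nn_integral_mono hF] supaff_mono) (simp add: g_def)
  ultimately show thesis using that[of g \<mu>] by auto
qed

section \<open>Discrete functions\<close>

text \<open>The end points of the mesh element containing the cell [i/n, (i+1)/n]. For i < n both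
  sets are nonempty as soon as 0 and n are atoms.\<close>

definition elem_lo :: "nat set \<Rightarrow> nat \<Rightarrow> nat" where "elem_lo T i = Max {t\<in>T. t \<le> i}"
definition elem_hi :: "nat set \<Rightarrow> nat \<Rightarrow> nat" where "elem_hi T i = Min {t\<in>T. i < t}"

lemma elem_props:
  assumes "atoms_ok n T" "i < n"
  shows "consecutive T (elem_lo T i) (elem_hi T i)" "elem_lo T i \<le> i" "i < elem_hi T i" "elem_hi T i \<le> n"
proof -
  have fin: "finite T" using assms(1) by (auto simp: atoms_ok_def intro: finite_subset)
  have ne: "{t\<in>T. t \<le> i} \<noteq> {}" "{t\<in>T. i < t} \<noteq> {}" using assms by (auto simp: atoms_ok_def)
  have a: "elem_lo T i \<in> {t\<in>T. t \<le> i}" unfolding elem_lo_def using fin ne by (intro Max_in) auto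
  have b: "elem_hi T i \<in> {t\<in>T. i < t}" unfolding elem_hi_def using fin ne by (intro Min_in) auto
  have "\<not> (elem_lo T i < t \<and> t < elem_hi T i)" if "t \<in> T" for t
  proof (cases "t \<le> i")
    case True
    then have "t \<le> elem_lo T i" unfolding elem_lo_def using that fin by (intro Max_ge) auto
    then show ?thesis by simp
  next
    case False
    then have "elem_hi T i \<le> t" unfolding elem_hi_def using that fin by (intro Min_le) auto
    then show ?thesis by simp
  qed
  then show "consecutive T (elem_lo T i) (elem_hi T i)" using a b by (auto simp: consecutive_def)
  show "elem_lo T i \<le> i" "i < elem_hi T i" "elem_hi T i \<le> n" using a b assms(1) by (auto simp: atoms_ok_def)
qed

text \<open>Every cell lies inside one element, so v is affine on each cell and determined by its
  nodal differences. From here on admissible functions are handled through their slopes.\<close>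

lemma A_T_eq_pwa:
  assumes v: "v \<in> A_T n T" and T: "atoms_ok n T" and n: "0 < n" and v0: "node n v 0 = 0"
    and x: "0 \<le> x" "x \<le> 1"
  shows "v x = pwa n (\<lambda>i. (node n v (i + 1) - node n v i) / (1 / real n)) x"
proof -
  let ?s = "\<lambda>i. (node n v (i + 1) - node n v i) / (1 / real n)"
  have aff: "v y = node n v i + ?s i * (y - real i / real n)"
    if i: "i < n" and y: "real i / real n \<le> y" "y \<le> real (Suc i) / real n" for i y
  proof -
    define a b where "a = elem_lo T i" and "b = elem_hi T i"
    note ab = elem_props(1-3)[OF T i, folded a_def b_def]
    then obtain \<alpha> \<beta> where lin: "\<And>x. x \<in> {real a / real n .. real b / real n} \<Longrightarrow> v x = \<alpha> * x + \<beta>"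
      using v unfolding A_T_def by blast
    have "real a / real n \<le> real i / real n" "real (Suc i) / real n \<le> real b / real n"
      "real i / real n \<le> real (Suc i) / real n"
      using ab n by (auto intro!: divide_right_mono)
    then have "v y = \<alpha> * y + \<beta>" "v (real i / real n) = \<alpha> * (real i / real n) + \<beta>"
      "v (real (Suc i) / real n) = \<alpha> * (real (Suc i) / real n) + \<beta>"
      using y by (auto simp del: times_divide_eq_right of_nat_Suc intro!: lin)
    then have "v y = v (real i / real n) + \<alpha> * (y - real i / real n)"
      and "v (real (Suc i) / real n) - v (real i / real n) = \<alpha> * (1 / real n)"
      by (auto simp: algebra_simps add_divide_distrib)
    then show ?thesis using n by (simp add: node_def)
  qed
  have "(\<Sum>j<i. ?s j) / real n = node n v i" for i
  proof -
    have "(\<Sum>j<i. ?s j) / real n = (\<Sum>j<i. node n v (Suc j) - node n v j)"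
      unfolding sum_divide_distrib using n by (intro sum.cong) auto
    also have "\<dots> = node n v i" using v0 by (simp add: sum_lessThan_telescope)
    finally show ?thesis .
  qed
  note nodes = this
  show ?thesis
  proof (cases "x < 1")
    case True
    note c = cell_bounds[OF n x(1) True]
    show ?thesis using aff[OF c(1,2)] c(3) pwa_cell[OF c(1,2), of ?s] nodes by simp
  next
    case False
    then have "x = real n / real n" using x n by simp
    then show ?thesis using pwa_node[OF n order_refl, of ?s] nodes[of n] by (simp add: node_def)
  qed
qed

section \<open>The energy as a function of the slopes, and its lower bound\<close>

definition nnn_term :: "(real \<Rightarrow> ereal) \<Rightarrow> nat \<Rightarrow> nat \<Rightarrow> (nat \<Rightarrow> real) \<Rightarrow> nat \<Rightarrow> ereal" where
  "nnn_term J2 k1 k2 s i = (if k1 \<le> i \<and> i \<le> k2 - 2 then ereal (1/2) * (J2 (s i) + J2 (s (i + 1)))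
     else J2 ((s i + s (i + 1)) / 2))"

text \<open>The three second-neighbour sums of \<open>QC_energy\<close> run over consecutive ranges
  that make up 0, ..., n - 2, so a single sum with a case distinction replaces them.\<close>

lemma QC_energy_slopes:
  assumes n: "0 < n" and k: "0 < k1" "k1 < k2" "k2 < n - 2"
    and s: "\<And>i. s i = (node n u (i + 1) - node n u i) / (1 / real n)"
  shows "QC_energy J1 J2 n k1 k2 u = (\<Sum>i<n. ereal (1 / real n) * J1 (s i))
    + (\<Sum>i<n-1. ereal (1 / real n) * nnn_term J2 k1 k2 s i)"
proof -
  let ?l = "1 / real n"
  let ?v = "node n u"
  have avg: "(?v (i + 2) - ?v i) / (2 * ?l) = (s i + s (i + 1)) / 2" for i
    unfolding s using n by (simp add: field_simps)
  have half: "ereal (?l / 2) * X = ereal ?l * (ereal (1/2) * X)" for X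
    by (simp add: mult.assoc[symmetric])
  have split: "{..<n-1} = {0..<k1} \<union> ({k1..k2 - 2} \<union> {k2 - 1..n - 2})" using k by auto
  have "(\<Sum>i<n-1. ereal ?l * nnn_term J2 k1 k2 s i) = (\<Sum>i\<in>{0..<k1}. ereal ?l * nnn_term J2 k1 k2 s i)
     + ((\<Sum>i\<in>{k1..k2 - 2}. ereal ?l * nnn_term J2 k1 k2 s i) + (\<Sum>i\<in>{k2 - 1..n - 2}. ereal ?l * nnn_term J2 k1 k2 s i))"
    unfolding split using k by (subst sum.union_disjoint, (auto)[3], subst sum.union_disjoint, auto)
  moreover have "(\<Sum>i\<in>{0..<k1}. ereal ?l * nnn_term J2 k1 k2 s i) = (\<Sum>i\<in>{0..<k1}. ereal ?l * J2 ((?v (i+2) - ?v i) / (2 * ?l)))"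
    by (intro sum.cong refl) (simp only: avg, simp add: nnn_term_def)
  moreover have "(\<Sum>i\<in>{k2 - 1..n - 2}. ereal ?l * nnn_term J2 k1 k2 s i) = (\<Sum>i\<in>{k2 - 1..n - 2}. ereal ?l * J2 ((?v (i+2) - ?v i) / (2 * ?l)))"
  proof (intro sum.cong refl)
    fix i assume "i \<in> {k2 - 1..n - 2}"
    then have "\<not> (k1 \<le> i \<and> i \<le> k2 - 2)" using k by auto
    then show "ereal ?l * nnn_term J2 k1 k2 s i = ereal ?l * J2 ((?v (i+2) - ?v i) / (2 * ?l))"
      by (simp only: avg nnn_term_def if_False)
  qed
  moreover have "(\<Sum>i\<in>{k1..k2 - 2}. ereal ?l * nnn_term J2 k1 k2 s i) =
      (\<Sum>i\<in>{k1..k2 - 2}. ereal (?l / 2) * (J2 ((?v (i+1) - ?v i) / ?l) + J2 ((?v (i+2) - ?v (i+1)) / ?l)))"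
  proof (intro sum.cong refl)
    fix i assume "i \<in> {k1..k2 - 2}"
    then show "ereal ?l * nnn_term J2 k1 k2 s i = ereal (?l / 2) * (J2 ((?v (i+1) - ?v i) / ?l) + J2 ((?v (i+2) - ?v (i+1)) / ?l))"
      unfolding half nnn_term_def s by (simp add: numeral_2_eq_2)
  qed
  moreover have "(\<Sum>i<n. ereal ?l * J1 (s i)) = (\<Sum>i\<in>{0..<n}. ereal ?l * J1 ((?v (i+1) - ?v i) / ?l))"
    unfolding s by (simp add: atLeast0LessThan)
  ultimately show ?thesis unfolding QC_energy_def Let_def by (simp only: add.assoc)
qed

lemma sum_ereal_not_MInfty:
  fixes f :: "'a \<Rightarrow> ereal"
  assumes "\<And>i. i \<in> A \<Longrightarrow> f i \<noteq> - \<infinity>"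
  shows "sum f A \<noteq> - \<infinity>"
  using assms by (induction A rule: infinite_finite_induct) auto

text \<open>All that is needed of the potentials; \<^term>\<open>m\<close> is the minimum of $J_0$, attained at
  \<^term>\<open>\<gamma>\<close>. The second bound on \<^term>\<open>J1\<close> yields a bound on the total variation.\<close>

locale lennard_jones =
  fixes J1 J2 :: "real \<Rightarrow> ereal" and \<gamma> m c1 :: real and b :: "real \<Rightarrow> real"
  assumes envelope: "biconj (J0_of J1 J2) z = ereal m + enn2ereal (supaff b (\<gamma> - z))"
    and supaff_0: "supaff b 0 = 0"
    and \<gamma>_pos: "0 < \<gamma>"
    and c1_nonneg: "0 \<le> c1"
    and envelope_le: "biconj (J0_of J1 J2) ((x + y) / 2) \<le> J2 ((x + y) / 2) + ereal (1/2) * (J1 x + J1 y)"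
    and J1_ge: "ereal (- c1) \<le> J1 x" "ereal (- x - c1) \<le> J1 x"
    and J2_ge: "ereal (- c1) \<le> J2 x"
    and Cauchy_Born: "z \<le> \<gamma> \<Longrightarrow> supaff b (\<gamma> - z) < top \<Longrightarrow> J1 z + J2 z = ereal m + enn2ereal (supaff b (\<gamma> - z))"
    and finite_pos: "0 < x \<Longrightarrow> J1 x < \<infinity>" "0 < x \<Longrightarrow> J2 x < \<infinity>"
    and bounded_at_top: "\<exists>X>0. \<forall>x\<ge>X. J1 x + J2 x \<le> 1"
    and J2_finite_midpoint: "J2 x < \<infinity> \<Longrightarrow> J2 y < \<infinity> \<Longrightarrow> J2 ((x + y) / 2) < \<infinity>"
begin

lemma J1_cases: "J1 x = \<infinity> \<or> (\<exists>r. J1 x = ereal r \<and> - c1 \<le> r \<and> - x - c1 \<le> r)"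
  using J1_ge[of x] by (cases "J1 x") auto

lemma J2_cases: "J2 x = \<infinity> \<or> (\<exists>r. J2 x = ereal r \<and> - c1 \<le> r)"
  using J2_ge[of x] by (cases "J2 x") auto

lemma envelope_le_iff:
  "ereal m + enn2ereal X \<le> ereal r \<longleftrightarrow> m \<le> r \<and> X \<le> ennreal (r - m)"
proof (cases X)
  case (real x)
  then show ?thesis by (auto simp: enn2ereal_ennreal ennreal_le_iff2)
qed (simp add: top_unique)

text \<open>Each second-neighbour term is given half of the first-neighbour energies of its two
  cells. In the atomistic region the result dominates the envelope at the averaged slope by the
  definition of J0. In the continuum region each cell dominates the envelope at its own slope, and
  convexity passes to the average. Negative slopes are controlled separately through the bound
  \<open>- x - c1\<close> for \<open>J1\<close>.\<close>

lemma slopes_lower_bound: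
  assumes n: "3 < n" and E: "(\<Sum>i<n. ereal (1 / real n) * J1 (s i))
    + (\<Sum>i<n-1. ereal (1 / real n) * nnn_term J2 k1 k2 s i) < ereal C"
  shows "(\<Sum>i<n-1. supaff b (\<gamma> - (s i + s (i + 1)) / 2)) * ennreal (1 / real n) \<le> ennreal (C - m + (c1 + \<bar>m\<bar>) / real n)"
    and "0 \<le> C - m + (c1 + \<bar>m\<bar>) / real n"
    and "(\<Sum>i<n. max 0 (- s i)) / real n \<le> C + 2 * c1"
proof -
  let ?l = "1 / real n"
  have l: "0 < ?l" using n by simp
  define e2 where "e2 i = nnn_term J2 k1 k2 s i" for i
  have e2_ge: "ereal (- c1) \<le> e2 i" for i
  proof -
    have "ereal (- c1) \<le> ereal (1/2) * (J2 x + J2 y)" for x y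
      using J2_cases[of x] J2_cases[of y] by auto
    then show ?thesis unfolding e2_def nnn_term_def using J2_ge by auto
  qed
  have nm: "ereal ?l * J1 (s i) \<noteq> - \<infinity>" "ereal ?l * e2 i \<noteq> - \<infinity>" for i
    using J1_cases[of "s i"] e2_ge[of i] l by (cases "e2 i"; auto)+
  have A: "(\<Sum>i<n. ereal ?l * J1 (s i)) \<noteq> \<infinity>" "(\<Sum>i<n-1. ereal ?l * e2 i) \<noteq> \<infinity>"
  proof -
    have "(\<Sum>i<n. ereal ?l * J1 (s i)) \<noteq> - \<infinity>" "(\<Sum>i<n-1. ereal ?l * e2 i) \<noteq> - \<infinity>"
      using nm by (intro sum_ereal_not_MInfty; simp)+
    then show "(\<Sum>i<n. ereal ?l * J1 (s i)) \<noteq> \<infinity>" "(\<Sum>i<n-1. ereal ?l * e2 i) \<noteq> \<infinity>"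
      using E unfolding e2_def by auto
  qed
  define j1 where "j1 i = real_of_ereal (J1 (s i))" for i
  define q2 where "q2 i = real_of_ereal (e2 i)" for i
  have j1: "J1 (s i) = ereal (j1 i)" "- c1 \<le> j1 i" "- s i - c1 \<le> j1 i" if "i < n" for i
  proof -
    have "ereal ?l * J1 (s i) \<noteq> \<infinity>" using A(1) that by (auto simp: sum_Pinfty)
    then have "J1 (s i) \<noteq> \<infinity>" using l by auto
    then show "J1 (s i) = ereal (j1 i)" "- c1 \<le> j1 i" "- s i - c1 \<le> j1 i"
      using J1_cases[of "s i"] by (auto simp: j1_def)
  qed
  have q2: "e2 i = ereal (q2 i)" "- c1 \<le> q2 i" if "i < n - 1" for i
  proof -
    have "ereal ?l * e2 i \<noteq> \<infinity>" using A(2) that by (auto simp: sum_Pinfty)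
    then have "e2 i \<noteq> \<infinity>" using l by auto
    then show "e2 i = ereal (q2 i)" "- c1 \<le> q2 i"
      using e2_ge[of i] by (cases "e2 i"; auto simp: q2_def)+
  qed
  have "(\<Sum>i<n. ereal ?l * J1 (s i)) = ereal (\<Sum>i<n. ?l * j1 i)"
    unfolding sum_ereal[symmetric] using j1 by (intro sum.cong) auto
  moreover have "(\<Sum>i<n-1. ereal ?l * nnn_term J2 k1 k2 s i) = ereal (\<Sum>i<n-1. ?l * q2 i)"
    unfolding sum_ereal[symmetric] e2_def[symmetric] using q2 by (intro sum.cong) auto
  ultimately have "(\<Sum>i<n. ?l * j1 i) + (\<Sum>i<n-1. ?l * q2 i) < C" using E by simp
  then have Er: "((\<Sum>i<n. j1 i) + (\<Sum>i<n-1. q2 i)) / real n < C"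
    by (simp add: sum_distrib_left[symmetric] add_divide_distrib sum_divide_distrib)
  define r where "r i = (j1 i + j1 (i + 1)) / 2 + q2 i" for i
  have r: "m \<le> r i \<and> supaff b (\<gamma> - (s i + s (i + 1)) / 2) \<le> ennreal (r i - m)" if i: "i < n - 1" for i
  proof -
    have i': "i < n" "i + 1 < n" using that by auto
    have "ereal m + enn2ereal (supaff b (\<gamma> - (s i + s (i + 1)) / 2)) \<le> ereal (r i)"
    proof (cases "k1 \<le> i \<and> i \<le> k2 - 2")
      case False
      have "ereal m + enn2ereal (supaff b (\<gamma> - (s i + s (i + 1)) / 2))
          \<le> J2 ((s i + s (i + 1)) / 2) + ereal (1/2) * (J1 (s i) + J1 (s (i + 1)))"
        using envelope_le[of "s i" "s (i + 1)"] unfolding envelope .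
      also have "\<dots> = e2 i + ereal (1/2) * (J1 (s i) + J1 (s (i + 1)))" 
        unfolding e2_def nnn_term_def if_not_P[OF False] ..
      also have "\<dots> = ereal (r i)" unfolding j1(1)[OF i'(1)] j1(1)[OF i'(2)] q2(1)[OF i] r_def by simp
      finally show ?thesis .
    next
      case True
      have e: "ereal (q2 i) = ereal (1/2) * (J2 (s i) + J2 (s (i + 1)))"
        using True q2(1)[OF i] by (simp add: e2_def nnn_term_def)
      obtain a a' where j2: "J2 (s i) = ereal a" "J2 (s (i + 1)) = ereal a'"
        using J2_cases[of "s i"] J2_cases[of "s (i + 1)"] e by auto
      have q: "q2 i = (a + a') / 2" using e unfolding j2 by simp
      have *: "m \<le> j1 k + x \<and> supaff b (\<gamma> - s k) \<le> ennreal (j1 k + x - m)"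
        if k: "k < n" "J2 (s k) = ereal x" for k x
      proof -
        have "ereal m + enn2ereal (supaff b (\<gamma> - s k)) \<le> J2 (s k) + ereal (1/2) * (J1 (s k) + J1 (s k))"
          using envelope_le[of "s k" "s k"] unfolding envelope by simp
        also have "\<dots> = ereal (j1 k + x)" unfolding j1(1)[OF k(1)] k(2) by simp
        finally show ?thesis unfolding envelope_le_iff .
      qed
      note b1 = *[OF i'(1) j2(1)] and b2 = *[OF i'(2) j2(2)]
      have "\<gamma> - (s i + s (i + 1)) / 2 = ((\<gamma> - s i) + (\<gamma> - s (i + 1))) / 2" by (simp add: field_simps)
      then have "supaff b (\<gamma> - (s i + s (i + 1)) / 2) \<le> ennreal (1/2) * supaff b (\<gamma> - s i) + ennreal (1/2) * supaff b (\<gamma> - s (i + 1))"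
        by (simp only: supaff_midpoint)
      also have "\<dots> \<le> ennreal (1/2) * ennreal (j1 i + a - m) + ennreal (1/2) * ennreal (j1 (i + 1) + a' - m)"
        using b1 b2 by (intro add_mono mult_left_mono) auto
      also have "\<dots> = ennreal (1/2 * (j1 i + a - m)) + ennreal (1/2 * (j1 (i + 1) + a' - m))"
        by (subst (1 2) ennreal_mult') auto
      also have "\<dots> = ennreal (1/2 * (j1 i + a - m) + 1/2 * (j1 (i + 1) + a' - m))"
        using b1 b2 by (intro ennreal_plus[symmetric]) auto
      also have "1/2 * (j1 i + a - m) + 1/2 * (j1 (i + 1) + a' - m) = r i - m"
        unfolding r_def q by (simp add: field_simps)
      finally have "supaff b (\<gamma> - (s i + s (i + 1)) / 2) \<le> ennreal (r i - m)" .
      moreover have "m \<le> r i" using b1 b2 by (simp add: r_def q field_simps)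
      ultimately show ?thesis unfolding envelope_le_iff by simp
    qed
    then show ?thesis unfolding envelope_le_iff .
  qed
  \<comment> \<open>The two end cells belong to one pair only, so half of their first-neighbour
    energy is left over; it is at least -c1 and negligible after division by n.\<close>
  have sumr: "(\<Sum>i<n-1. r i) = (\<Sum>i<n. j1 i) - (j1 0 + j1 (n - 1)) / 2 + (\<Sum>i<n-1. q2 i)"
  proof -
    obtain n' where n': "n = Suc n'" using n by (cases n) auto
    have 1: "(\<Sum>i<n'. j1 (Suc i)) = (\<Sum>i<n'. j1 i) + j1 n' - j1 0"
      using sum.lessThan_Suc_shift[of j1 n'] sum.lessThan_Suc[of j1 n'] by simp
    have "(\<Sum>i<n'. r i) = ((\<Sum>i<n'. j1 i) + (\<Sum>i<n'. j1 (Suc i))) / 2 + (\<Sum>i<n'. q2 i)"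
      by (simp add: r_def sum.distrib sum_divide_distrib add_divide_distrib)
    then show ?thesis unfolding 1 by (simp add: n' field_simps)
  qed
  have "(\<Sum>i<n-1. r i) \<le> real n * C + c1"
  proof -
    have "(\<Sum>i<n. j1 i) + (\<Sum>i<n-1. q2 i) < real n * C" using Er n by (simp add: field_simps)
    moreover have "- c1 \<le> (j1 0 + j1 (n - 1)) / 2" using j1(2)[of 0] j1(2)[of "n - 1"] n by simp
    ultimately show ?thesis unfolding sumr by linarith
  qed
  then have "(\<Sum>i<n-1. r i - m) \<le> real n * C + c1 - (real n - 1) * m" using n by (simp add: sum_subtractf of_nat_diff)
  \<comment> \<open>There are n - 1 pairs but n cells; the missing copy of m accounts for
    |m|.\<close>
  also have "\<dots> \<le> real n * (C - m) + (c1 + \<bar>m\<bar>)" by (simp add: algebra_simps)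
  finally have "(\<Sum>i<n-1. r i - m) / real n \<le> (real n * (C - m) + (c1 + \<bar>m\<bar>)) / real n"
    by (rule divide_right_mono) simp
  then have R: "(\<Sum>i<n-1. r i - m) / real n \<le> C - m + (c1 + \<bar>m\<bar>) / real n"
    using n by (simp add: add_divide_distrib)
  have "(\<Sum>i<n-1. supaff b (\<gamma> - (s i + s (i + 1)) / 2)) \<le> (\<Sum>i<n-1. ennreal (r i - m))"
    using r by (intro sum_mono) auto
  also have "\<dots> = ennreal (\<Sum>i<n-1. r i - m)" using r by (intro sum_ennreal) auto
  finally have "(\<Sum>i<n-1. supaff b (\<gamma> - (s i + s (i + 1)) / 2)) * ennreal ?l \<le> ennreal (\<Sum>i<n-1. r i - m) * ennreal ?l"
    by (rule mult_right_mono) simp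
  also have "\<dots> = ennreal ((\<Sum>i<n-1. r i - m) / real n)" by (subst ennreal_mult''[symmetric]) auto
  also have "\<dots> \<le> ennreal (C - m + (c1 + \<bar>m\<bar>) / real n)" by (rule ennreal_leI[OF R])
  finally show "(\<Sum>i<n-1. supaff b (\<gamma> - (s i + s (i + 1)) / 2)) * ennreal (1 / real n) \<le> ennreal (C - m + (c1 + \<bar>m\<bar>) / real n)" .
  have "0 \<le> (\<Sum>i<n-1. r i - m)" using r by (intro sum_nonneg) auto
  then have "0 \<le> (\<Sum>i<n-1. r i - m) / real n" by simp
  then show "0 \<le> C - m + (c1 + \<bar>m\<bar>) / real n" using R by linarith
  have "(\<Sum>i<n. max 0 (- s i)) \<le> (\<Sum>i<n. j1 i + c1)"
  proof (rule sum_mono)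
    fix i assume "i \<in> {..<n}"
    then show "max 0 (- s i) \<le> j1 i + c1" using j1(2,3)[of i] by simp
  qed
  also have "\<dots> = (\<Sum>i<n. j1 i) + real n * c1" by (simp add: sum.distrib)
  finally have "(\<Sum>i<n. max 0 (- s i)) \<le> (\<Sum>i<n. j1 i) + real n * c1" .
  moreover have "(\<Sum>i<n-1. - c1) \<le> (\<Sum>i<n-1. q2 i)" using q2 by (intro sum_mono) auto
  then have "- (real n * c1) \<le> (\<Sum>i<n-1. q2 i)" using n c1_nonneg by (simp add: of_nat_diff algebra_simps)
  moreover have "(\<Sum>i<n. j1 i) + (\<Sum>i<n-1. q2 i) < real n * C" using Er n by (simp add: field_simps)
  ultimately have "(\<Sum>i<n. max 0 (- s i)) \<le> real n * (C + 2 * c1)" by (simp add: algebra_simps)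
  then show "(\<Sum>i<n. max 0 (- s i)) / real n \<le> C + 2 * c1" using n by (simp add: field_simps)
qed

text \<open>The deficit is built from averaged slopes because only they carry the envelope. Adding
  it raises each averaged slope to at least \<gamma>, so that subtracting \<gamma> leaves an
  increasing discrete function. The bound on negative slopes and the prescribed total bound the
  total variation, which makes the discretisation errors O(1/n).\<close>

lemma slopes_competitor:
  assumes n: "3 < n" and E: "(\<Sum>i<n. ereal (1 / real n) * J1 (s i))
    + (\<Sum>i<n-1. ereal (1 / real n) * nnn_term J2 k1 k2 s i) < ereal C"
    and s0: "0 \<le> s 0" and s1: "0 \<le> s (n - 1)" and tot: "(\<Sum>i<n. s i) / real n = ell"
    and u [measurable]: "u \<in> borel_measurable borel"
    and near: "(\<integral>\<^sup>+x. ennreal \<bar>u x - pwa n s x\<bar> \<partial>U01) \<le> ennreal \<eta>" and "0 \<le> \<eta>"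
    and V: "V = ell + 2 * (C + 2 * c1)"
    and \<delta>: "\<eta> + (2 * \<bar>V\<bar> + 2 * \<gamma> + c1 + \<bar>m\<bar>) / real n \<le> \<delta>"
  shows "competitors b ell \<gamma> (C - m) u \<delta> \<noteq> {}" and "0 \<le> C - m + \<delta>"
proof -
  have n0: "0 < n" using n by simp
  note lb = slopes_lower_bound[OF n E]
  \<comment> \<open>The last cell starts no pair; its deficit 0 costs no energy because
    \<open>supaff b 0\<close> is 0.\<close>
  define h where "h i = (if i < n - 1 then max 0 (\<gamma> - (s i + s (i + 1)) / 2) else 0)" for i
  have h0: "0 \<le> h i" for i by (simp add: h_def)
  have TV: "(\<Sum>i<n. \<bar>s i\<bar>) / real n \<le> V"
  proof -
    have "(\<Sum>i<n. \<bar>s i\<bar>) = (\<Sum>i<n. s i + 2 * max 0 (- s i))" by (intro sum.cong) (auto simp: max_def)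
    also have "\<dots> = (\<Sum>i<n. s i) + 2 * (\<Sum>i<n. max 0 (- s i))" by (simp add: sum.distrib sum_distrib_left)
    finally have "(\<Sum>i<n. \<bar>s i\<bar>) / real n = ell + 2 * ((\<Sum>i<n. max 0 (- s i)) / real n)"
      using tot by (simp add: add_divide_distrib)
    moreover have "2 * ((\<Sum>i<n. max 0 (- s i)) / real n) \<le> 2 * (C + 2 * c1)" by (intro mult_left_mono lb(3)) simp
    ultimately show ?thesis unfolding V by simp
  qed
  then have V0: "0 \<le> V" by (rule order_trans[rotated]) (auto intro!: divide_nonneg_nonneg sum_nonneg)
  have hsum: "(\<Sum>i<n. h i) / real n \<le> \<gamma> + V"
  proof -
    obtain n' where n': "n = Suc n'" using n by (cases n) auto
    have "(\<Sum>i<n. h i) = (\<Sum>i<n'. h i)" by (simp add: n' h_def)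
    also have "\<dots> \<le> (\<Sum>i<n'. \<gamma> + (\<bar>s i\<bar> + \<bar>s (Suc i)\<bar>) / 2)"
      using \<gamma>_pos by (intro sum_mono) (auto simp: h_def n' max_def abs_if field_simps)
    also have "\<dots> = real n' * \<gamma> + ((\<Sum>i<n'. \<bar>s i\<bar>) + (\<Sum>i<n'. \<bar>s (Suc i)\<bar>)) / 2"
      by (simp add: sum.distrib sum_divide_distrib add_divide_distrib)
    also have "\<dots> \<le> real n * \<gamma> + (\<Sum>i<n. \<bar>s i\<bar>)"
    proof -
      have "(\<Sum>i<n'. \<bar>s i\<bar>) \<le> (\<Sum>i<n. \<bar>s i\<bar>)" by (simp add: n')
      moreover have "(\<Sum>i<n'. \<bar>s (Suc i)\<bar>) \<le> (\<Sum>i<n. \<bar>s i\<bar>)" unfolding n' sum.lessThan_Suc_shift by simp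
      moreover have "real n' * \<gamma> \<le> real n * \<gamma>" using \<gamma>_pos by (intro mult_right_mono) (auto simp: n')
      moreover have "q + (A + B) / 2 \<le> r + S" if "A \<le> S" "B \<le> S" "q \<le> r" for A B S q r :: real
        using that by (simp add: field_simps)
      ultimately show ?thesis by blast
    qed
    finally have "(\<Sum>i<n. h i) / real n \<le> (real n * \<gamma> + (\<Sum>i<n. \<bar>s i\<bar>)) / real n" by (rule divide_right_mono) simp
    then show ?thesis using TV n0 by (simp add: add_divide_distrib)
  qed
  define H where "H t = (if 0 \<le> t \<and> t < 1 then h (cell n t) else 0)" for t :: real
  have Hm [measurable]: "H \<in> borel_measurable borel" unfolding H_def by measurable
  have Hint: "(LINT t:{0..x}|lborel. H t) = pwa n h x" if "0 \<le> x" "x \<le> 1" for x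
    unfolding H_def using set_integral_step(2)[OF n0 that] .
  have H1: "(LINT t:{0..1}|lborel. H t) = (\<Sum>i<n. h i) / real n"
    using Hint[of 1] pwa_node[OF n0 order_refl, of h] n0 by simp
  \<comment> \<open>The half slope evaluates the function at the centre of cell i. Consecutive
    values then differ through exactly the averaged slope, which is what \<open>h\<close>
    corrects.\<close>
  define p where "p i = ((\<Sum>j<i. s j) + s i / 2 + (\<Sum>j<i. h j) - \<gamma> * real i) / real n" for i
  define P where "P x = p (cell n x)" for x
  have Pm [measurable]: "P \<in> borel_measurable borel" unfolding P_def by measurable
  have p_step: "p i \<le> p (Suc i)" if "i < n - 1" for i
  proof -
    have "p (Suc i) - p i = ((s i + s (Suc i)) / 2 + h i - \<gamma>) / real n"
      unfolding p_def diff_divide_distrib[symmetric]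
      by (intro arg_cong[where f="\<lambda>x. x / real n"]) (simp add: field_simps)
    moreover have "0 \<le> (s i + s (Suc i)) / 2 + h i - \<gamma>" using that by (simp add: h_def)
    ultimately show ?thesis by (smt (verit) divide_nonneg_nonneg of_nat_0_le_iff)
  qed
  have p_mono: "p i \<le> p j" if "i \<le> j" "j < n" for i j
    using that
  proof (induction j rule: dec_induct)
    case (step k)
    then have "k < n - 1" "p i \<le> p k" by auto
    then show ?case using p_step[of k] by simp
  qed simp
  \<comment> \<open>The sign of the first and of the last slope, known from the boundary conditions,
    gives the lower bound at the first cell and the upper bound at the last; monotonicity does the
    rest.\<close>
  have p_low: "0 \<le> p i" if "i < n" for i
  proof -
    have "0 \<le> p 0" using s0 by (simp add: p_def)
    then show ?thesis using p_mono[of 0 i] that by simp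
  qed
  have p_up: "p i \<le> ell - \<gamma> + (\<Sum>i<n. h i) / real n + \<gamma> / real n" if "i < n" for i
  proof -
    obtain n' where n': "n = Suc n'" using n by (cases n) auto
    have "p i \<le> p n'" using that n' by (intro p_mono) auto
    also have "p n' = ((\<Sum>j<n. s j) - s n' / 2 + (\<Sum>j<n. h j) - \<gamma> * real n + \<gamma>) / real n"
      unfolding p_def by (intro arg_cong[where f="\<lambda>x. x / real n"]) (simp add: n' h_def algebra_simps)
    also have "\<dots> = (\<Sum>j<n. s j) / real n - s n' / (2 * real n) + (\<Sum>j<n. h j) / real n - \<gamma> + \<gamma> / real n"
      using n0 by (simp add: add_divide_distrib diff_divide_distrib)
    also have "\<dots> \<le> ell - \<gamma> + (\<Sum>i<n. h i) / real n + \<gamma> / real n"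
    proof -
      have "0 \<le> s n' / (2 * real n)" using s1 by (simp add: n')
      then show ?thesis unfolding tot by linarith
    qed
    finally show ?thesis .
  qed
  let ?e = "\<lambda>i. (\<bar>s i\<bar> / 2 + \<gamma> + h i) / real n"
  have err: "\<bar>pwa n s x - \<gamma> * x + pwa n h x - P x\<bar> \<le> ?e (cell n x)" if x: "0 < x" "x < 1" for x
  proof -
    define i where "i = cell n x"
    note c = cell_bounds[OF n0 less_imp_le[OF x(1)] x(2), folded i_def]
    define d where "d = x - real i / real n"
    have d: "0 \<le> d" "d \<le> 1 / real n" using c(2,3) by (auto simp: d_def add_divide_distrib)
    have "pwa n s x - \<gamma> * x + pwa n h x - P x = s i * (d - 1 / (2 * real n)) - \<gamma> * d + h i * d"
      unfolding pwa_cell[OF c(1,2) less_imp_le[OF c(3)]] P_def i_def[symmetric] p_def d_def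
      by (simp add: algebra_simps add_divide_distrib diff_divide_distrib)
    moreover have "\<bar>s i * (d - 1 / (2 * real n))\<bar> \<le> \<bar>s i\<bar> * (1 / (2 * real n))"
      unfolding abs_mult using d by (intro mult_left_mono) (auto simp: abs_le_iff field_simps)
    moreover have "0 \<le> \<gamma> * d" "\<gamma> * d \<le> \<gamma> * (1 / real n)" using d(1) mult_left_mono[OF d(2), of \<gamma>] \<gamma>_pos by auto
    moreover have "0 \<le> h i * d" "h i * d \<le> h i * (1 / real n)" using d(1) mult_left_mono[OF d(2), of "h i"] h0[of i] by auto
    ultimately have "\<bar>pwa n s x - \<gamma> * x + pwa n h x - P x\<bar> \<le> \<bar>s i\<bar> * (1 / (2 * real n)) + \<gamma> * (1 / real n) + h i * (1 / real n)"
      by linarith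
    also have "\<dots> = ?e i" using n0 by (simp add: add_divide_distrib)
    finally show ?thesis by (simp add: i_def)
  qed
  have e0: "0 \<le> ?e i" for i using h0[of i] \<gamma>_pos by (intro divide_nonneg_nonneg add_nonneg_nonneg) auto
  have "(\<Sum>i<n. ?e i) / real n \<le> (2 * V + 2 * \<gamma>) / real n"
  proof (rule divide_right_mono)
    have eq: "(\<Sum>i<n. ?e i) = (\<Sum>i<n. \<bar>s i\<bar>) / real n / 2 + \<gamma> + (\<Sum>i<n. h i) / real n"
      using n0 by (simp add: sum_divide_distrib[symmetric] sum.distrib add_divide_distrib)
    have bnd: "X / 2 + \<gamma> + Y \<le> 2 * V + 2 * \<gamma>" if "X \<le> V" "Y \<le> \<gamma> + V" for X Y
      using that V0 by linarith
    show "(\<Sum>i<n. ?e i) \<le> 2 * V + 2 * \<gamma>" unfolding eq by (rule bnd[OF TV hsum])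
  qed simp
  then have e_sum: "(\<Sum>i<n. ennreal (?e i)) * ennreal (1 / real n) \<le> ennreal ((2 * V + 2 * \<gamma>) / real n)"
    using e0 by (subst sum_ennreal) (auto simp: ennreal_mult''[symmetric] intro!: ennreal_leI)
  have "(\<integral>\<^sup>+x. ennreal \<bar>u x - \<gamma> * x + (LINT t:{0..x}|lborel. H t) - P x\<bar> \<partial>U01)
      \<le> (\<integral>\<^sup>+x. ennreal \<bar>u x - pwa n s x\<bar> + ennreal (?e (cell n x)) \<partial>U01)"
  proof (rule nn_integral_mono_AE)
    show "AE x in U01. ennreal \<bar>u x - \<gamma> * x + (LINT t:{0..x}|lborel. H t) - P x\<bar>
        \<le> ennreal \<bar>u x - pwa n s x\<bar> + ennreal (?e (cell n x))"
      using AE_U01_in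
    proof eventually_elim
      case (elim x)
      have "\<bar>u x - \<gamma> * x + (LINT t:{0..x}|lborel. H t) - P x\<bar> \<le> \<bar>u x - pwa n s x\<bar> + ?e (cell n x)"
        using err[of x] elim Hint[of x] by linarith
      then have "ennreal \<bar>u x - \<gamma> * x + (LINT t:{0..x}|lborel. H t) - P x\<bar> \<le> ennreal (\<bar>u x - pwa n s x\<bar> + ?e (cell n x))"
        by (rule ennreal_leI)
      then show ?case by (subst (asm) ennreal_plus[OF abs_ge_zero e0])
    qed
  qed
  also have "\<dots> = (\<integral>\<^sup>+x. ennreal \<bar>u x - pwa n s x\<bar> \<partial>U01) + (\<integral>\<^sup>+x. ennreal (?e (cell n x)) \<partial>U01)"
    using borel_measurable_continuous_onI[OF continuous_on_pwa, of n s] by (intro nn_integral_add) auto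
  also have "\<dots> \<le> ennreal \<eta> + ennreal ((2 * V + 2 * \<gamma>) / real n)"
    unfolding nn_integral_cell[OF n0, of "\<lambda>i. ennreal (?e i)"] by (intro add_mono near e_sum)
  also have "\<dots> = ennreal (\<eta> + (2 * V + 2 * \<gamma>) / real n)"
    using \<open>0 \<le> \<eta>\<close> V0 \<gamma>_pos by (intro ennreal_plus[symmetric]) auto
  also have "\<dots> \<le> ennreal \<delta>"
  proof (rule ennreal_leI)
    have "(2 * V + 2 * \<gamma>) / real n \<le> (2 * \<bar>V\<bar> + 2 * \<gamma> + c1 + \<bar>m\<bar>) / real n"
      using c1_nonneg by (intro divide_right_mono) auto
    then show "\<eta> + (2 * V + 2 * \<gamma>) / real n \<le> \<delta>" using \<delta> by linarith
  qed
  finally have L1: "(\<integral>\<^sup>+x. ennreal \<bar>u x - \<gamma> * x + (LINT t:{0..x}|lborel. H t) - P x\<bar> \<partial>U01) \<le> ennreal \<delta>" .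
  have small: "(c1 + \<bar>m\<bar>) / real n \<le> \<delta>" "\<gamma> / real n \<le> \<delta>"
  proof -
    have "(c1 + \<bar>m\<bar>) / real n \<le> (2 * \<bar>V\<bar> + 2 * \<gamma> + c1 + \<bar>m\<bar>) / real n"
      "\<gamma> / real n \<le> (2 * \<bar>V\<bar> + 2 * \<gamma> + c1 + \<bar>m\<bar>) / real n"
      using c1_nonneg \<gamma>_pos by (auto intro!: divide_right_mono)
    then show "(c1 + \<bar>m\<bar>) / real n \<le> \<delta>" "\<gamma> / real n \<le> \<delta>" using \<delta> \<open>0 \<le> \<eta>\<close> by linarith+
  qed
  show "0 \<le> C - m + \<delta>" using lb(2) small by linarith
  have "(\<integral>\<^sup>+x. supaff b (H x) \<partial>U01) = (\<integral>\<^sup>+x. supaff b (h (cell n x)) \<partial>U01)"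
    using AE_U01_in by (intro nn_integral_cong_AE, eventually_elim) (simp add: H_def)
  also have "\<dots> = (\<Sum>i<n. supaff b (h i)) * ennreal (1 / real n)"
    by (rule nn_integral_cell[OF n0, of "\<lambda>i. supaff b (h i)"])
  also have "(\<Sum>i<n. supaff b (h i)) = (\<Sum>i<n-1. supaff b (h i))"
  proof -
    obtain n' where n': "n = Suc n'" using n by (cases n) auto
    then show ?thesis by (simp add: h_def supaff_0)
  qed
  also have "\<dots> \<le> (\<Sum>i<n-1. supaff b (\<gamma> - (s i + s (i + 1)) / 2))"
    by (intro sum_mono) (auto simp: h_def max_def supaff_0)
  finally have "(\<integral>\<^sup>+x. supaff b (H x) \<partial>U01) \<le> (\<Sum>i<n-1. supaff b (\<gamma> - (s i + s (i + 1)) / 2)) * ennreal (1 / real n)"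
    by (simp add: mult_right_mono)
  also have "\<dots> \<le> ennreal (C - m + (c1 + \<bar>m\<bar>) / real n)" by (rule lb(1))
  also have "\<dots> \<le> ennreal (C - m + \<delta>)" using small by (intro ennreal_leI) auto
  finally have F: "(\<integral>\<^sup>+x. supaff b (H x) \<partial>U01) \<le> ennreal (C - m + \<delta>)" .
  have mono: "\<forall>x y. 0 < x \<longrightarrow> x \<le> y \<longrightarrow> y < 1 \<longrightarrow> P x \<le> P y"
    unfolding P_def using cell_mono cell_bounds(1)[OF n0] by (auto intro!: p_mono)
  have rng: "\<forall>x. 0 < x \<longrightarrow> x < 1 \<longrightarrow> 0 \<le> P x \<and> P x \<le> ell - \<gamma> + (LINT t:{0..1}|lborel. H t) + \<delta>"
  proof (intro allI impI)
    fix x :: real assume "0 < x" "x < 1"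
    then have c: "cell n x < n" by (intro cell_bounds n0) auto
    show "0 \<le> P x \<and> P x \<le> ell - \<gamma> + (LINT t:{0..1}|lborel. H t) + \<delta>"
      unfolding P_def H1 using p_low[OF c] p_up[OF c] small(2) by auto
  qed
  have "H \<in> competitors b ell \<gamma> (C - m) u \<delta>"
    unfolding competitors_def mem_Collect_eq
  proof (intro conjI bexI[of _ P])
    show "\<forall>x. 0 \<le> H x" using h0 by (auto simp: H_def)
  qed (fact Hm F mono rng L1 Pm)+
  then show "competitors b ell \<gamma> (C - m) u \<delta> \<noteq> {}" by auto
qed

end

section \<open>Consequences of the hypotheses on the potentials\<close>

lemma biconj_le: "f z \<noteq> - \<infinity> \<Longrightarrow> biconj f z \<le> f z"
  unfolding biconj_def
proof (rule SUP_least)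
  fix p assume "f z \<noteq> - \<infinity>"
  moreover have "ereal (p * z) - f z \<le> fconj f p" unfolding fconj_def by (rule SUP_upper) simp
  ultimately show "ereal (p * z) - fconj f p \<le> f z" by (cases "f z"; cases "fconj f p") auto
qed

lemma J0_of_le: "J0_of J1 J2 ((x + y) / 2) \<le> J2 ((x + y) / 2) + ereal (1/2) * (J1 x + J1 y)"
  unfolding J0_of_def
  by (intro add_left_mono ereal_mult_left_mono INF_lower2[of "(x, y)"]) auto

lemma J0_of_ge:
  assumes "\<And>x. ereal (- c) \<le> J1 x" "ereal r \<le> J2 z"
  shows "ereal (r - c) \<le> J0_of J1 J2 z"
proof -
  have "ereal (- (2 * c)) \<le> (INF p \<in> {p. fst p + snd p = 2 * z}. J1 (fst p) + J1 (snd p))"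
  proof (rule INF_greatest)
    fix p :: "real \<times> real"
    have "ereal (- c) + ereal (- c) \<le> J1 (fst p) + J1 (snd p)" by (intro add_mono assms)
    then show "ereal (- (2 * c)) \<le> J1 (fst p) + J1 (snd p)" by simp
  qed
  then have "ereal (1/2) * ereal (- (2 * c)) \<le> ereal (1/2) * (INF p \<in> {p. fst p + snd p = 2 * z}. J1 (fst p) + J1 (snd p))"
    by (intro ereal_mult_left_mono) auto
  then have "ereal r + ereal (- c) \<le> J0_of J1 J2 z"
    unfolding J0_of_def by (intro add_mono assms) simp
  then show ?thesis by simp
qed

text \<open>Near -\<infinity> the function \<Psi> exceeds (p/k)|z|, and elsewhere \<Psi> \<ge> 0
  suffices at the price of a constant. Such minorants for every p make the conjugate of J0 finite on
  the nonpositive half line.\<close>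

lemma superlinear_minorant:
  fixes \<Psi> J :: "real \<Rightarrow> ereal"
  assumes \<Psi>0: "\<And>z. 0 \<le> \<Psi> z" and lim: "((\<lambda>z. \<Psi> z / ereal \<bar>z\<bar>) \<longlongrightarrow> \<infinity>) at_bot"
    and k: "0 < k" and p: "0 \<le> p" and low: "\<And>z. ereal k * (\<Psi> z - 1) \<le> J z"
  obtains c where "\<And>z. ereal (- p * z - c) \<le> J z"
proof -
  have "\<forall>\<^sub>F z in at_bot. ereal (p / k) < \<Psi> z / ereal \<bar>z\<bar>" using lim by (rule order_tendstoD) simp
  then obtain N where N: "\<And>z. z \<le> N \<Longrightarrow> ereal (p / k) < \<Psi> z / ereal \<bar>z\<bar>" by (auto simp: eventually_at_bot_linorder)
  \<comment> \<open>The cap at -1 keeps z negative, so that multiplying by |z| is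
    legitimate.\<close>
  define N' where "N' = min N (-1)"
  have "ereal (- p * z - (k + p * \<bar>N'\<bar>)) \<le> J z" for z
  proof (cases "\<Psi> z")
    case (real r)
    have r: "0 \<le> r" using \<Psi>0[of z] real by simp
    have "- p * z - (k + p * \<bar>N'\<bar>) \<le> k * (r - 1)"
    proof (cases "z \<le> N'")
      case True
      then have z: "z \<le> N" "z < 0" by (auto simp: N'_def)
      then have "p / k < r / \<bar>z\<bar>" using N[OF z(1)] real by simp
      then have "p * - z < k * r" using z k by (simp add: field_simps)
      moreover have "0 \<le> p * \<bar>N'\<bar>" using p by simp
      ultimately show ?thesis by (simp add: algebra_simps)
    next
      case False
      then have "p * - z \<le> p * \<bar>N'\<bar>" using p by (intro mult_left_mono) (auto simp: N'_def)
      moreover have "0 \<le> k * r" using k r by simp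
      ultimately show ?thesis by (simp add: algebra_simps)
    qed
    then have "ereal (- p * z - (k + p * \<bar>N'\<bar>)) \<le> ereal k * (\<Psi> z - 1)" using real by (simp add: one_ereal_def)
    then show ?thesis using low[of z] by (rule order_trans)
  next
    case PInf
    then have "J z = \<infinity>" using low[of z] k by (simp add: one_ereal_def)
    then show ?thesis by simp
  next
    case MInf
    then show ?thesis using \<Psi>0[of z] by simp
  qed
  then show ?thesis using that by blast
qed

text \<open>The conjugate of J0 is finite at nonpositive slopes, since J0 is superlinear at
  -\<infinity>, and infinite at positive ones, since J0 has a finite limit at +\<infinity>. So the
  biconjugate is a supremum of nonincreasing affine functions, which yields its monotonicity and its
  representation by \<open>supaff\<close>.\<close>

lemma LJ_hyps_lennard_jones:
  assumes "LJ_hyps J1 J2"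
  obtains \<gamma> m c1 b where "lennard_jones J1 J2 \<gamma> m c1 b"
proof -
  define J0 where "J0 = J0_of J1 J2"
  define f where "f = biconj J0"
  have LJ2: "\<And>z. J0 z = f z \<Longrightarrow> J0 z < \<infinity> \<Longrightarrow>
        (\<exists>!p. fst p + snd p = 2 * z \<and> J0 z = J2 z + ereal (1/2) * (J1 (fst p) + J1 (snd p)))"
    and dom: "edom J1 = edom J2" "{0<..} \<subseteq> edom J1"
    and lim: "(J1 \<longlongrightarrow> 0) at_top" "(J2 \<longlongrightarrow> 0) at_top"
    using assms unfolding LJ_hyps_def Let_def J0_def[symmetric] f_def[symmetric] by blast+
  obtain L where L: "(J0 \<longlongrightarrow> ereal L) at_top"
    and ex1: "\<exists>\<Psi> :: real \<Rightarrow> ereal. (\<forall>z. \<Psi> z \<ge> 0) \<and> ereal_convex \<Psi> \<and>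
          ((\<lambda>z. \<Psi> z / ereal \<bar>z\<bar>) \<longlongrightarrow> \<infinity>) at_bot \<and>
          (\<exists>c1 c2::real. c1 > 0 \<and> c2 > 0 \<and>
             (\<forall>z. ereal c1 * (\<Psi> z - 1) \<le> J1 z \<and> J1 z \<le> ereal c2 * max (\<Psi> z) (ereal \<bar>z\<bar>)) \<and>
             (\<forall>z. ereal c1 * (\<Psi> z - 1) \<le> J2 z \<and> J2 z \<le> ereal c2 * max (\<Psi> z) (ereal \<bar>z\<bar>)))"
    and ex2: "\<exists>\<gamma>. \<gamma> > 0 \<and> {x. \<forall>y. J0 x \<le> J0 y} = {\<gamma>} \<and> (\<forall>z\<le>\<gamma>. J0 z = f z)"
    using assms unfolding LJ_hyps_def Let_def J0_def[symmetric] f_def[symmetric]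
    by (elim conjE exE) (rule that, assumption, blast, blast)
  obtain \<gamma> where \<gamma>: "\<gamma> > 0" "{x. \<forall>y. J0 x \<le> J0 y} = {\<gamma>}" and f_J0: "\<And>z. z \<le> \<gamma> \<Longrightarrow> J0 z = f z"
    using ex2 by blast
  obtain \<Psi> where \<Psi>: "\<And>z. \<Psi> z \<ge> 0" "ereal_convex \<Psi>" "((\<lambda>z. \<Psi> z / ereal \<bar>z\<bar>) \<longlongrightarrow> \<infinity>) at_bot"
    and ex3: "\<exists>c1 c2::real. c1 > 0 \<and> c2 > 0 \<and>
             (\<forall>z. ereal c1 * (\<Psi> z - 1) \<le> J1 z \<and> J1 z \<le> ereal c2 * max (\<Psi> z) (ereal \<bar>z\<bar>)) \<and>
             (\<forall>z. ereal c1 * (\<Psi> z - 1) \<le> J2 z \<and> J2 z \<le> ereal c2 * max (\<Psi> z) (ereal \<bar>z\<bar>))"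
    using ex1 by blast
  obtain k c2 where k: "k > 0" "c2 > 0"
    and J1b: "\<And>z. ereal k * (\<Psi> z - 1) \<le> J1 z" "\<And>z. J1 z \<le> ereal c2 * max (\<Psi> z) (ereal \<bar>z\<bar>)"
    and J2b: "\<And>z. ereal k * (\<Psi> z - 1) \<le> J2 z" "\<And>z. J2 z \<le> ereal c2 * max (\<Psi> z) (ereal \<bar>z\<bar>)"
    using ex3 by blast
  have low: "ereal (- k) \<le> J1 z" "ereal (- k) \<le> J2 z" for z
  proof -
    have "ereal (- k) \<le> ereal k * (\<Psi> z - 1)" using \<Psi>(1)[of z] k by (cases "\<Psi> z") (auto simp: one_ereal_def algebra_simps)
    then show "ereal (- k) \<le> J1 z" "ereal (- k) \<le> J2 z" using J1b(1)[of z] J2b(1)[of z] by (auto intro: order_trans)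
  qed
  obtain c0 where c0: "\<And>z. ereal (- 1 * z - c0) \<le> J1 z"
    using superlinear_minorant[OF \<Psi>(1,3) k(1) _ J1b(1), of 1] by auto
  define c1 where "c1 = max k c0"
  have J0_le: "J0 ((x + y) / 2) \<le> J2 ((x + y) / 2) + ereal (1/2) * (J1 x + J1 y)" for x y
    unfolding J0_def by (rule J0_of_le)
  have J0_le': "J0 z \<le> J2 z + J1 z" for z
    using J0_le[of z z] low(1)[of z] by (cases "J1 z") auto
  have J0_low: "ereal (- k - k) \<le> J0 z" for z unfolding J0_def using low by (intro J0_of_ge)
  have J0_MInf: "J0 z \<noteq> - \<infinity>" for z using J0_low[of z] by auto
  have \<gamma>min: "J0 \<gamma> \<le> J0 y" for y using \<gamma>(2) by blast
  have fin: "J1 x < \<infinity>" "J2 x < \<infinity>" if "0 < x" for x using that dom by (auto simp: edom_def)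
  have "J0 \<gamma> < \<infinity>"
    using J0_le'[of \<gamma>] fin[OF \<gamma>(1)] by (cases "J1 \<gamma>"; cases "J2 \<gamma>") auto
  then obtain m where m: "J0 \<gamma> = ereal m" using J0_MInf[of \<gamma>] by (cases "J0 \<gamma>") auto
  define c where "c p = real_of_ereal (fconj J0 (- p))" for p
  have fc: "fconj J0 (- p) = ereal (c p)" if p: "0 \<le> p" for p
  proof -
    obtain c' where c': "\<And>z. ereal (- p * z - c') \<le> J2 z"
      using superlinear_minorant[OF \<Psi>(1,3) k(1) p J2b(1)] by auto
    have "fconj J0 (- p) \<le> ereal (c' + k)"
      unfolding fconj_def
    proof (rule SUP_least)
      fix z
      have "ereal (- p * z - c' - k) \<le> J0 z" unfolding J0_def using low c' by (intro J0_of_ge)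
      then show "ereal (- p * z) - J0 z \<le> ereal (c' + k)" by (cases "J0 z") auto
    qed
    moreover have "ereal (- p * \<gamma>) - J0 \<gamma> \<le> fconj J0 (- p)" unfolding fconj_def by (rule SUP_upper) simp
    ultimately show ?thesis unfolding c_def m by (cases "fconj J0 (- p)") auto
  qed
  have fc_pos: "fconj J0 p = \<infinity>" if p: "0 < p" for p
  proof -
    have "\<forall>\<^sub>F z in at_top. J0 z < ereal (L + 1)" using L by (rule order_tendstoD) simp
    then obtain Z where Z: "\<And>z. Z \<le> z \<Longrightarrow> J0 z < ereal (L + 1)" by (auto simp: eventually_at_top_linorder)
    have "ereal B \<le> fconj J0 p" for B
    proof -
      define z where "z = max Z ((B + L + 1) / p)"
      have "B + L + 1 \<le> p * z" using p by (simp add: z_def max_def field_simps)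
      then have "ereal B \<le> ereal (p * z) - J0 z" using Z[of z] J0_MInf[of z] by (cases "J0 z") (auto simp: z_def)
      also have "\<dots> \<le> fconj J0 p" unfolding fconj_def by (rule SUP_upper) simp
      finally show ?thesis .
    qed
    then show ?thesis by (rule ereal_top)
  qed
  have f_ge: "ereal (- p * z - c p) \<le> f z" if "0 \<le> p" for p z
  proof -
    have "ereal (- p * z) - fconj J0 (- p) \<le> f z" unfolding f_def biconj_def by (rule SUP_upper) simp
    then show ?thesis using fc[OF that] by simp
  qed
  have f_le: "f z \<le> B" if "\<And>p. 0 \<le> p \<Longrightarrow> ereal (- p * z - c p) \<le> B" for B z
    unfolding f_def biconj_def
  proof (rule SUP_least)
    fix q :: real
    show "ereal (q * z) - fconj J0 q \<le> B"
      using that[of "- q"] fc[of "- q"] fc_pos[of q] by (cases "0 < q") auto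
  qed
  \<comment> \<open>Slope 0 gives the constant minorant m, so cutting the affine functions off at 0
    in \<open>ennreal\<close> loses nothing.\<close>
  have f_m: "ereal m \<le> f z" for z
  proof -
    have "fconj J0 (- 0) \<le> ereal (- m)" unfolding fconj_def
    proof (rule SUP_least)
      fix y
      show "ereal (- 0 * y) - J0 y \<le> ereal (- m)" using \<gamma>min[of y] unfolding m by (cases "J0 y") auto
    qed
    then have "ereal m \<le> ereal (- 0 * z - c 0)" using fc[of 0] by simp
    also have "\<dots> \<le> f z" by (rule f_ge) simp
    finally show ?thesis .
  qed
  \<comment> \<open>The intercepts after recentring at \<gamma> and subtracting m.\<close>
  define b where "b p = p * \<gamma> + c p + m" for p
  have b: "p * (\<gamma> - z) - b p = (- p * z - c p) - m" for p z by (simp add: b_def algebra_simps)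
  have env: "f z = ereal m + enn2ereal (supaff b (\<gamma> - z))" for z
  proof (rule antisym)
    show "f z \<le> ereal m + enn2ereal (supaff b (\<gamma> - z))"
    proof (rule f_le)
      fix p :: real assume p: "0 \<le> p"
      let ?X = "p * (\<gamma> - z) - b p"
      have "ereal ?X \<le> enn2ereal (ennreal ?X)" by (cases "0 \<le> ?X") (auto simp: enn2ereal_ennreal ennreal_neg zero_ennreal.rep_eq)
      also have "\<dots> \<le> enn2ereal (supaff b (\<gamma> - z))"
        using supaff_upper[OF p] by (simp add: less_eq_ennreal.rep_eq)
      finally have "ereal m + ereal ?X \<le> ereal m + enn2ereal (supaff b (\<gamma> - z))" by (rule add_left_mono)
      then show "ereal (- p * z - c p) \<le> ereal m + enn2ereal (supaff b (\<gamma> - z))" unfolding b by simp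
    qed
    have fm0: "0 \<le> f z - ereal m" using f_m[of z] by (cases "f z") auto
    have "supaff b (\<gamma> - z) \<le> e2ennreal (f z - ereal m)"
      unfolding supaff_def
    proof (rule SUP_least)
      fix p :: real assume "p \<in> {0..}"
      then have "ereal (- p * z - c p) \<le> f z" by (intro f_ge) simp
      then have "ereal (p * (\<gamma> - z) - b p) \<le> f z - ereal m" unfolding b by (cases "f z") auto
      then have "e2ennreal (ereal (p * (\<gamma> - z) - b p)) \<le> e2ennreal (f z - ereal m)" by (rule e2ennreal_mono)
      then show "ennreal (p * (\<gamma> - z) - b p) \<le> e2ennreal (f z - ereal m)" by (simp add: e2ennreal_ereal)
    qed
    then have "enn2ereal (supaff b (\<gamma> - z)) \<le> enn2ereal (e2ennreal (f z - ereal m))" by (simp add: less_eq_ennreal.rep_eq)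
    also have "\<dots> = f z - ereal m" using fm0 by (rule enn2ereal_e2ennreal)
    finally show "ereal m + enn2ereal (supaff b (\<gamma> - z)) \<le> f z"
      by (cases "f z"; cases "enn2ereal (supaff b (\<gamma> - z))") (auto simp: algebra_simps)
  qed
  have "lennard_jones J1 J2 \<gamma> m c1 b"
  proof
    show "biconj (J0_of J1 J2) z = ereal m + enn2ereal (supaff b (\<gamma> - z))" for z
      using env unfolding f_def J0_def .
    have "ereal m + enn2ereal (supaff b 0) = ereal m" using env[of \<gamma>] f_J0[of \<gamma>] m by simp
    then show "supaff b 0 = 0" by (cases "supaff b 0") (auto simp: enn2ereal_ennreal)
    show "0 < \<gamma>" by fact
    show "0 \<le> c1" using k by (simp add: c1_def)
    show "biconj (J0_of J1 J2) ((x + y) / 2) \<le> J2 ((x + y) / 2) + ereal (1/2) * (J1 x + J1 y)" for x y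
      using biconj_le[of J0 "(x + y) / 2", OF J0_MInf] J0_le[of x y] unfolding J0_def by (rule order_trans)
    show "ereal (- c1) \<le> J1 x" "ereal (- c1) \<le> J2 x" for x
      using low[of x] by (auto simp: c1_def intro: order_trans[rotated])
    show "ereal (- x - c1) \<le> J1 x" for x
      using c0[of x] by (auto simp: c1_def intro: order_trans[rotated])
    show "J1 x < \<infinity>" "J2 x < \<infinity>" if "0 < x" for x using fin[OF that] .
    show "J1 z + J2 z = ereal m + enn2ereal (supaff b (\<gamma> - z))" if z: "z \<le> \<gamma>" "supaff b (\<gamma> - z) < top" for z
    proof -
      have "f z < \<infinity>" unfolding env using z(2) by (cases "supaff b (\<gamma> - z)") (auto simp: enn2ereal_ennreal)
      define opt where "opt p \<longleftrightarrow> fst p + snd p = 2 * z \<and> J0 z = J2 z + ereal (1/2) * (J1 (fst p) + J1 (snd p))" for p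
      have J0f: "J0 z = f z" by (rule f_J0[OF z(1)])
      have "J0 z < \<infinity>" unfolding J0f by fact
      then have "\<exists>!p. opt p" unfolding opt_def by (rule LJ2[OF J0f])
      then obtain p where p: "opt p" and unique: "\<And>q. opt q \<Longrightarrow> q = p" by blast
      have "opt (snd p, fst p)" using p unfolding opt_def fst_conv snd_conv by (simp only: add.commute[of "snd p"] add.commute[of "J1 (snd p)"])
      then have "(snd p, fst p) = p" by (rule unique)
      then have "fst p = snd p" by (metis fst_conv)
      then have xy: "fst p = z" "snd p = z" "J0 z = J2 z + ereal (1/2) * (J1 (fst p) + J1 (snd p))"
        using p unfolding opt_def by auto
      then have "J0 z = J1 z + J2 z"
        using xy(3) low[of z] unfolding xy(1,2) by (cases "J1 z"; cases "J2 z") auto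
      then show ?thesis using f_J0[OF z(1)] env by simp
    qed
    show "\<exists>X>0. \<forall>x\<ge>X. J1 x + J2 x \<le> 1"
    proof -
      have "\<forall>\<^sub>F x in at_top. J1 x < ereal (1/2)" "\<forall>\<^sub>F x in at_top. J2 x < ereal (1/2)"
        using lim by (auto intro: order_tendstoD)
      then have "\<forall>\<^sub>F x in at_top. J1 x + J2 x \<le> 1 \<and> x \<ge> 1"
        using eventually_ge_at_top[of "1::real"]
      proof eventually_elim
        case (elim x)
        then have "J1 x + J2 x \<le> ereal (1/2) + ereal (1/2)" by (intro add_mono) auto
        then show ?case using elim by (simp add: one_ereal_def)
      qed
      then obtain X where "\<forall>x\<ge>X. J1 x + J2 x \<le> 1 \<and> x \<ge> 1" by (auto simp: eventually_at_top_linorder)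
      then show ?thesis by (intro exI[of _ "max X 1"]) auto
    qed
    \<comment> \<open>By the two growth bounds \<open>J2\<close> is finite exactly where \<Psi> is,
      so its domain is convex.\<close>
    show "J2 ((x + y) / 2) < \<infinity>" if "J2 x < \<infinity>" "J2 y < \<infinity>" for x y
    proof -
      have *: "\<Psi> w < \<infinity>" if "J2 w < \<infinity>" for w
        using J2b(1)[of w] that k by (cases "\<Psi> w") (auto simp: one_ereal_def)
      have "\<Psi> ((1 - 1/2) * x + (1/2) * y) \<le> ereal (1 - 1/2) * \<Psi> x + ereal (1/2) * \<Psi> y"
        using \<Psi>(2) unfolding ereal_convex_def by (metis half_bounded_equal less_eq_real_def zero_less_divide_1_iff zero_less_numeral divide_le_eq_1_pos one_le_numeral)
      also have "\<dots> < \<infinity>" using *[OF that(1)] *[OF that(2)] \<Psi>(1)[of x] \<Psi>(1)[of y]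
        by (cases "\<Psi> x"; cases "\<Psi> y") auto
      also have "(1 - 1/2) * x + (1/2) * y = (x + y) / 2" by (simp add: field_simps)
      finally have "\<Psi> ((x + y) / 2) < \<infinity>" .
      then have "ereal c2 * max (\<Psi> ((x + y) / 2)) (ereal \<bar>(x + y) / 2\<bar>) < \<infinity>"
        using \<Psi>(1)[of "(x + y) / 2"] by (cases "\<Psi> ((x + y) / 2)") (auto simp: max_def)
      then show ?thesis using J2b(2)[of "(x + y) / 2"] by (rule order.strict_trans1[rotated])
    qed
  qed
  then show ?thesis using that by blast
qed

section \<open>Interpolation at the representative atoms\<close>

lemma elem_unique:
  assumes "atoms_ok n T" "consecutive T a b" "a \<le> i" "i < b"
  shows "elem_lo T i = a" "elem_hi T i = b"
proof -
  have "b \<le> n" using assms by (auto simp: atoms_ok_def consecutive_def)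
  then have "i < n" using assms by simp
  note e = elem_props[OF assms(1) this]
  show "elem_lo T i = a"
    using e assms unfolding consecutive_def by (metis less_le_trans le_less_trans linorder_neqE_nat)
  show "elem_hi T i = b"
    using e assms unfolding consecutive_def by (metis less_le_trans le_less_trans linorder_neqE_nat)
qed

definition interp_slope :: "nat \<Rightarrow> nat set \<Rightarrow> (nat \<Rightarrow> real) \<Rightarrow> nat \<Rightarrow> real" where
  "interp_slope n T y i = (y (elem_hi T i) - y (elem_lo T i)) * real n / real (elem_hi T i - elem_lo T i)"

lemma interp_slope_elem:
  assumes "atoms_ok n T" "consecutive T a b" "a \<le> i" "i < b"
  shows "interp_slope n T y i = (y b - y a) * real n / real (b - a)"
  unfolding interp_slope_def elem_unique[OF assms] ..

text \<open>Induction over the atoms: the cells of the element ending at t add exactly the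
  difference of y at t and at the previous atom.\<close>

lemma interp_nodes:
  assumes n: "0 < n" and T: "atoms_ok n T" and y0: "y 0 = 0" and t: "t \<in> T"
  shows "(\<Sum>i<t. interp_slope n T y i) / real n = y t"
  using t
proof (induction t rule: less_induct)
  case (less t)
  show ?case
  proof (cases "t = 0")
    case False
    have "t \<le> n" using less.prems T by (auto simp: atoms_ok_def)
    then have i: "t - 1 < n" using False by simp
    note e = elem_props[OF T i]
    define a where "a = elem_lo T (t - 1)"
    have hi: "elem_hi T (t - 1) = t"
    proof (rule antisym)
      show "elem_hi T (t - 1) \<le> t"
      proof (rule ccontr)
        assume "\<not> elem_hi T (t - 1) \<le> t"
        then have "elem_lo T (t - 1) < t \<and> t < elem_hi T (t - 1)" using e(2) False by auto
        then show False using e(1) less.prems unfolding consecutive_def by blast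
      qed
      show "t \<le> elem_hi T (t - 1)" using e(3) False by simp
    qed
    have c: "consecutive T a t" using e(1) unfolding hi a_def .
    then have at: "a \<in> T" "a < t" by (auto simp: consecutive_def)
    have "(\<Sum>i<t. interp_slope n T y i) = (\<Sum>i<a. interp_slope n T y i) + (\<Sum>i\<in>{a..<t}. interp_slope n T y i)"
      using at(2) by (subst sum.union_disjoint[symmetric]) (auto intro: sum.cong)
    also have "(\<Sum>i\<in>{a..<t}. interp_slope n T y i) = (\<Sum>i\<in>{a..<t}. (y t - y a) * real n / real (t - a))"
      using interp_slope_elem[OF T c] by (intro sum.cong) auto
    also have "\<dots> = (y t - y a) * real n" using at(2) by simp
    finally have "(\<Sum>i<t. interp_slope n T y i) / real n = (\<Sum>i<a. interp_slope n T y i) / real n + (y t - y a)"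
      using n by (simp add: add_divide_distrib)
    then show ?thesis using less.IH[OF at(2,1)] by simp
  qed (simp add: y0)
qed

lemma interp_in_A_T:
  assumes n: "0 < n" and T: "atoms_ok n T"
  shows "pwa n (interp_slope n T y) \<in> A_T n T"
proof -
  have "\<exists>\<alpha> \<beta>. \<forall>x\<in>{real a / real n .. real b / real n}. pwa n (interp_slope n T y) x = \<alpha> * x + \<beta>"
    if c: "consecutive T a b" for a b
  proof -
    have ab: "a < b" "b \<le> n" using c T by (auto simp: consecutive_def atoms_ok_def)
    define \<sigma> where "\<sigma> = (y b - y a) * real n / real (b - a)"
    have "pwa n (interp_slope n T y) x = (\<Sum>i<a. interp_slope n T y i) / real n + \<sigma> * (x - real a / real n)"
      if "x \<in> {real a / real n .. real b / real n}" for x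
      using that n ab interp_slope_elem[OF T c] by (intro pwa_const_between[where b=b]) (auto simp: \<sigma>_def)
    then show ?thesis
      by (intro exI[of _ \<sigma>] exI[of _ "(\<Sum>i<a. interp_slope n T y i) / real n - \<sigma> * (real a / real n)"])
         (auto simp: algebra_simps)
  qed
  then show ?thesis unfolding A_T_def by (auto intro: continuous_intros)
qed

lemma interp_eq:
  assumes n: "0 < n" and T: "atoms_ok n T" and y0: "y 0 = 0" and c: "consecutive T a b"
    and x: "real a / real n \<le> x" "x \<le> real b / real n"
  shows "pwa n (interp_slope n T y) x = y a + (y b - y a) * real n / real (b - a) * (x - real a / real n)"
proof -
  have ab: "a < b" "b \<le> n" "a \<in> T" using c T by (auto simp: consecutive_def atoms_ok_def)
  have "pwa n (interp_slope n T y) x = (\<Sum>i<a. interp_slope n T y i) / real n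
      + (y b - y a) * real n / real (b - a) * (x - real a / real n)"
    using interp_slope_elem[OF T c] x by (intro pwa_const_between[OF n ab(1,2)]) auto
  then show ?thesis using interp_nodes[where y=y, OF n T y0 ab(3)] by simp
qed

lemma card_nat_interval:
  fixes x w :: real
  assumes "0 \<le> w"
  shows "finite {i::nat. x \<le> real i \<and> real i < x + w}" "real (card {i::nat. x \<le> real i \<and> real i < x + w}) \<le> w + 1"
proof -
  let ?S = "{i::nat. x \<le> real i \<and> real i < x + w}"
  have sub: "?S \<subseteq> {nat \<lceil>x\<rceil>..<nat \<lceil>x + w\<rceil>}" by (auto simp: nat_ceiling_le_eq) linarith
  then show "finite ?S" by (rule finite_subset) simp
  have "card ?S \<le> nat \<lceil>x + w\<rceil> - nat \<lceil>x\<rceil>" using card_mono[OF _ sub] by simp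
  then have "real (card ?S) \<le> real (nat \<lceil>x + w\<rceil> - nat \<lceil>x\<rceil>)" by simp
  also have "\<dots> = real (nat \<lceil>x + w\<rceil>) - real (nat \<lceil>x\<rceil>)"
    using assms by (intro of_nat_diff nat_mono ceiling_mono) simp
  also have "\<dots> \<le> w + 1" using assms by linarith
  finally show "real (card ?S) \<le> w + 1" .
qed

section \<open>Block functions\<close>

text \<open>Slope \<open>z j\<close> on the j-th of M equal blocks, and a jump \<open>c j\<close> at
  each interior boundary j/M. The function is right-continuous: its value at j/M includes the jump
  there.\<close>

definition blockU :: "nat \<Rightarrow> (nat \<Rightarrow> real) \<Rightarrow> (nat \<Rightarrow> real) \<Rightarrow> real \<Rightarrow> real" where
  "blockU M z c x = pwa M z x + (\<Sum>j\<in>{1..<M}. if real j / real M \<le> x then c j else 0)"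

lemma le_cell_iff: "0 < n \<Longrightarrow> 0 \<le> x \<Longrightarrow> j \<le> cell n x \<longleftrightarrow> real j / real n \<le> x"
proof -
  assume n: "0 < n" and x: "0 \<le> x"
  have "j \<le> cell n x \<longleftrightarrow> int j \<le> \<lfloor>real n * x\<rfloor>" using n x by (simp add: cell_def le_nat_iff)
  also have "\<dots> \<longleftrightarrow> real j \<le> real n * x" by (simp add: le_floor_iff)
  finally show ?thesis using n by (simp add: field_simps)
qed

lemma blockU_cell:
  assumes "0 < M" "0 \<le> x" "x < 1"
  shows "blockU M z c x = pwa M z x + (\<Sum>j\<in>{1..cell M x}. c j)"
proof -
  have "(\<Sum>j\<in>{1..<M}. if real j / real M \<le> x then c j else 0) = (\<Sum>j\<in>{1..<M}. if j \<le> cell M x then c j else 0)"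
    by (simp only: le_cell_iff[OF assms(1,2)])
  also have "\<dots> = (\<Sum>j\<in>{j\<in>{1..<M}. j \<le> cell M x}. c j)" by (rule sum.inter_filter[symmetric]) simp
  also have "{j\<in>{1..<M}. j \<le> cell M x} = {1..cell M x}" using cell_bounds(1)[OF assms] by auto
  finally show ?thesis by (simp add: blockU_def)
qed

lemma blockU_0: "blockU M z c 0 = 0"
  unfolding blockU_def by (auto intro!: sum.neutral simp: divide_le_0_iff)

lemma blockU_1: "0 < M \<Longrightarrow> blockU M z c 1 = (\<Sum>j<M. z j) / real M + (\<Sum>j\<in>{1..<M}. c j)"
  unfolding blockU_def using pwa_node[of M M z] by (auto intro!: sum.cong)

lemma blockU_same_block:
  assumes M: "0 < M" and x: "0 \<le> x" "x \<le> y" "y < 1" and eq: "cell M x = cell M y"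
  shows "blockU M z c y = blockU M z c x + z (cell M x) * (y - x)"
proof -
  note cx = cell_bounds[OF M x(1) le_less_trans[OF x(2,3)]]
  note cy = cell_bounds[OF M order_trans[OF x(1,2)] x(3)]
  show ?thesis
    using blockU_cell[OF M, of x z c] blockU_cell[OF M, of y z c] x eq
      pwa_cell[OF cx(1,2) less_imp_le[OF cx(3)], of z] pwa_cell[OF cy(1,2) less_imp_le[OF cy(3)], of z]
    by (simp add: algebra_simps)
qed

text \<open>The point 1 has \<open>cell M 1\<close> equal to M and lies in no block, while the jumps
  stop at M - 1; hence the last block needs its own version of the formula.\<close>

lemma blockU_last_block:
  assumes M: "0 < M" and x: "0 \<le> x" "x < 1" and eq: "cell M x = M - 1"
  shows "blockU M z c 1 = blockU M z c x + z (M - 1) * (1 - x)"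
proof -
  note cx = cell_bounds[OF M x]
  have "real (Suc (M - 1)) / real M = 1" using M by simp
  then have "pwa M z 1 = (\<Sum>j<M-1. z j) / real M + z (M - 1) * (1 - real (M - 1) / real M)"
    using M by (intro pwa_cell) auto
  moreover have "pwa M z x = (\<Sum>j<M-1. z j) / real M + z (M - 1) * (x - real (M - 1) / real M)"
    using pwa_cell[OF cx(1,2) less_imp_le[OF cx(3)], of z] unfolding eq .
  moreover have "{1..M - 1} = {1..<M}" using M by auto
  moreover have "blockU M z c 1 = pwa M z 1 + (\<Sum>j\<in>{1..<M}. c j)"
    unfolding blockU_def by (auto intro!: sum.cong)
  ultimately show ?thesis using blockU_cell[OF M x, of z c] eq by (simp add: algebra_simps)
qed

text \<open>The jump at the start of the block of y lies between the two points, no jump is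
  negative, and the continuous part changes by at most Z (y - x).\<close>

lemma blockU_jump:
  assumes M: "0 < M" and x: "0 \<le> x" "x \<le> y" "y < 1" and lt: "cell M x < cell M y"
    and Z: "\<And>j. j < M \<Longrightarrow> \<bar>z j\<bar> \<le> Z" and k: "\<And>j. 1 \<le> j \<Longrightarrow> j < M \<Longrightarrow> k \<le> c j" "0 < k"
  shows "k - Z * (y - x) \<le> blockU M z c y - blockU M z c x"
proof -
  have cy: "cell M y < M" using x M by (intro cell_bounds) auto
  have "\<bar>pwa M z y - pwa M z x\<bar> \<le> Z * (y - x)" using x M Z by (intro pwa_increment_abs_le) auto
  moreover have "(\<Sum>j\<in>{1..cell M y}. c j) = (\<Sum>j\<in>{1..cell M x}. c j) + (\<Sum>j\<in>{cell M x<..cell M y}. c j)"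
    using lt by (subst sum.union_disjoint[symmetric]) (auto intro!: sum.cong)
  moreover have "c (cell M y) \<le> (\<Sum>j\<in>{cell M x<..cell M y}. c j)"
    using lt cy k by (intro member_le_sum) (auto intro: order_trans[OF less_imp_le[OF k(2)]])
  moreover have "k \<le> c (cell M y)" using lt cy by (intro k) auto
  ultimately show ?thesis using blockU_cell[OF M, of x z c] blockU_cell[OF M, of y z c] x by simp
qed

lemma blockU_abs_le:
  assumes M: "0 < M" and x: "0 \<le> x" "x \<le> 1"
    and Z: "\<And>j. j < M \<Longrightarrow> \<bar>z j\<bar> \<le> Z" and k: "\<And>j. 1 \<le> j \<Longrightarrow> j < M \<Longrightarrow> 0 \<le> c j"
  shows "\<bar>blockU M z c x\<bar> \<le> Z + (\<Sum>j\<in>{1..<M}. c j)"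
proof -
  have Z0: "0 \<le> Z" using Z[OF M] by linarith
  have "\<bar>pwa M z x - pwa M z 0\<bar> \<le> Z * (x - 0)" using x M Z by (intro pwa_increment_abs_le) auto
  also have "\<dots> \<le> Z" using x Z0 by (simp add: mult_left_le)
  finally have "\<bar>pwa M z x\<bar> \<le> Z" by simp
  moreover have "0 \<le> (\<Sum>j\<in>{1..<M}. if real j / real M \<le> x then c j else 0)" using k by (intro sum_nonneg) auto
  moreover have "(\<Sum>j\<in>{1..<M}. if real j / real M \<le> x then c j else 0) \<le> (\<Sum>j\<in>{1..<M}. c j)"
    using k by (intro sum_mono) auto
  ultimately show ?thesis unfolding blockU_def by linarith
qed

lemma measurable_blockU [measurable]: "blockU M z c \<in> borel_measurable borel"
proof -
  have [measurable]: "pwa M z \<in> borel_measurable borel"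
    by (intro borel_measurable_continuous_onI continuous_on_pwa)
  show ?thesis unfolding blockU_def by measurable
qed

context lennard_jones
begin

text \<open>In the continuum region every pair takes half of \<open>j2\<close> from each of its
  cells, so the second-neighbour energies add up to \<open>j2\<close> per cell. Each of the k1 + (n
  - k2) atomistic pairs costs at most C0 more, and c1 makes up for the half energies missing at the
  two ends.\<close>

lemma slopes_upper_bound:
  assumes n: "3 < n" and k: "0 < k1" "k1 < k2" "k2 < n - 2"
    and fin: "\<And>i. i < n \<Longrightarrow> J1 (s i) = ereal (j1 i)" "\<And>i. i < n \<Longrightarrow> J2 (s i) = ereal (j2 i)"
    and atom: "\<And>i. i < n - 1 \<Longrightarrow> i < k1 \<or> k2 \<le> i + 1 \<Longrightarrow> J2 ((s i + s (i + 1)) / 2) \<le> ereal ((j2 i + j2 (i + 1)) / 2 + C0)"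
  shows "(\<Sum>i<n. ereal (1 / real n) * J1 (s i)) + (\<Sum>i<n-1. ereal (1 / real n) * nnn_term J2 k1 k2 s i)
    \<le> ereal (((\<Sum>i<n. j1 i + j2 i) + C0 * real (k1 + (n - k2)) + c1) / real n)"
proof -
  let ?l = "1 / real n"
  define B where "B = {i. i < n - 1 \<and> (i < k1 \<or> k2 \<le> i + 1)}"
  have B: "finite B" "card B = k1 + (n - k2)"
  proof -
    have "B = {..<k1} \<union> {k2 - 1..<n - 1}" using k by (auto simp: B_def)
    moreover have "{..<k1} \<inter> {k2 - 1..<n - 1} = {}" using k by auto
    ultimately have "finite B" "card B = k1 + (n - 1 - (k2 - 1))"
      using card_Un_disjoint[of "{..<k1}" "{k2 - 1..<n - 1}"] by auto
    moreover have "n - 1 - (k2 - 1) = n - k2" using k by simp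
    ultimately show "finite B" "card B = k1 + (n - k2)" by auto
  qed
  have t: "nnn_term J2 k1 k2 s i \<le> ereal ((j2 i + j2 (i + 1)) / 2 + (if i \<in> B then C0 else 0))" if i: "i < n - 1" for i
  proof (cases "i \<in> B")
    case True
    then have "\<not> (k1 \<le> i \<and> i \<le> k2 - 2)" using k by (auto simp: B_def)
    then show ?thesis using True atom[of i] by (simp only: nnn_term_def if_False if_True) (simp add: B_def)
  next
    case False
    then have bulk: "k1 \<le> i \<and> i \<le> k2 - 2" using i by (auto simp: B_def)
    have "i < n" "i + 1 < n" using i by auto
    then have "nnn_term J2 k1 k2 s i = ereal ((j2 i + j2 (i + 1)) / 2)"
      unfolding nnn_term_def if_P[OF bulk] by (simp add: fin)
    then show ?thesis using False by simp
  qed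
  have A1: "(\<Sum>i<n. ereal ?l * J1 (s i)) = ereal (\<Sum>i<n. ?l * j1 i)"
    unfolding sum_ereal[symmetric] using fin by (intro sum.cong) auto
  have A2: "(\<Sum>i<n-1. ereal ?l * nnn_term J2 k1 k2 s i) \<le> (\<Sum>i<n-1. ereal ?l * ereal ((j2 i + j2 (i + 1)) / 2 + (if i \<in> B then C0 else 0)))"
    using t by (intro sum_mono ereal_mult_left_mono) auto
  have A3: "(\<Sum>i<n-1. ereal ?l * ereal ((j2 i + j2 (i + 1)) / 2 + (if i \<in> B then C0 else 0))) = ereal (\<Sum>i<n-1. ?l * ((j2 i + j2 (i + 1)) / 2 + (if i \<in> B then C0 else 0)))"
    by (simp add: sum_ereal[symmetric] del: sum_ereal)
  have "(\<Sum>i<n. ereal ?l * J1 (s i)) + (\<Sum>i<n-1. ereal ?l * nnn_term J2 k1 k2 s i)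
      \<le> ereal (\<Sum>i<n. ?l * j1 i) + ereal (\<Sum>i<n-1. ?l * ((j2 i + j2 (i + 1)) / 2 + (if i \<in> B then C0 else 0)))"
    unfolding A1 by (rule add_left_mono[OF A2[unfolded A3]])
  also have "\<dots> = ereal (((\<Sum>i<n. j1 i) + (\<Sum>i<n-1. (j2 i + j2 (i + 1)) / 2 + (if i \<in> B then C0 else 0))) / real n)"
    by (simp add: add_divide_distrib sum_divide_distrib)
  also have "(\<Sum>i<n-1. (j2 i + j2 (i + 1)) / 2 + (if i \<in> B then C0 else 0))
      = (\<Sum>i<n. j2 i) - (j2 0 + j2 (n - 1)) / 2 + C0 * real (k1 + (n - k2))"
  proof -
    have "(\<Sum>i<n-1. if i \<in> B then C0 else 0) = (\<Sum>i\<in>B. C0)"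
    proof -
      have "{..<n-1} \<inter> B = B" by (auto simp: B_def)
      then show ?thesis using sum.inter_restrict[of "{..<n-1}" "\<lambda>_. C0" B] by simp
    qed
    then have 0: "(\<Sum>i<n-1. if i \<in> B then C0 else 0) = C0 * real (k1 + (n - k2))" using B by simp
    obtain n' where n': "n = Suc n'" using n by (cases n) auto
    have 1: "(\<Sum>i<n'. j2 (Suc i)) = (\<Sum>i<n'. j2 i) + j2 n' - j2 0"
      using sum.lessThan_Suc_shift[of j2 n'] sum.lessThan_Suc[of j2 n'] by simp
    have "(\<Sum>i<n'. (j2 i + j2 (i + 1)) / 2) = ((\<Sum>i<n'. j2 i) + (\<Sum>i<n'. j2 (Suc i))) / 2"
      by (simp add: sum.distrib sum_divide_distrib add_divide_distrib)
    then have "(\<Sum>i<n-1. (j2 i + j2 (i + 1)) / 2) = (\<Sum>i<n. j2 i) - (j2 0 + j2 (n - 1)) / 2"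
      unfolding 1 by (simp add: n' field_simps)
    then show ?thesis unfolding sum.distrib 0 by simp
  qed
  also have "ereal (((\<Sum>i<n. j1 i) + ((\<Sum>i<n. j2 i) - (j2 0 + j2 (n - 1)) / 2 + C0 * real (k1 + (n - k2)))) / real n)
      \<le> ereal (((\<Sum>i<n. j1 i + j2 i) + C0 * real (k1 + (n - k2)) + c1) / real n)"
  proof -
    have "- c1 \<le> j2 0" "- c1 \<le> j2 (n - 1)" using J2_ge[of "s 0"] J2_ge[of "s (n - 1)"] fin(2)[of 0] fin(2)[of "n - 1"] n by auto
    then have low: "- c1 \<le> (j2 0 + j2 (n - 1)) / 2" by (simp add: field_simps)
    have gen: "a + (b - q + r) \<le> a + b + r + c1" if "- c1 \<le> q" for a b q r :: real using that by simp
    show ?thesis unfolding sum.distrib ereal_less_eq(3)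
      by (rule divide_right_mono[OF gen[OF low]]) simp
  qed
  finally show ?thesis .
qed

end

text \<open>Block slopes \<^term>\<open>z\<close> and jumps \<^term>\<open>c\<close> at the interior block boundaries, for a fixed
  \<^term>\<open>n\<close> large enough that the elements are short compared with the \<^term>\<open>M\<close> blocks and that
  the atomistic region lies in the first and the last block.\<close>

locale recovery = lennard_jones +
  fixes M p n k1 k2 :: nat and z c \<phi> :: "nat \<Rightarrow> real" and T :: "nat set" and ell u0 u1 \<kappa> Z X C0 Kb :: real
  assumes n3: "3 < n" and kk: "0 < k1" "k1 < k2" "k2 < n - 2"
    and T: "atoms_ok n T" and mesh: "\<And>a b. consecutive T a b \<Longrightarrow> b - a \<le> p"
    and M2: "2 \<le> M" and z_le: "\<And>j. j < M \<Longrightarrow> z j \<le> \<gamma>"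
    and \<phi>: "\<And>j. j < M \<Longrightarrow> supaff b (\<gamma> - z j) = ennreal (\<phi> j)" "\<And>j. 0 \<le> \<phi> j"
    and c_ge: "\<And>j. 1 \<le> j \<Longrightarrow> j < M \<Longrightarrow> \<kappa> \<le> c j" "0 < \<kappa>"
    and tot: "blockU M z c 1 = ell"
    and Z: "\<And>j. j < M \<Longrightarrow> \<bar>z j\<bar> \<le> Z"
    and X: "\<And>x. X \<le> x \<Longrightarrow> J1 x + J2 x \<le> 1" "0 < X"
    and pos: "0 < ell" "0 < u0" "0 < u1"
    and C0: "\<And>x y. x \<in> {u0, u1} \<union> z ` {..<M} \<Longrightarrow> y \<in> {u0, u1} \<union> z ` {..<M} \<Longrightarrow>
      J2 ((x + y) / 2) \<le> ereal ((real_of_ereal (J2 x) + real_of_ereal (J2 y)) / 2 + C0)"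
    and Kb: "J1 u0 + J2 u0 \<le> ereal Kb" "J1 u1 + J2 u1 \<le> ereal Kb" "1 \<le> Kb"
    and small1: "real p * real M < real n"
    and small2: "(3 * Z + u0 + u1) * (real p / real n) \<le> \<kappa> / 2"
    and small3: "X * (real p / real n) \<le> \<kappa> / 2"
    and small4: "real (k1 + p) * real M < real n" "real (n - k2 + 1 + p) * real M < real n"
begin

abbreviation "U \<equiv> blockU M z c"
abbreviation "S \<equiv> {u0, u1} \<union> z ` {..<M}"

definition "t_first = elem_hi T 0"
definition "t_last = elem_lo T (n - 1)"
text \<open>The shifts \<^term>\<open>d\<close> and \<^term>\<open>e\<close> of the nodal values in the first and the last block give
  the first and the last element the prescribed slopes \<^term>\<open>u0\<close> and \<^term>\<open>u1\<close>; the adjacent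
  jumps absorb them.\<close>

definition "d = (u0 - z 0) * (real t_first / real n)"
definition "e = (z (M - 1) - u1) * ((real n - real t_last) / real n)"
definition "corr j = (if j = 0 then d else if j = M - 1 then e else 0)"
definition "y t = (if t = 0 then 0 else if t = n then ell else U (real t / real n) + corr (cell M (real t / real n)))"
definition "s = interp_slope n T y"
text \<open>An element ending exactly at j/M counts as crossing that boundary, in accordance with
  right-continuity. The wider notion also contains the two end elements, whose slopes are
  \<open>u0\<close> and \<open>u1\<close>; \<open>jumping\<close> singles out the elements that
  receive a large slope.\<close>

definition "bad i \<longleftrightarrow> elem_lo T i = 0 \<or> elem_hi T i = n \<or>
   cell M (real (elem_lo T i) / real n) \<noteq> cell M (real (elem_hi T i) / real n)"
definition "jumping i \<longleftrightarrow> elem_lo T i \<noteq> 0 \<and> elem_hi T i \<noteq> n \<and>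
   cell M (real (elem_lo T i) / real n) \<noteq> cell M (real (elem_hi T i) / real n)"

section \<open>Elementary bounds for the mesh and the corrections\<close>

lemma n0: "0 < n" using n3 by simp
lemma M0: "0 < M" using M2 by simp
lemma Z0: "0 \<le> Z" using Z[of 0] M0 by linarith

lemma p_lt_n: "p < n"
proof -
  have "real p * 1 \<le> real p * real M" using M2 by (intro mult_left_mono) auto
  then have "real p < real n" using small1 by simp
  then show ?thesis by simp
qed

lemma consecutive_bounds: "consecutive T a b' \<Longrightarrow> a < b' \<and> b' \<le> n \<and> b' - a \<le> p"
  using mesh[of a b'] T by (auto simp: consecutive_def atoms_ok_def)

lemma first_elem: "consecutive T 0 t_first"
  using elem_props[OF T n0] by (simp add: t_first_def)

lemma last_elem: "consecutive T t_last n"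
proof -
  have i: "n - 1 < n" using n0 by simp
  have "elem_hi T (n - 1) = n" using elem_props(3,4)[OF T i] by simp
  then show ?thesis using elem_props(1)[OF T i] by (simp add: t_last_def)
qed

lemma small_cell_0: "t \<le> p \<Longrightarrow> cell M (real t / real n) = 0"
proof -
  assume "t \<le> p"
  then have "real t * real M \<le> real p * real M" by (intro mult_right_mono) auto
  then have "real t * real M < real n" using small1 by simp
  then show ?thesis using M0 n0 by (intro cell_eqI) (auto simp: field_simps)
qed

lemma large_cell_last: "n - t \<le> p \<Longrightarrow> t < n \<Longrightarrow> cell M (real t / real n) = M - 1"
proof -
  assume t: "n - t \<le> p" "t < n"
  then have "(real n - real t) * real M \<le> real p * real M" by (intro mult_right_mono) auto
  then have "(real n - real t) * real M < real n" using small1 by simp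
  then have "(real M - 1) * real n \<le> real t * real M" by (simp add: algebra_simps)
  then have "real (M - 1) / real M \<le> real t / real n" using M0 n0 by (simp add: field_simps of_nat_diff)
  then show ?thesis using M0 n0 t(2) by (intro cell_eqI) auto
qed

lemma d_bound: "\<bar>d\<bar> \<le> (u0 + Z) * (real p / real n)"
proof -
  have "t_first \<le> p" using consecutive_bounds[OF first_elem] by simp
  then have "real t_first / real n \<le> real p / real n" by (intro divide_right_mono) auto
  moreover have "\<bar>u0 - z 0\<bar> \<le> u0 + Z" using Z[of 0] M0 pos by linarith
  ultimately show ?thesis unfolding d_def abs_mult by (intro mult_mono) auto
qed

lemma e_bound: "\<bar>e\<bar> \<le> (Z + u1) * (real p / real n)"
proof -
  have "n - t_last \<le> p" "t_last < n" using consecutive_bounds[OF last_elem] by auto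
  then have "(real n - real t_last) / real n \<le> real p / real n" "0 \<le> (real n - real t_last) / real n"
    by (auto intro!: divide_right_mono)
  moreover have "\<bar>z (M - 1) - u1\<bar> \<le> Z + u1" using Z[of "M - 1"] M0 pos by linarith
  ultimately show ?thesis unfolding e_def abs_mult by (intro mult_mono) auto
qed

lemma corr_bound: "\<bar>corr j\<bar> \<le> \<bar>d\<bar> + \<bar>e\<bar>"
  by (simp add: corr_def)

lemma de_bound: "\<bar>d\<bar> + \<bar>e\<bar> \<le> (2 * Z + u0 + u1) * (real p / real n)"
proof -
  have "(2 * Z + u0 + u1) * (real p / real n) = (u0 + Z) * (real p / real n) + (Z + u1) * (real p / real n)"
    by (simp only: distrib_right[symmetric]) (simp add: algebra_simps)
  then show ?thesis using d_bound e_bound by linarith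
qed

section \<open>Slopes of the interpolant, element by element\<close>

lemma y_0: "y 0 = 0" by (simp add: y_def)

lemma slope_eq: "consecutive T a b' \<Longrightarrow> a \<le> i \<Longrightarrow> i < b' \<Longrightarrow> s i = (y b' - y a) * real n / real (b' - a)"
  unfolding s_def by (rule interp_slope_elem[OF T])

lemma slope_first:
  assumes "consecutive T 0 b'" "i < b'"
  shows "s i = u0"
proof -
  have b': "0 < b'" "b' \<le> p" using consecutive_bounds[OF assms(1)] by auto
  have lt: "b' < n" using b' p_lt_n by simp
  have t_first: "b' = t_first" using elem_unique(2)[OF T assms(1), of 0] b' by (simp add: t_first_def)
  have c: "cell M (real b' / real n) = 0" using b' by (intro small_cell_0)
  have c0: "cell M 0 = 0" by (simp add: cell_def)
  have "U (real b' / real n) = U 0 + z (cell M 0) * (real b' / real n - 0)"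
    using lt n0 c c0 by (intro blockU_same_block[OF M0]) auto
  then have "U (real b' / real n) = z 0 * (real b' / real n)" by (simp add: blockU_0 c0)
  then have "y b' = z 0 * (real b' / real n) + (u0 - z 0) * (real b' / real n)"
    using b' lt c by (simp add: y_def corr_def d_def t_first[symmetric])
  also have "\<dots> = u0 * (real b' / real n)" by (simp only: distrib_right[symmetric]) simp
  finally have "y b' = u0 * (real b' / real n)" .
  then show ?thesis using slope_eq[OF assms(1) _ assms(2)] y_0 b' n0 by simp
qed

lemma slope_last:
  assumes "consecutive T a n" "a \<le> i" "i < n"
  shows "s i = u1"
proof -
  have a: "a < n" "n - a \<le> p" using consecutive_bounds[OF assms(1)] by auto
  have a0: "a \<noteq> 0" using a p_lt_n by auto
  have "a \<le> n - 1" "n - 1 < n" using a by auto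
  then have t_last: "a = t_last" unfolding t_last_def by (intro elem_unique(1)[OF T assms(1), symmetric])
  have c: "cell M (real a / real n) = M - 1" using a by (intro large_cell_last)
  have an: "real a / real n < 1" using a by simp
  have U1: "U 1 = U (real a / real n) + z (M - 1) * (1 - real a / real n)"
    using an c by (intro blockU_last_block[OF M0]) auto
  have "y n = ell" using n0 by (simp add: y_def)
  moreover have "y a = U (real a / real n) + e" using a a0 c M2 by (simp add: y_def corr_def)
  ultimately have "y n - y a = z (M - 1) * (1 - real a / real n) - e" using U1 tot by linarith
  also have "\<dots> = u1 * ((real n - real a) / real n)"
    using n0 by (simp add: e_def t_last[symmetric] diff_divide_distrib algebra_simps)
  finally have "s i = u1 * ((real n - real a) / real n) * real n / real (n - a)"
    using slope_eq[OF assms] by simp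
  then show ?thesis using a n0 by (simp add: of_nat_diff)
qed

lemma slope_good:
  assumes "consecutive T a b'" "a \<le> i" "i < b'" "a \<noteq> 0" "b' \<noteq> n"
    and eq: "cell M (real a / real n) = cell M (real b' / real n)"
  shows "s i = z (cell M (real a / real n))"
proof -
  have ab: "a < b'" "b' < n" using consecutive_bounds[OF assms(1)] assms(5) by auto
  have le: "real a / real n \<le> real b' / real n" "real b' / real n < 1" using ab by (auto intro: divide_right_mono)
  have "U (real b' / real n) = U (real a / real n) + z (cell M (real a / real n)) * (real b' / real n - real a / real n)"
    using le eq by (intro blockU_same_block[OF M0]) auto
  then have "y b' - y a = z (cell M (real a / real n)) * ((real b' - real a) / real n)"
    using ab assms(4,5) eq by (simp add: y_def diff_divide_distrib)
  then have "s i = z (cell M (real a / real n)) * ((real b' - real a) / real n) * real n / real (b' - a)"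
    using slope_eq[OF assms(1-3)] by simp
  then show ?thesis using ab n0 by (simp add: of_nat_diff)
qed

text \<open>The increment of y is at least the jump \<kappa>, less Z p/n for the block slopes and
  less |d| + |e| for the corrections; by \<open>small2\<close> at least \<kappa>/2 is left. Over an
  element of length at most p/n this is a slope of at least X by \<open>small3\<close>.\<close>

lemma slope_jump:
  assumes "consecutive T a b'" "a \<le> i" "i < b'" "a \<noteq> 0" "b' \<noteq> n"
    and neq: "cell M (real a / real n) \<noteq> cell M (real b' / real n)"
  shows "X \<le> s i"
proof -
  have ab: "a < b'" "b' < n" "b' - a \<le> p" using consecutive_bounds[OF assms(1)] assms(5) by auto
  have le: "real a / real n \<le> real b' / real n" "real b' / real n < 1" using ab by (auto intro: divide_right_mono)
  have lt: "cell M (real a / real n) < cell M (real b' / real n)" using cell_mono[OF le(1), of M] neq by simp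
  have diff: "real b' / real n - real a / real n = real (b' - a) / real n"
    using ab by (simp add: of_nat_diff diff_divide_distrib)
  have w: "real (b' - a) / real n \<le> real p / real n" using ab by (intro divide_right_mono) auto
  have "\<kappa> - Z * (real b' / real n - real a / real n) \<le> U (real b' / real n) - U (real a / real n)"
    using le lt Z c_ge by (intro blockU_jump[OF M0]) auto
  then have 1: "\<kappa> - Z * (real p / real n) \<le> U (real b' / real n) - U (real a / real n)"
    unfolding diff using mult_left_mono[OF w Z0] by linarith
  have yy: "y b' - y a = U (real b' / real n) - U (real a / real n) + (corr (cell M (real b' / real n)) - corr (cell M (real a / real n)))"
    using ab assms(4,5) by (simp add: y_def)
  have 2: "- (\<bar>d\<bar> + \<bar>e\<bar>) \<le> corr j - corr k" for j k by (auto simp: corr_def)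
  have "(3 * Z + u0 + u1) * (real p / real n) = Z * (real p / real n) + (2 * Z + u0 + u1) * (real p / real n)"
    by (simp add: algebra_simps)
  then have inc: "\<kappa> / 2 \<le> y b' - y a" using yy 1 2[of "cell M (real b' / real n)" "cell M (real a / real n)"] de_bound small2 by linarith
  have "X * (real (b' - a) / real n) \<le> X * (real p / real n)" using w X(2) by (intro mult_left_mono) auto
  then have "X * (real (b' - a) / real n) \<le> y b' - y a" using inc small3 by linarith
  then have "X \<le> (y b' - y a) * real n / real (b' - a)" using ab n0 by (simp add: field_simps)
  then show ?thesis using slope_eq[OF assms(1-3)] by simp
qed

lemma slope_cases:
  assumes "i < n"
  shows "(jumping i \<and> X \<le> s i) \<or> (\<not> jumping i \<and> s i \<in> S)"
    "\<not> bad i \<Longrightarrow> s i = z (cell M (real i / real n))" "bad i \<Longrightarrow> s i = u0 \<or> s i = u1 \<or> X \<le> s i"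
proof -
  define a where "a = elem_lo T i"
  define b' where "b' = elem_hi T i"
  note el = elem_props[OF T assms, folded a_def b'_def]
  have good: "s i = z (cell M (real i / real n)) \<and> cell M (real i / real n) < M"
    if "a \<noteq> 0" "b' \<noteq> n" "cell M (real a / real n) = cell M (real b' / real n)"
  proof -
    have "real a / real n \<le> real i / real n" "real i / real n \<le> real b' / real n" using el by (auto intro!: divide_right_mono)
    then have "cell M (real i / real n) = cell M (real a / real n)"
      using that(3) cell_mono by (metis order_antisym)
    moreover have "cell M (real i / real n) < M" using assms M0 by (intro cell_bounds) auto
    ultimately show ?thesis using slope_good[OF el(1-3) that] by simp
  qed
  show "(jumping i \<and> X \<le> s i) \<or> (\<not> jumping i \<and> s i \<in> S)"
  proof (cases "jumping i")
    case True
    then show ?thesis using slope_jump[OF el(1-3)] by (simp add: jumping_def a_def b'_def)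
  next
    case False
    then consider "a = 0" | "b' = n" | "a \<noteq> 0" "b' \<noteq> n" "cell M (real a / real n) = cell M (real b' / real n)"
      by (auto simp: jumping_def a_def b'_def)
    then have "s i \<in> S"
    proof cases
      case 1 then show ?thesis using slope_first el by auto
    next
      case 2 then show ?thesis using slope_last el assms by auto
    next
      case 3 then show ?thesis using good by auto
    qed
    then show ?thesis using False by simp
  qed
  show "s i = z (cell M (real i / real n))" if "\<not> bad i"
    using that good by (auto simp: bad_def a_def b'_def)
  show "s i = u0 \<or> s i = u1 \<or> X \<le> s i" if bad: "bad i"
  proof -
    show ?thesis
    proof (cases "a = 0 \<or> b' = n")
      case True
      then show ?thesis using slope_first[of b' i] slope_last[of a i] el assms by auto
    next
      case False
      then have "cell M (real a / real n) \<noteq> cell M (real b' / real n)" using bad by (simp add: bad_def a_def b'_def)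
      then show ?thesis using slope_jump[OF el(1-3)] False by auto
    qed
  qed
qed

section \<open>Counting the cells near block boundaries\<close>

lemma jumping_near:
  assumes "i < n" "jumping i"
  shows "\<exists>j. 1 \<le> j \<and> j < M \<and> \<bar>real i - real n * real j / real M\<bar> \<le> real p"
proof -
  define a where "a = elem_lo T i"
  define b' where "b' = elem_hi T i"
  note el = elem_props[OF T assms(1), folded a_def b'_def]
  have ab: "a < b'" "b' < n" "b' - a \<le> p" using consecutive_bounds[OF el(1)] assms(2) by (auto simp: jumping_def b'_def)
  define j where "j = cell M (real b' / real n)"
  have le: "real a / real n \<le> real b' / real n" "real b' / real n < 1" using ab by (auto intro: divide_right_mono)
  have lt: "cell M (real a / real n) < j"
    using cell_mono[OF le(1), of M] assms(2) by (auto simp: j_def jumping_def a_def b'_def)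
  have j: "1 \<le> j" "j < M" using lt le M0 cell_bounds(1)[of M "real b' / real n"] by (auto simp: j_def)
  have "real j / real M \<le> real b' / real n" using le_cell_iff[OF M0, of "real b' / real n" j] by (simp add: j_def)
  moreover have "\<not> real j / real M \<le> real a / real n" using le_cell_iff[OF M0, of "real a / real n" j] lt by simp
  ultimately have "real n * real j / real M \<le> real b'" "real a < real n * real j / real M"
    using n0 M0 by (auto simp: field_simps)
  moreover have "real b' - real a \<le> real p" "real a \<le> real i" "real i < real b'" using ab el by auto
  ultimately have "\<bar>real i - real n * real j / real M\<bar> \<le> real p" by linarith
  then show ?thesis using j by auto
qed

lemma bad_near:
  assumes "i < n" "bad i"
  shows "\<exists>j\<le>M. \<bar>real i - real n * real j / real M\<bar> \<le> real p"
proof -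
  note el = elem_props[OF T assms(1)]
  have ab: "elem_hi T i - elem_lo T i \<le> p" using consecutive_bounds[OF el(1)] by simp
  consider "elem_lo T i = 0" | "elem_hi T i = n" | "jumping i" using assms(2) by (auto simp: bad_def jumping_def)
  then show ?thesis
  proof cases
    case 1
    then have "i \<le> p" using ab el by simp
    then show ?thesis by (intro exI[of _ 0]) auto
  next
    case 2
    then have "n - i \<le> p" using ab el by simp
    then have "\<bar>real i - real n\<bar> \<le> real p" using assms(1) by linarith
    then show ?thesis using M0 by (intro exI[of _ M]) auto
  next
    case 3
    then show ?thesis using jumping_near[OF assms(1)] by (meson less_imp_le)
  qed
qed

lemma card_bad: "real (card {i. i < n \<and> bad i}) \<le> (real M + 1) * (2 * real p + 2)"
proof -
  \<comment> \<open>The extra 1 lets the half-open window contain the integers of the closed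
    interval of radius p around the boundary; it holds at most 2p + 2 of them.\<close>
  define W where "W j = {i::nat. real n * real j / real M - real p \<le> real i \<and>
      real i < (real n * real j / real M - real p) + (2 * real p + 1)}" for j
  have W: "finite (W j)" "real (card (W j)) \<le> 2 * real p + 2" for j
    using card_nat_interval[of "2 * real p + 1" "real n * real j / real M - real p"] by (auto simp: W_def)
  have "{i. i < n \<and> bad i} \<subseteq> (\<Union>j\<in>{..M}. W j)"
  proof
    fix i assume "i \<in> {i. i < n \<and> bad i}"
    then obtain j where "j \<le> M" "\<bar>real i - real n * real j / real M\<bar> \<le> real p" using bad_near by auto
    then have "i \<in> W j" by (auto simp: W_def)
    then show "i \<in> (\<Union>j\<in>{..M}. W j)" using \<open>j \<le> M\<close> by auto
  qed
  then have "card {i. i < n \<and> bad i} \<le> card (\<Union>j\<in>{..M}. W j)" using W by (intro card_mono) auto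
  also have "\<dots> \<le> (\<Sum>j\<in>{..M}. card (W j))" by (intro card_UN_le) simp
  finally have "real (card {i. i < n \<and> bad i}) \<le> (\<Sum>j\<in>{..M}. real (card (W j)))"
    using of_nat_mono by fastforce
  also have "\<dots> \<le> (\<Sum>j\<in>{..M}. 2 * real p + 2)" using W by (intro sum_mono)
  also have "\<dots> = (real M + 1) * (2 * real p + 2)" by simp
  finally show ?thesis .
qed

lemma sum_blocks: "(\<Sum>i<n. \<phi> (cell M (real i / real n))) \<le> (\<Sum>j<M. \<phi> j) * (real n / real M + 1)"
proof -
  have cM: "cell M (real i / real n) < M" if "i < n" for i using that M0 by (intro cell_bounds) auto
  have "(\<Sum>i<n. \<phi> (cell M (real i / real n))) = (\<Sum>j<M. \<Sum>i | i \<in> {..<n} \<and> cell M (real i / real n) = j. \<phi> (cell M (real i / real n)))"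
    using cM by (intro sum.group[symmetric]) auto
  also have "\<dots> \<le> (\<Sum>j<M. \<phi> j * (real n / real M + 1))"
  proof (rule sum_mono)
    fix j assume "j \<in> {..<M}"
    let ?A = "{i. i \<in> {..<n} \<and> cell M (real i / real n) = j}"
    have "?A \<subseteq> {i. real n * real j / real M \<le> real i \<and> real i < real n * real j / real M + real n / real M}"
    proof
      fix i assume i: "i \<in> ?A"
      then have "real j / real M \<le> real i / real n" "real i / real n < real (Suc j) / real M"
        using cell_bounds(2,3)[OF M0, of "real i / real n"] by auto
      then show "i \<in> {i. real n * real j / real M \<le> real i \<and> real i < real n * real j / real M + real n / real M}"
        using M0 n0 by (auto simp: field_simps)
    qed
    then have "card ?A \<le> card {i::nat. real n * real j / real M \<le> real i \<and> real i < real n * real j / real M + real n / real M}"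
      by (intro card_mono card_nat_interval) auto
    then have "real (card ?A) \<le> real n / real M + 1"
      using card_nat_interval(2)[of "real n / real M" "real n * real j / real M"] by (simp add: of_nat_le_iff[symmetric, where ?'a=real] del: of_nat_le_iff)
    moreover have "(\<Sum>i\<in>?A. \<phi> (cell M (real i / real n))) = (\<Sum>i\<in>?A. \<phi> j)" by (intro sum.cong) auto
    ultimately show "(\<Sum>i\<in>?A. \<phi> (cell M (real i / real n))) \<le> \<phi> j * (real n / real M + 1)"
      using \<phi>(2)[of j] by (simp add: mult.commute mult_left_mono)
  qed
  finally show ?thesis by (simp add: sum_distrib_right)
qed

section \<open>Energy of the interpolant\<close>

definition "j1 i = real_of_ereal (J1 (s i))"
definition "j2 i = real_of_ereal (J2 (s i))"

text \<open>Positive slopes lie in both domains. A nonpositive one must be a block slope, where the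
  Cauchy-Born identity makes \<open>J1 + J2\<close> finite and hence, both being bounded below, each
  of the two.\<close>

lemma finite_values:
  assumes "x \<in> S \<or> X \<le> x"
  shows "J1 x = ereal (real_of_ereal (J1 x))" "J2 x = ereal (real_of_ereal (J2 x))"
proof -
  have "J1 x \<noteq> \<infinity> \<and> J2 x \<noteq> \<infinity>"
  proof (cases "0 < x")
    case True
    then show ?thesis using finite_pos by auto
  next
    case False
    then obtain j where j: "j < M" "x = z j" using assms pos X(2) by auto
    have "J1 x + J2 x = ereal (m + \<phi> j)"
      using Cauchy_Born[of x] z_le[OF j(1)] \<phi>(1)[OF j(1)] \<phi>(2)[of j] j(2) by (simp add: enn2ereal_ennreal)
    then show ?thesis using J1_cases[of x] J2_cases[of x] by auto
  qed
  then show "J1 x = ereal (real_of_ereal (J1 x))" "J2 x = ereal (real_of_ereal (J2 x))"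
    using J1_cases[of x] J2_cases[of x] by auto
qed

text \<open>Keeps the extra cost \<open>Kb - m\<close> of a bad cell nonnegative, so that an upper
  bound for the number of bad cells is one for their cost.\<close>

lemma m_le_Kb: "m \<le> Kb"
proof -
  have "ereal m \<le> ereal m + enn2ereal (supaff b (\<gamma> - u0))" by (simp add: add_increasing2)
  also have "\<dots> \<le> J2 u0 + ereal (1/2) * (J1 u0 + J1 u0)" using envelope_le[of u0 u0] unfolding envelope by simp
  also have "\<dots> = J1 u0 + J2 u0" using J1_cases[of u0] by (auto simp: add.commute)
  also have "\<dots> \<le> ereal Kb" by (rule Kb)
  finally show ?thesis by simp
qed

lemma cell_energy:
  assumes "i < n"
  shows "j1 i + j2 i \<le> m + \<phi> (cell M (real i / real n)) + (if bad i then Kb - m else 0)"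
proof (cases "bad i")
  case False
  define j where "j = cell M (real i / real n)"
  have j: "j < M" unfolding j_def using assms M0 by (intro cell_bounds) auto
  have s: "s i = z j" using slope_cases(2)[OF assms False] by (simp add: j_def)
  then have fin: "J1 (s i) = ereal (j1 i)" "J2 (s i) = ereal (j2 i)"
    unfolding j1_def j2_def using finite_values[of "s i"] j by auto
  have "J1 (s i) + J2 (s i) = ereal (m + \<phi> j)"
    using Cauchy_Born[of "s i"] z_le[OF j] \<phi>(1)[OF j] \<phi>(2)[of j] s by (simp add: enn2ereal_ennreal)
  then show ?thesis using False fin by (simp add: j_def)
next
  case True
  have "J1 (s i) + J2 (s i) \<le> ereal Kb"
    using slope_cases(3)[OF assms True] Kb X(1)[of "s i"] by (auto intro: order_trans)
  moreover have "s i \<in> S \<or> X \<le> s i" using slope_cases(3)[OF assms True] by auto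
  then have "J1 (s i) = ereal (j1 i)" "J2 (s i) = ereal (j2 i)"
    unfolding j1_def j2_def by (rule finite_values)+
  ultimately have "j1 i + j2 i \<le> Kb" by simp
  then show ?thesis using True \<phi>(2)[of "cell M (real i / real n)"] by simp
qed

lemma total_energy:
  "(\<Sum>i<n. j1 i + j2 i) / real n \<le> m + (\<Sum>j<M. \<phi> j) / real M
     + ((\<Sum>j<M. \<phi> j) + (real M + 1) * (2 * real p + 2) * (Kb - m)) / real n"
proof -
  have "(\<Sum>i<n. j1 i + j2 i) \<le> (\<Sum>i<n. m + \<phi> (cell M (real i / real n)) + (if bad i then Kb - m else 0))"
    using cell_energy by (intro sum_mono) auto
  also have "\<dots> = real n * m + (\<Sum>i<n. \<phi> (cell M (real i / real n))) + (\<Sum>i<n. if bad i then Kb - m else 0)"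
    by (simp add: sum.distrib)
  also have "(\<Sum>i<n. if bad i then Kb - m else 0) = real (card {i. i < n \<and> bad i}) * (Kb - m)"
  proof -
    have "(\<Sum>i<n. if bad i then Kb - m else 0) = (\<Sum>i\<in>{i\<in>{..<n}. bad i}. Kb - m)"
      by (rule sum.inter_filter[symmetric]) simp
    also have "{i\<in>{..<n}. bad i} = {i. i < n \<and> bad i}" by auto
    finally show ?thesis by simp
  qed
  also have "real n * m + (\<Sum>i<n. \<phi> (cell M (real i / real n))) + real (card {i. i < n \<and> bad i}) * (Kb - m)
      \<le> real n * m + (\<Sum>j<M. \<phi> j) * (real n / real M + 1) + (real M + 1) * (2 * real p + 2) * (Kb - m)"
    using m_le_Kb by (intro add_mono[OF add_mono[OF order_refl sum_blocks] mult_right_mono[OF card_bad]]) simp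
  finally have "(\<Sum>i<n. j1 i + j2 i) / real n
      \<le> (real n * m + (\<Sum>j<M. \<phi> j) * (real n / real M + 1) + (real M + 1) * (2 * real p + 2) * (Kb - m)) / real n"
    by (rule divide_right_mono) simp
  also have "\<dots> = m + (\<Sum>j<M. \<phi> j) / real M
     + ((\<Sum>j<M. \<phi> j) + (real M + 1) * (2 * real p + 2) * (Kb - m)) / real n"
    using n0 M0 by (simp add: add_divide_distrib distrib_left)
  finally show ?thesis .
qed

text \<open>By \<open>small4\<close> the atomistic region stays more than p cells away from every
  interior block boundary. This matters because slopes across a jump have no bound independent of n,
  whereas C0 covers only averages of slopes from a fixed finite set. Allowing i = k1 covers the
  second cell of the last pair on the left.\<close>

lemma not_jumping_atomistic:
  assumes "i < n" "i \<le> k1 \<or> k2 \<le> i + 1"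
  shows "\<not> jumping i"
proof
  assume "jumping i"
  then obtain j where j: "1 \<le> j" "j < M" "\<bar>real i - real n * real j / real M\<bar> \<le> real p"
    using jumping_near assms(1) by auto
  show False
  proof (cases "i \<le> k1")
    case True
    then have "real n * real j / real M \<le> real (k1 + p)" using j(3) by simp
    then have "real n * real j \<le> real (k1 + p) * real M" using M0 by (simp add: field_simps)
    moreover have "real n * 1 \<le> real n * real j" using j by (intro mult_left_mono) auto
    ultimately show False using small4(1) by simp
  next
    case False
    then have "real k2 \<le> real i + 1" using assms(2) by simp
    then have "real k2 - 1 - real p \<le> real n * real j / real M" using j(3) by linarith
    then have "(real k2 - 1 - real p) * real M \<le> real n * real j" using M0 by (simp add: field_simps)
    also have "\<dots> \<le> real n * (real M - 1)" using j by (intro mult_left_mono) auto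
    finally have "real n \<le> (real n - real k2 + 1 + real p) * real M" by (simp add: algebra_simps)
    also have "real n - real k2 + 1 + real p = real (n - k2 + 1 + p)" using kk by (simp add: of_nat_diff)
    finally show False using small4(2) by simp
  qed
qed

lemma energy_bound:
  "QC_energy J1 J2 n k1 k2 (pwa n s) \<le> ereal (m + (\<Sum>j<M. \<phi> j) / real M +
     ((\<Sum>j<M. \<phi> j) + (real M + 1) * (2 * real p + 2) * (Kb - m) + C0 * real (k1 + (n - k2)) + c1) / real n)"
proof -
  \<comment> \<open>Beyond the last cell the nodal differences vanish, so the two slope sequences
    are compared for i < n only.\<close>
  define s' where "s' i = (node n (pwa n s) (i + 1) - node n (pwa n s) i) / (1 / real n)" for i
  have s': "s' i = s i" if "i < n" for i
  proof -
    have "node n (pwa n s) (Suc i) - node n (pwa n s) i = s i / real n"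
      unfolding node_def using that n0 by (simp add: pwa_node add_divide_distrib del: of_nat_Suc)
    then show ?thesis using n0 by (simp add: s'_def)
  qed
  have fin: "J1 (s i) = ereal (j1 i)" "J2 (s i) = ereal (j2 i)" if "i < n" for i
    unfolding j1_def j2_def using finite_values[of "s i"] slope_cases(1)[OF that] by auto
  have "QC_energy J1 J2 n k1 k2 (pwa n s) = (\<Sum>i<n. ereal (1 / real n) * J1 (s' i))
      + (\<Sum>i<n-1. ereal (1 / real n) * nnn_term J2 k1 k2 s' i)"
    using n0 kk by (intro QC_energy_slopes) (auto simp: s'_def)
  also have "(\<Sum>i<n. ereal (1 / real n) * J1 (s' i)) = (\<Sum>i<n. ereal (1 / real n) * J1 (s i))"
    using s' by (intro sum.cong) auto
  also have "(\<Sum>i<n-1. ereal (1 / real n) * nnn_term J2 k1 k2 s' i) = (\<Sum>i<n-1. ereal (1 / real n) * nnn_term J2 k1 k2 s i)"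
    using s' by (intro sum.cong) (auto simp: nnn_term_def)
  also have "(\<Sum>i<n. ereal (1 / real n) * J1 (s i)) + (\<Sum>i<n-1. ereal (1 / real n) * nnn_term J2 k1 k2 s i)
    \<le> ereal (((\<Sum>i<n. j1 i + j2 i) + C0 * real (k1 + (n - k2)) + c1) / real n)"
  proof (rule slopes_upper_bound[OF n3 kk fin])
    fix i assume i: "i < n - 1" "i < k1 \<or> k2 \<le> i + 1"
    then have lt: "i < n" "i + 1 < n" by auto
    have "\<not> jumping i" using i by (intro not_jumping_atomistic lt) auto
    moreover have "\<not> jumping (i + 1)" using i by (intro not_jumping_atomistic lt) auto
    moreover note lt
    ultimately have "s i \<in> S" "s (i + 1) \<in> S" using slope_cases(1)[of i] slope_cases(1)[of "i + 1"] by blast+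
    then show "J2 ((s i + s (i + 1)) / 2) \<le> ereal ((j2 i + j2 (i + 1)) / 2 + C0)"
      unfolding j2_def by (rule C0)
  qed
  also have "\<dots> \<le> ereal (m + (\<Sum>j<M. \<phi> j) / real M +
     ((\<Sum>j<M. \<phi> j) + (real M + 1) * (2 * real p + 2) * (Kb - m) + C0 * real (k1 + (n - k2)) + c1) / real n)"
    using total_energy by (simp add: add_divide_distrib)
  finally show ?thesis .
qed

section \<open>Boundary values and distance to the block function\<close>

lemma boundary_conditions: "BC n ell u0 u1 (pwa n s)"
proof -
  have s0: "s 0 = u0" using slope_first[OF first_elem, of 0] consecutive_bounds[OF first_elem] by simp
  have "t_last \<le> n - 1" "n - 1 < n" using consecutive_bounds[OF last_elem] by auto
  then have sn: "s (n - 1) = u1" by (rule slope_last[OF last_elem])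
  have nn: "n \<in> T" using T by (simp add: atoms_ok_def)
  have tot_s: "(\<Sum>i<n. s i) / real n = ell"
    using interp_nodes[of n T y n, OF n0 T y_0 nn] n0 by (simp add: s_def y_def)
  have nd: "node n (pwa n s) i = (\<Sum>j<i. s j) / real n" if "i \<le> n" for i
    unfolding node_def using pwa_node[OF n0 that] .
  have "(\<Sum>j<n - 1. s j) = (\<Sum>j<n. s j) - s (n - 1)" using n0 by (cases n) auto
  then have "(\<Sum>j<n - 1. s j) / real n = ell - u1 / real n" using tot_s sn by (simp add: diff_divide_distrib)
  then show ?thesis unfolding BC_def using nd[of 0] nd[of 1] nd[of "n - 1"] nd[of n] n3 s0 tot_s by simp
qed

lemma in_A_T: "pwa n s \<in> A_T n T"
  unfolding s_def by (rule interp_in_A_T[OF n0 T])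

text \<open>The slopes are at least -Z, so adding Z x gives an increasing function between its end
  values 0 and \<open>ell\<close> + Z. The bound is free of the large slopes across jumps.\<close>

lemma pwa_bound:
  assumes "0 \<le> x" "x \<le> 1" shows "\<bar>pwa n s x\<bar> \<le> ell + Z"
proof -
  have s_ge: "- Z \<le> s i" if "i < n" for i
  proof -
    have "- Z \<le> z j" if "j < M" for j using Z[OF that] by linarith
    then show ?thesis using slope_cases(1)[OF that] pos X(2) Z0 by auto
  qed
  have "pwa n (\<lambda>i. - Z) x \<le> pwa n s x" using s_ge by (intro pwa_mono_slopes) auto
  then have "- Z * x \<le> pwa n s x" using assms n0 by (simp add: pwa_const)
  moreover have "Z * x \<le> Z" "0 \<le> Z * x" using assms Z0 by (auto simp: mult_left_le)
  moreover have "pwa n (\<lambda>i. 1 * s i + Z * 1) x \<le> pwa n (\<lambda>i. 1 * s i + Z * 1) 1"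
  proof (rule pwa_mono)
    show "0 \<le> 1 * s i + Z * 1" if "i < n" for i using s_ge[OF that] by simp
  qed (rule assms)
  then have "pwa n s x + Z * x \<le> pwa n s 1 + Z"
    unfolding pwa_mult_add using assms n0 by (simp add: pwa_const)
  moreover have "pwa n s 1 = ell" using boundary_conditions n0 by (simp add: BC_def node_def)
  ultimately show ?thesis using pos by linarith
qed

text \<open>Both functions have the same slope on such an element, so they differ only by the
  correction at its left atom.\<close>

lemma good_cell_close:
  assumes x: "0 < x" "x < 1" and good: "\<not> bad (cell n x)"
  shows "\<bar>U x - pwa n s x\<bar> \<le> \<bar>d\<bar> + \<bar>e\<bar>"
proof -
  define i where "i = cell n x"
  note ci = cell_bounds[OF n0 less_imp_le[OF x(1)] x(2), folded i_def]
  define a where "a = elem_lo T i"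
  define b' where "b' = elem_hi T i"
  note el = elem_props[OF T ci(1), folded a_def b'_def]
  have ab: "a \<noteq> 0" "b' \<noteq> n" "cell M (real a / real n) = cell M (real b' / real n)"
    using good by (auto simp: bad_def i_def[symmetric] a_def b'_def)
  have "real a / real n \<le> real i / real n" "real (Suc i) / real n \<le> real b' / real n"
    using el by (auto intro!: divide_right_mono)
  then have ax: "real a / real n \<le> x" "x \<le> real b' / real n" using ci by linarith+
  then have cx: "cell M (real a / real n) = cell M x" using ab(3) cell_mono by (metis order_antisym)
  have "pwa n s x = y a + s i * (x - real a / real n)"
    using interp_eq[of n T y a b' x, OF n0 T y_0 el(1) ax] slope_eq[OF el(1-3)] by (simp add: s_def)
  also have "s i = z (cell M (real a / real n))" by (rule slope_good[OF el(1-3) ab])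
  finally have "pwa n s x = y a + z (cell M (real a / real n)) * (x - real a / real n)" .
  moreover have "U x = U (real a / real n) + z (cell M (real a / real n)) * (x - real a / real n)"
    using ax x cx by (intro blockU_same_block[OF M0]) auto
  moreover have "y a = U (real a / real n) + corr (cell M (real a / real n))"
    using ab(1) el consecutive_bounds[OF el(1)] ci(1) by (simp add: y_def)
  ultimately show ?thesis using corr_bound[of "cell M (real a / real n)"] by simp
qed

text \<open>The bad cells have total length of order (p + 1)/n for fixed M, and there the difference
  is bounded through the sup norms; on the others only the corrections remain.\<close>

lemma L1_bound:
  "(\<integral>\<^sup>+x. ennreal \<bar>U x - pwa n s x\<bar> \<partial>U01) \<le> ennreal (((real M + 1) * (2 * real p + 2) * (ell + 2 * Z + (\<Sum>j\<in>{1..<M}. c j))) / real n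
     + (2 * Z + u0 + u1) * (real p / real n))"
proof -
  define K where "K = ell + 2 * Z + (\<Sum>j\<in>{1..<M}. c j)"
  have cpos: "0 \<le> c j" if "1 \<le> j" "j < M" for j using c_ge(1)[OF that] c_ge(2) by linarith
  have K0: "0 \<le> K" using pos Z0 cpos by (auto simp: K_def intro!: add_nonneg_nonneg sum_nonneg)
  define g where "g i = (if bad i then K else 0) + (\<bar>d\<bar> + \<bar>e\<bar>)" for i
  have g0: "0 \<le> g i" for i using K0 by (simp add: g_def)
  have close: "\<bar>U x - pwa n s x\<bar> \<le> g (cell n x)" if x: "0 < x" "x < 1" for x
  proof (cases "bad (cell n x)")
    case False
    then show ?thesis using good_cell_close[OF x] by (simp add: g_def)
  next
    case True
    have "\<bar>U x\<bar> \<le> Z + (\<Sum>j\<in>{1..<M}. c j)" using x Z cpos by (intro blockU_abs_le[OF M0]) auto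
    moreover have "\<bar>pwa n s x\<bar> \<le> ell + Z" using x by (intro pwa_bound) auto
    ultimately show ?thesis using True by (simp add: g_def K_def)
  qed
  have "(\<integral>\<^sup>+x. ennreal \<bar>U x - pwa n s x\<bar> \<partial>U01) \<le> (\<integral>\<^sup>+x. ennreal (g (cell n x)) \<partial>U01)"
  proof (rule nn_integral_mono_AE)
    show "AE x in U01. ennreal \<bar>U x - pwa n s x\<bar> \<le> ennreal (g (cell n x))"
      using AE_U01_in by eventually_elim (auto intro!: ennreal_leI close)
  qed
  also have "\<dots> = (\<Sum>i<n. ennreal (g i)) * ennreal (1 / real n)"
    by (rule nn_integral_cell[OF n0, of "\<lambda>i. ennreal (g i)"])
  also have "\<dots> = ennreal ((\<Sum>i<n. g i) / real n)"
    using g0 by (simp add: sum_ennreal ennreal_mult''[symmetric])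
  also have "\<dots> \<le> ennreal (((real M + 1) * (2 * real p + 2) * K) / real n + (2 * Z + u0 + u1) * (real p / real n))"
  proof (rule ennreal_leI)
    have "(\<Sum>i<n. g i) = (\<Sum>i<n. if bad i then K else 0) + real n * (\<bar>d\<bar> + \<bar>e\<bar>)"
      by (simp add: g_def sum.distrib)
    also have "(\<Sum>i<n. if bad i then K else 0) = (\<Sum>i\<in>{i\<in>{..<n}. bad i}. K)"
      by (rule sum.inter_filter[symmetric]) simp
    also have "\<dots> = real (card {i. i < n \<and> bad i}) * K" by simp
    also have "\<dots> \<le> (real M + 1) * (2 * real p + 2) * K" using K0 by (intro mult_right_mono card_bad)
    finally have "(\<Sum>i<n. g i) / real n \<le> ((real M + 1) * (2 * real p + 2) * K + real n * (\<bar>d\<bar> + \<bar>e\<bar>)) / real n"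
      by (intro divide_right_mono) auto
    then have "(\<Sum>i<n. g i) / real n \<le> (real M + 1) * (2 * real p + 2) * K / real n + (\<bar>d\<bar> + \<bar>e\<bar>)"
      using n0 by (simp add: add_divide_distrib)
    then show "(\<Sum>i<n. g i) / real n \<le> ((real M + 1) * (2 * real p + 2) * K) / real n + (2 * Z + u0 + u1) * (real p / real n)"
      using de_bound by linarith
  qed
  finally show ?thesis unfolding K_def .
qed

end

context lennard_jones
begin

text \<open>The constants Z, \<kappa>, X, C0 and Kb depend on the potentials, the block data and the
  boundary values alone, so every smallness condition of the locale holds for large n. C0 is finite
  because finitely many slopes are involved and the mean of two of them stays in the domain of
  \<open>J2\<close>.\<close>

lemma recovery_sequence_blocks:
  assumes M2: "2 \<le> M" and z: "\<And>j. j < M \<Longrightarrow> z j \<le> \<gamma>" "\<And>j. j < M \<Longrightarrow> supaff b (\<gamma> - z j) < top"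
    and c: "\<And>j. 1 \<le> j \<Longrightarrow> j < M \<Longrightarrow> 0 < c j" and tot: "blockU M z c 1 = ell"
    and pos: "0 < ell" "0 < u0" "0 < u1"
    and k_range: "\<forall>\<^sub>F n in sequentially. 0 < k1 n \<and> k1 n < k2 n \<and> k2 n < n - 2"
    and K: "(\<lambda>n. real (k1 n) / real n) \<longlonglongrightarrow> 0" "(\<lambda>n. real (n - k2 n) / real n) \<longlonglongrightarrow> 0"
    and T: "\<And>n. atoms_ok n (T n)"
    and p: "(\<lambda>n. real (p n) / real n) \<longlonglongrightarrow> 0" "\<And>n a b. consecutive (T n) a b \<Longrightarrow> b - a \<le> p n"
    and \<epsilon>: "0 < \<epsilon>"
  shows "\<forall>\<^sub>F n in sequentially. \<exists>s. pwa n s \<in> A_T n (T n) \<and> BC n ell u0 u1 (pwa n s) \<and>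
    (\<integral>\<^sup>+x. ennreal \<bar>blockU M z c x - pwa n s x\<bar> \<partial>U01) \<le> ennreal \<epsilon> \<and>
    QC_energy J1 J2 n (k1 n) (k2 n) (pwa n s) \<le> ereal (m + (\<Sum>j<M. enn2real (supaff b (\<gamma> - z j))) / real M + \<epsilon>)"
proof -
  define \<phi> where "\<phi> j = enn2real (supaff b (\<gamma> - z j))" for j
  have \<phi>: "supaff b (\<gamma> - z j) = ennreal (\<phi> j)" if "j < M" for j using z(2)[OF that] by (simp add: \<phi>_def)
  have \<phi>0: "0 \<le> \<phi> j" for j by (simp add: \<phi>_def)
  define Z where "Z = (\<Sum>j<M. \<bar>z j\<bar>)"
  have Z: "\<bar>z j\<bar> \<le> Z" if "j < M" for j unfolding Z_def using that by (intro member_le_sum) auto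
  define \<kappa> where "\<kappa> = Min (c ` {1..<M})"
  have ne: "c ` {1..<M} \<noteq> {}" using M2 by auto
  have \<kappa>: "\<kappa> \<le> c j" if "1 \<le> j" "j < M" for j unfolding \<kappa>_def using that by (intro Min_le) auto
  have "\<kappa> \<in> c ` {1..<M}" unfolding \<kappa>_def using ne by (intro Min_in) auto
  then have \<kappa>0: "0 < \<kappa>" using c by auto
  obtain X where X: "0 < X" "\<And>x. X \<le> x \<Longrightarrow> J1 x + J2 x \<le> 1" using bounded_at_top by auto
  define S where "S = {u0, u1} \<union> z ` {..<M}"
  have J2S: "J2 x < \<infinity>" if xS: "x \<in> S" for x
  proof (cases "0 < x")
    case True
    then show ?thesis by (rule finite_pos)
  next
    case False
    then obtain j where j: "j < M" "x = z j" using xS pos by (auto simp: S_def)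
    have "J1 x + J2 x = ereal (m + \<phi> j)"
      using Cauchy_Born[of x] z[OF j(1)] \<phi>[OF j(1)] \<phi>0[of j] j(2) by (simp add: enn2ereal_ennreal)
    then show ?thesis using J1_cases[of x] J2_cases[of x] by auto
  qed
  define g where "g q = real_of_ereal (J2 ((fst q + snd q) / 2)) - (real_of_ereal (J2 (fst q)) + real_of_ereal (J2 (snd q))) / 2" for q
  define C0 where "C0 = (\<Sum>q\<in>S \<times> S. \<bar>g q\<bar>)"
  have C0: "J2 ((x + y) / 2) \<le> ereal ((real_of_ereal (J2 x) + real_of_ereal (J2 y)) / 2 + C0)" if "x \<in> S" "y \<in> S" for x y
  proof -
    have "\<bar>g (x, y)\<bar> \<le> C0" unfolding C0_def using that by (intro member_le_sum) (auto simp: S_def)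
    then have "g (x, y) \<le> C0" by simp
    moreover have "J2 ((x + y) / 2) < \<infinity>" using that by (intro J2_finite_midpoint J2S)
    ultimately show ?thesis using J2_cases[of "(x + y) / 2"] by (auto simp: g_def)
  qed
  define Kb where "Kb = \<bar>real_of_ereal (J1 u0 + J2 u0)\<bar> + \<bar>real_of_ereal (J1 u1 + J2 u1)\<bar> + 1"
  have Kb: "J1 u0 + J2 u0 \<le> ereal Kb" "J1 u1 + J2 u1 \<le> ereal Kb" "1 \<le> Kb"
  proof -
    have f: "\<exists>r. J1 x + J2 x = ereal r" if "0 < x" for x
      using finite_pos[OF that] J1_cases[of x] J2_cases[of x] by auto
    show "J1 u0 + J2 u0 \<le> ereal Kb" "J1 u1 + J2 u1 \<le> ereal Kb" "1 \<le> Kb"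
      using f[OF pos(2)] f[OF pos(3)] by (auto simp: Kb_def)
  qed
  define Kv where "Kv = ell + 2 * Z + (\<Sum>j\<in>{1..<M}. c j)"
  have inv: "(\<lambda>n. 1 / real n) \<longlonglongrightarrow> 0" by (rule lim_1_over_n)
  have lim: "(\<lambda>n. a * (real (p n) / real n)) \<longlonglongrightarrow> 0" for a
    using tendsto_mult_left[OF p(1), of a] by simp
  have ev2: "\<forall>\<^sub>F n in sequentially. (3 * Z + u0 + u1) * (real (p n) / real n) < \<kappa> / 2"
    "\<forall>\<^sub>F n in sequentially. X * (real (p n) / real n) < \<kappa> / 2"
    "\<forall>\<^sub>F n in sequentially. real M * (real (p n) / real n) < 1"
    using \<kappa>0 by (intro order_tendstoD(2)[OF lim]; simp)+
  have "(\<lambda>n. real M * (real (k1 n) / real n + real (p n) / real n)) \<longlonglongrightarrow> real M * (0 + 0)"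
    by (intro tendsto_intros K p)
  then have ev4: "\<forall>\<^sub>F n in sequentially. real M * (real (k1 n) / real n + real (p n) / real n) < 1"
    by (rule order_tendstoD) simp
  have "(\<lambda>n. real M * (real (n - k2 n) / real n + 1 / real n + real (p n) / real n)) \<longlonglongrightarrow> real M * (0 + 0 + 0)"
    by (intro tendsto_intros K p inv)
  then have ev5: "\<forall>\<^sub>F n in sequentially. real M * (real (n - k2 n) / real n + 1 / real n + real (p n) / real n) < 1"
    by (rule order_tendstoD) simp
  define E1 where "E1 n = ((real M + 1) * (2 * real (p n) + 2) * Kv) / real n + (2 * Z + u0 + u1) * (real (p n) / real n)" for n
  have "(\<lambda>n. (real M + 1) * Kv * (2 * (real (p n) / real n) + 2 * (1 / real n)) + (2 * Z + u0 + u1) * (real (p n) / real n))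
      \<longlonglongrightarrow> (real M + 1) * Kv * (2 * 0 + 2 * 0) + (2 * Z + u0 + u1) * 0"
    by (intro tendsto_intros p inv)
  moreover have "E1 = (\<lambda>n. (real M + 1) * Kv * (2 * (real (p n) / real n) + 2 * (1 / real n)) + (2 * Z + u0 + u1) * (real (p n) / real n))"
    unfolding E1_def by (rule ext) (simp add: algebra_simps add_divide_distrib)
  ultimately have "E1 \<longlonglongrightarrow> 0" by simp
  then have ev6: "\<forall>\<^sub>F n in sequentially. E1 n < \<epsilon>" using \<epsilon> by (rule order_tendstoD)
  define E2 where "E2 n = ((\<Sum>j<M. \<phi> j) + (real M + 1) * (2 * real (p n) + 2) * (Kb - m) + C0 * real (k1 n + (n - k2 n)) + c1) / real n" for n
  have "(\<lambda>n. (\<Sum>j<M. \<phi> j) * (1 / real n) + (real M + 1) * (Kb - m) * (2 * (real (p n) / real n) + 2 * (1 / real n))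
      + C0 * (real (k1 n) / real n + real (n - k2 n) / real n) + c1 * (1 / real n))
      \<longlonglongrightarrow> (\<Sum>j<M. \<phi> j) * 0 + (real M + 1) * (Kb - m) * (2 * 0 + 2 * 0) + C0 * (0 + 0) + c1 * 0"
    by (intro tendsto_intros p inv K)
  moreover have "E2 = (\<lambda>n. (\<Sum>j<M. \<phi> j) * (1 / real n) + (real M + 1) * (Kb - m) * (2 * (real (p n) / real n) + 2 * (1 / real n))
      + C0 * (real (k1 n) / real n + real (n - k2 n) / real n) + c1 * (1 / real n))"
    unfolding E2_def by (rule ext) (simp add: algebra_simps add_divide_distrib diff_divide_distrib)
  ultimately have "E2 \<longlonglongrightarrow> 0" by simp
  then have ev7: "\<forall>\<^sub>F n in sequentially. E2 n < \<epsilon>" using \<epsilon> by (rule order_tendstoD)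
  show ?thesis
    using k_range ev2 ev4 ev5 ev6 ev7 eventually_gt_at_top[of 3]
  proof eventually_elim
    case (elim n)
    have n0: "0 < real n" using elim by simp
    interpret R: recovery J1 J2 \<gamma> m c1 b M "p n" n "k1 n" "k2 n" z c \<phi> "T n" ell u0 u1 \<kappa> Z X C0 Kb
    proof
      show "3 < n" "0 < k1 n" "k1 n < k2 n" "k2 n < n - 2" using elim by auto
      show "atoms_ok n (T n)" by (rule T)
      show "b' - a \<le> p n" if "consecutive (T n) a b'" for a b' using that by (rule p)
      show "2 \<le> M" "0 < \<kappa>" "blockU M z c 1 = ell" "0 < X" "0 < ell" "0 < u0" "0 < u1" "1 \<le> Kb" by fact+
      show "z j \<le> \<gamma>" if "j < M" for j using that by (rule z)
      show "supaff b (\<gamma> - z j) = ennreal (\<phi> j)" if "j < M" for j using that by (rule \<phi>)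
      show "0 \<le> \<phi> j" for j by (rule \<phi>0)
      show "\<kappa> \<le> c j" if "1 \<le> j" "j < M" for j using that by (rule \<kappa>)
      show "\<bar>z j\<bar> \<le> Z" if "j < M" for j using that by (rule Z)
      show "J1 x + J2 x \<le> 1" if "X \<le> x" for x using that by (rule X)
      show "J2 ((x + y) / 2) \<le> ereal ((real_of_ereal (J2 x) + real_of_ereal (J2 y)) / 2 + C0)"
        if "x \<in> {u0, u1} \<union> z ` {..<M}" "y \<in> {u0, u1} \<union> z ` {..<M}" for x y
        using that unfolding S_def[symmetric] by (rule C0)
      show "J1 u0 + J2 u0 \<le> ereal Kb" "J1 u1 + J2 u1 \<le> ereal Kb" by (rule Kb)+
      show "real (p n) * real M < real n" using elim n0 by (simp add: field_simps)
      show "(3 * Z + u0 + u1) * (real (p n) / real n) \<le> \<kappa> / 2" "X * (real (p n) / real n) \<le> \<kappa> / 2" using elim by auto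
      show "real (k1 n + p n) * real M < real n" "real (n - k2 n + 1 + p n) * real M < real n"
        using elim n0 by (auto simp: field_simps)
    qed
    show ?case
    proof (intro exI[of _ R.s] conjI)
      show "pwa n R.s \<in> A_T n (T n)" "BC n ell u0 u1 (pwa n R.s)" by (rule R.in_A_T R.boundary_conditions)+
      have "(\<integral>\<^sup>+x. ennreal \<bar>blockU M z c x - pwa n R.s x\<bar> \<partial>U01) \<le> ennreal (E1 n)"
        using R.L1_bound unfolding E1_def Kv_def .
      also have "\<dots> \<le> ennreal \<epsilon>" using elim by (intro ennreal_leI) auto
      finally show "(\<integral>\<^sup>+x. ennreal \<bar>blockU M z c x - pwa n R.s x\<bar> \<partial>U01) \<le> ennreal \<epsilon>" .
      have "QC_energy J1 J2 n (k1 n) (k2 n) (pwa n R.s) \<le> ereal (m + (\<Sum>j<M. \<phi> j) / real M + E2 n)"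
        using R.energy_bound unfolding E2_def .
      also have "\<dots> \<le> ereal (m + (\<Sum>j<M. \<phi> j) / real M + \<epsilon>)" using elim by simp
      finally show "QC_energy J1 J2 n (k1 n) (k2 n) (pwa n R.s) \<le> ereal (m + (\<Sum>j<M. enn2real (supaff b (\<gamma> - z j))) / real M + \<epsilon>)"
        unfolding \<phi>_def .
    qed
  qed
qed

end

section \<open>Approximation by block functions\<close>

lemma ennreal_integral_le_nn_integral:
  assumes "integrable M f" shows "ennreal (\<integral>x. f x \<partial>M) \<le> (\<integral>\<^sup>+x. ennreal (f x) \<partial>M)"
proof -
  have i: "integrable M (\<lambda>x. max 0 (f x))" using assms by (intro integrable_max) auto
  have "ennreal (\<integral>x. f x \<partial>M) \<le> ennreal (\<integral>x. max 0 (f x) \<partial>M)"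
    using assms i by (intro ennreal_leI integral_mono) auto
  also have "\<dots> = (\<integral>\<^sup>+x. ennreal (max 0 (f x)) \<partial>M)" using i by (intro nn_integral_eq_integral[symmetric]) auto
  also have "\<dots> = (\<integral>\<^sup>+x. ennreal (f x) \<partial>M)" by (intro nn_integral_cong) (auto simp: max_def ennreal_neg)
  finally show ?thesis .
qed

text \<open>Averaging is exact for each affine function p q - b p, and its mean is at most that of
  \<open>supaff\<close>; the supremum over p is taken last. The factor r - l avoids a division in
  \<open>ennreal\<close>.\<close>

lemma supaff_Jensen:
  fixes \<zeta> :: "real \<Rightarrow> real"
  assumes [measurable]: "\<zeta> \<in> borel_measurable borel" and int: "set_integrable lborel {l..r} \<zeta>" and lr: "l < r"
  shows "supaff b (\<gamma> - (LINT x:{l..r}|lborel. \<zeta> x) / (r - l)) * ennreal (r - l)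
    \<le> (\<integral>\<^sup>+x. supaff b (\<gamma> - \<zeta> x) * indicator {l..r} x \<partial>lborel)"
  unfolding supaff_def[of b "\<gamma> - (LINT x:{l..r}|lborel. \<zeta> x) / (r - l)"] SUP_mult_right_ennreal
proof (rule SUP_least)
  fix p :: real assume p: "p \<in> {0..}"
  let ?I = "LINT x:{l..r}|lborel. \<zeta> x"
  have ci: "set_integrable lborel {l..r} (\<lambda>_. a)" for a :: real
    unfolding set_integrable_def
    by (intro integrable_scaleR_left integrable_real_indicator) (simp_all add: emeasure_lborel_Icc_eq)
  have cI: "(LINT x:{l..r}|lborel. a) = a * (r - l)" for a :: real using lr by (simp add: set_integral_const)
  have i1: "set_integrable lborel {l..r} (\<lambda>x. p * \<gamma> - b p)" "set_integrable lborel {l..r} (\<lambda>x. p * \<zeta> x)"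
    using ci int by auto
  have i2: "set_integrable lborel {l..r} (\<lambda>x. (p * \<gamma> - b p) - p * \<zeta> x)" using i1 by (rule set_integral_diff)
  have "(LINT x:{l..r}|lborel. (p * \<gamma> - b p) - p * \<zeta> x) = (p * \<gamma> - b p) * (r - l) - p * ?I"
    using i1 by (simp add: set_integral_diff cI)
  also have "\<dots> = (p * (\<gamma> - ?I / (r - l)) - b p) * (r - l)" using lr by (simp add: field_simps)
  finally have eq: "(LINT x:{l..r}|lborel. (p * \<gamma> - b p) - p * \<zeta> x) = (p * (\<gamma> - ?I / (r - l)) - b p) * (r - l)" .
  have "ennreal (p * (\<gamma> - ?I / (r - l)) - b p) * ennreal (r - l) = ennreal (LINT x:{l..r}|lborel. (p * \<gamma> - b p) - p * \<zeta> x)"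
    unfolding eq using lr by (subst ennreal_mult'') auto
  also have "\<dots> \<le> (\<integral>\<^sup>+x. ennreal (indicator {l..r} x *\<^sub>R ((p * \<gamma> - b p) - p * \<zeta> x)) \<partial>lborel)"
    using i2 unfolding set_lebesgue_integral_def set_integrable_def by (rule ennreal_integral_le_nn_integral)
  also have "\<dots> \<le> (\<integral>\<^sup>+x. supaff b (\<gamma> - \<zeta> x) * indicator {l..r} x \<partial>lborel)"
  proof (rule nn_integral_mono)
    fix x
    have "ennreal ((p * \<gamma> - b p) - p * \<zeta> x) \<le> supaff b (\<gamma> - \<zeta> x)"
      using supaff_upper[of p "\<gamma> - \<zeta> x" b] p by (simp add: algebra_simps)
    then show "ennreal (indicator {l..r} x *\<^sub>R ((p * \<gamma> - b p) - p * \<zeta> x)) \<le> supaff b (\<gamma> - \<zeta> x) * indicator {l..r} x"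
      by (simp add: indicator_def)
  qed
  finally show "ennreal (p * (\<gamma> - ?I / (r - l)) - b p) * ennreal (r - l)
    \<le> (\<integral>\<^sup>+x. supaff b (\<gamma> - \<zeta> x) * indicator {l..r} x \<partial>lborel)" .
qed

lemma sum_blocks_nn_integral:
  assumes M: "0 < M" and [measurable]: "f \<in> borel_measurable borel"
  shows "(\<Sum>j<M. \<integral>\<^sup>+x. f x * indicator {real j / real M..real (Suc j) / real M} x \<partial>lborel) = (\<integral>\<^sup>+x. f x \<partial>U01)"
proof -
  have "(\<Sum>j<M. \<integral>\<^sup>+x. f x * indicator {real j / real M..real (Suc j) / real M} x \<partial>lborel)
      = (\<Sum>j<M. \<integral>\<^sup>+x. f x * indicator {real j / real M..<real (Suc j) / real M} x \<partial>lborel)"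
  proof (rule sum.cong)
    fix j
    show "(\<integral>\<^sup>+x. f x * indicator {real j / real M..real (Suc j) / real M} x \<partial>lborel)
      = (\<integral>\<^sup>+x. f x * indicator {real j / real M..<real (Suc j) / real M} x \<partial>lborel)"
      using AE_lborel_singleton[of "real (Suc j) / real M"]
      by (intro nn_integral_cong_AE, eventually_elim) (auto simp: indicator_def)
  qed simp
  also have "\<dots> = (\<integral>\<^sup>+x. (\<Sum>j<M. f x * indicator {real j / real M..<real (Suc j) / real M} x) \<partial>lborel)"
    by (intro nn_integral_sum[symmetric]) auto
  also have "\<dots> = (\<integral>\<^sup>+x. f x * indicator {0<..<1} x \<partial>lborel)"
  proof (rule nn_integral_cong_AE)
    show "AE x in lborel. (\<Sum>j<M. f x * indicator {real j / real M..<real (Suc j) / real M} x) = f x * indicator {0<..<1} x"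
      using AE_lborel_singleton[of "0::real"]
    proof eventually_elim
      case (elim x)
      show ?case
      proof (cases "0 \<le> x \<and> x < 1")
        case True
        then have "f x = (\<Sum>j<M. f x * indicator {real j / real M..<real (Suc j) / real M} x)"
          using cell_indicator_sum[of M x "\<lambda>_. f x"] M by simp
        then show ?thesis using True elim by (simp add: indicator_def)
      next
        case False
        have "x \<notin> {real j / real M..<real (Suc j) / real M}" if "j < M" for j
        proof
          assume x: "x \<in> {real j / real M..<real (Suc j) / real M}"
          have "0 \<le> real j / real M" "real (Suc j) / real M \<le> 1" using that M by (auto simp: divide_simps)
          then show False using x False by (smt (verit) atLeastLessThan_iff)
        qed
        then have "(\<Sum>j<M. f x * indicator {real j / real M..<real (Suc j) / real M} x) = 0"
          by (intro sum.neutral) (simp add: indicator_def)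
        moreover have "f x * indicator {0<..<1} x = 0" using False by (auto simp: indicator_def)
        ultimately show ?thesis by (rule trans[OF _ sym])
      qed
    qed
  qed
  also have "\<dots> = (\<integral>\<^sup>+x. f x \<partial>U01)" by (simp add: nn_integral_U01)
  finally show ?thesis .
qed

lemma set_integral_Icc_split:
  fixes f :: "real \<Rightarrow> real"
  assumes "set_integrable lborel {0..1} f" "0 \<le> x" "x \<le> y" "y \<le> 1"
  shows "(LINT t:{0..y}|lborel. f t) = (LINT t:{0..x}|lborel. f t) + (LINT t:{x..y}|lborel. f t)"
proof -
  have "{0..y} = {0..x} \<union> {x..y}" using assms by auto
  moreover have "(LINT t:{0..x} \<union> {x..y}|lborel. f t) = (LINT t:{0..x}|lborel. f t) + (LINT t:{x..y}|lborel. f t)"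
  proof (rule set_integral_Un_AE)
    show "AE t in lborel. \<not> (t \<in> {0..x} \<and> t \<in> {x..y})"
      using AE_lborel_singleton[of x] by eventually_elim auto
    show "set_integrable lborel {0..x} f" "set_integrable lborel {x..y} f"
      using assms by (auto intro: set_integrable_subset)
  qed auto
  ultimately show ?thesis by simp
qed

lemma continuous_on_set_integral_upto:
  fixes f :: "real \<Rightarrow> real"
  assumes "set_integrable lborel {0..1} f"
  shows "continuous_on {0..1} (\<lambda>x. LINT t:{0..x}|lborel. f t)"
proof -
  have "f integrable_on {0..1}" using assms by (rule set_borel_integral_eq_integral)
  then have cont: "continuous_on {0..1} (\<lambda>x. integral {0..x} f)" by (rule indefinite_integral_continuous_1)
  have eq: "(LINT t:{0..x}|lborel. f t) = integral {0..x} f" if "x \<in> {0..1}" for x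
  proof (rule set_borel_integral_eq_integral)
    show "set_integrable lborel {0..x} f" using assms that by (auto intro: set_integrable_subset)
  qed
  show ?thesis by (rule iffD2[OF continuous_on_cong[OF refl eq] cont])
qed

lemma cell_limits:
  assumes "0 \<le> x"
  shows "(\<lambda>M. real (cell M x) / real M) \<longlonglongrightarrow> x" "(\<lambda>M. real (Suc (cell M x)) / real M) \<longlonglongrightarrow> x"
proof -
  have b: "real (cell M x) \<le> real M * x" "real M * x < real (Suc (cell M x))" for M
    using assms unfolding cell_def by (simp_all add: of_nat_nat) linarith+
  have inv: "(\<lambda>M. 1 / real M) \<longlonglongrightarrow> 0" by (rule lim_1_over_n)
  have l1: "(\<lambda>M. x - 1 / real M) \<longlonglongrightarrow> x" "(\<lambda>M. x + 1 / real M) \<longlonglongrightarrow> x"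
    using tendsto_diff[OF tendsto_const inv, of x] tendsto_add[OF tendsto_const inv, of x] by auto
  show "(\<lambda>M. real (cell M x) / real M) \<longlonglongrightarrow> x"
  proof (rule tendsto_sandwich[OF _ _ l1(1) tendsto_const[of x]])
    show "\<forall>\<^sub>F M in sequentially. x - 1 / real M \<le> real (cell M x) / real M"
      using eventually_gt_at_top[of 0]
    proof eventually_elim
      case (elim M)
      have "(real M * x - 1) / real M \<le> real (cell M x) / real M" using b[of M] by (intro divide_right_mono) auto
      then show ?case using elim by (simp add: diff_divide_distrib)
    qed
    show "\<forall>\<^sub>F M in sequentially. real (cell M x) / real M \<le> x"
      using eventually_gt_at_top[of 0]
    proof eventually_elim
      case (elim M)
      have "real (cell M x) / real M \<le> (real M * x) / real M" using b[of M] by (intro divide_right_mono) auto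
      then show ?case using elim by simp
    qed
  qed
  then have "(\<lambda>M. real (cell M x) / real M + 1 / real M) \<longlonglongrightarrow> x + 0" by (intro tendsto_add inv)
  then show "(\<lambda>M. real (Suc (cell M x)) / real M) \<longlonglongrightarrow> x" by (simp add: add_divide_distrib add.commute)
qed

context lennard_jones
begin

lemma supaff_finite_pos: "0 < x \<Longrightarrow> supaff b (\<gamma> - x) < top"
proof -
  assume x: "0 < x"
  have "ereal m + enn2ereal (supaff b (\<gamma> - x)) \<le> J2 x + ereal (1/2) * (J1 x + J1 x)"
    using envelope_le[of x x] unfolding envelope by simp
  also have "\<dots> < \<infinity>" using finite_pos[OF x] J1_cases[of x] J2_cases[of x] by auto
  finally show ?thesis by (cases "supaff b (\<gamma> - x)") (auto simp: enn2ereal_ennreal)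
qed

text \<open>Besides averaging over blocks, the function is mixed with weight $1/M$ with one of slope $s_0 < \ell$,
  which frees the mass $(\ell - s_0)/M$ to make every jump strictly positive.\<close>

lemma block_approximation:
  assumes [measurable]: "g \<in> borel_measurable borel" "u \<in> borel_measurable borel" and rep: "BV_rep ell u g \<mu>"
    and ell: "0 < ell"
    and E: "(\<integral>\<^sup>+x. supaff b (\<gamma> - g x) \<partial>U01) = ennreal E" "0 \<le> E" and \<epsilon>: "0 < \<epsilon>"
  obtains M z c where "2 \<le> M" "\<And>j. j < M \<Longrightarrow> z j \<le> \<gamma>" "\<And>j. j < M \<Longrightarrow> supaff b (\<gamma> - z j) < top"
    "\<And>j. 1 \<le> j \<Longrightarrow> j < M \<Longrightarrow> 0 < c j" "blockU M z c 1 = ell"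
    "(\<integral>\<^sup>+x. ennreal \<bar>u x - blockU M z c x\<bar> \<partial>U01) \<le> ennreal \<epsilon>"
    "(\<Sum>j<M. enn2real (supaff b (\<gamma> - z j))) / real M \<le> E + \<epsilon>"
proof -
  have gi: "set_integrable lborel {0..1} g" and \<mu>s: "sets \<mu> = sets borel" and \<mu>f: "emeasure \<mu> {0..1} < \<infinity>"
    and \<mu>o: "emeasure \<mu> (UNIV - {0..1}) = 0"
    and urep: "AE x in lborel. x \<in> {0<..<1} \<longrightarrow> u x = (LINT t:{0..x}|lborel. g t) + measure \<mu> {0..x}"
    and utot: "(LINT t:{0..1}|lborel. g t) + measure \<mu> {0..1} = ell"
    using rep unfolding BV_rep_def by auto
  \<comment> \<open>The envelope is constant beyond \<gamma>, so slope in excess of \<gamma> gains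
    nothing. It is moved, together with \<mu>, into the increasing part N, and the block slopes stay
    in the range where the Cauchy-Born identity holds.\<close>
  define f1 where "f1 t = min (g t) \<gamma>" for t
  define f2 where "f2 t = max 0 (g t - \<gamma>)" for t
  have [measurable]: "f1 \<in> borel_measurable borel" "f2 \<in> borel_measurable borel"
    unfolding f1_def f2_def by measurable
  have cint: "set_integrable lborel {0..1::real} (\<lambda>_. a)" for a :: real
    unfolding set_integrable_def
    by (intro integrable_scaleR_left integrable_real_indicator) auto
  have "integrable lborel (\<lambda>x. max 0 (indicator {0..1} x *\<^sub>R (g x - \<gamma>)))"
    using set_integral_diff(1)[OF gi cint[of \<gamma>]] unfolding set_integrable_def by (intro integrable_max) auto
  moreover have "(\<lambda>x. max 0 (indicator {0..1} x *\<^sub>R (g x - \<gamma>))) = (\<lambda>x. indicator {0..1} x *\<^sub>R f2 x)"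
    by (auto simp: f2_def indicator_def)
  ultimately have i2: "set_integrable lborel {0..1} f2" unfolding set_integrable_def by simp
  have f12: "f1 = (\<lambda>t. g t - f2 t)" by (auto simp: f1_def f2_def)
  have i1: "set_integrable lborel {0..1} f1" unfolding f12 using gi i2 by (rule set_integral_diff)
  define G where "G x = (LINT t:{0..x}|lborel. f1 t)" for x
  define N where "N x = (LINT t:{0..x}|lborel. f2 t) + measure \<mu> {0..x}" for x
  have [measurable]: "G \<in> borel_measurable borel" unfolding G_def by measurable
  have GN: "(LINT t:{0..x}|lborel. g t) + measure \<mu> {0..x} = G x + N x" if "x \<le> 1" for x
  proof -
    have "set_integrable lborel {0..x} g" "set_integrable lborel {0..x} f2"
      using gi i2 that by (auto intro: set_integrable_subset)
    then show ?thesis unfolding G_def N_def f12 by (simp add: set_integral_diff)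
  qed
  have uGN: "AE x in U01. u x = G x + N x"
    using urep[folded AE_U01] AE_U01_in
  proof eventually_elim
    case (elim x)
    then show "u x = G x + N x" using GN[of x] by simp
  qed
  have tot: "G 1 + N 1 = ell" using utot GN[of 1] by simp
  have G0: "G 0 = 0" using set_integral_Icc_split[OF i1, of 0 0] by (simp add: G_def)
  have \<mu>m: "measure \<mu> {0..x} \<le> measure \<mu> {0..y}" if "x \<le> y" "y \<le> 1" for x y
  proof (rule measure_mono_fmeasurable)
    show "{0..y} \<in> fmeasurable \<mu>"
      using le_less_trans[OF emeasure_mono[of "{0..y}" "{0..1}" \<mu>] \<mu>f] that by (auto simp: fmeasurable_def \<mu>s)
  qed (use that \<mu>s in auto)
  have Nmono: "N x \<le> N y" if "0 \<le> x" "x \<le> y" "y \<le> 1" for x y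
  proof -
    have "0 \<le> (LINT t:{x..y}|lborel. f2 t)"
      unfolding set_lebesgue_integral_def by (intro Bochner_Integration.integral_nonneg) (auto simp: f2_def indicator_def)
    then show ?thesis unfolding N_def using set_integral_Icc_split[OF i2 that] \<mu>m[OF that(2,3)] by simp
  qed
  have N0: "0 \<le> N x" for x
    unfolding N_def set_lebesgue_integral_def
    by (intro add_nonneg_nonneg Bochner_Integration.integral_nonneg) (auto simp: f2_def indicator_def)
  have Gcont: "continuous_on {0..1} G" unfolding G_def by (rule continuous_on_set_integral_upto[OF i1])
  obtain B where B: "\<And>x. 0 \<le> x \<Longrightarrow> x \<le> 1 \<Longrightarrow> \<bar>G x\<bar> \<le> B"
  proof -
    have "bounded (G ` {0..1})" by (intro compact_imp_bounded compact_continuous_image Gcont) simp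
    then obtain B where "\<forall>y\<in>G ` {0..1}. norm y \<le> B" by (auto simp: bounded_iff)
    then show ?thesis using that[of B] by auto
  qed
  have B0: "0 \<le> B" using B[of 0] by linarith
  \<comment> \<open>Positive, hence of finite energy; below \<open>ell\<close>, so that mass remains
    for the jumps; at most \<gamma>, as block slopes must be.\<close>
  define s0 where "s0 = min ell \<gamma> / 2"
  have s0: "0 < s0" "s0 < ell" "s0 \<le> \<gamma>" using ell \<gamma>_pos by (auto simp: s0_def)
  define F0 where "F0 = enn2real (supaff b (\<gamma> - s0))"
  have F0: "supaff b (\<gamma> - s0) = ennreal F0" "0 \<le> F0" using supaff_finite_pos[OF s0(1)] by (auto simp: F0_def)
  define a where "a M j = real M * (G (real (Suc j) / real M) - G (real j / real M))" for M j
  define \<tau> where "\<tau> M = 1 / real M" for M :: nat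
  define z where "z M j = (1 - \<tau> M) * a M j + \<tau> M * s0" for M j
  \<comment> \<open>A block function has no jump at 0 or 1. Starting from 0 instead of N 0, and
    reaching N 1 already in the last block, shifts the boundary jumps to the nearest interior block
    boundaries.\<close>
  define Nh where "Nh M j = (if j = 0 then 0 else if j = M - 1 then N 1 else N (real j / real M))" for M j
  \<comment> \<open>The increments of \<open>Nh\<close> over the M - 1 interior boundaries sum to N
    1; the second summand spreads the spare mass evenly over these boundaries.\<close>
  define c where "c M j = (1 - \<tau> M) * (Nh M j - Nh M (j - 1)) + \<tau> M * ((ell - s0) / real (M - 1))" for M j
  have \<tau>: "0 < \<tau> M" "\<tau> M < 1" if "2 \<le> M" for M using that by (auto simp: \<tau>_def)
  have block: "0 \<le> real j / real M" "real j / real M < real (Suc j) / real M" "real (Suc j) / real M \<le> 1"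
    "real (Suc j) / real M - real j / real M = 1 / real M" if "j < M" for j M :: nat
    using that by (auto simp: divide_simps)
  have zint: "z M j = (LINT t:{real j / real M..real (Suc j) / real M}|lborel. (1 - \<tau> M) * f1 t + \<tau> M * s0) / (real (Suc j) / real M - real j / real M)"
    if M: "2 \<le> M" and j: "j < M" for M j
  proof -
    note bl = block[OF j]
    have f1b: "(LINT t:{real j / real M..real (Suc j) / real M}|lborel. f1 t) = G (real (Suc j) / real M) - G (real j / real M)"
      unfolding G_def using set_integral_Icc_split[OF i1 bl(1) less_imp_le[OF bl(2)] bl(3)] by simp
    have ii: "set_integrable lborel {real j / real M..real (Suc j) / real M} f1"
      using i1 by (rule set_integrable_subset) (use bl in auto)
    have ic: "set_integrable lborel {real j / real M..real (Suc j) / real M} (\<lambda>_. \<tau> M * s0)"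
      using cint by (rule set_integrable_subset) (use bl in auto)
    have "(LINT t:{real j / real M..real (Suc j) / real M}|lborel. \<tau> M * s0) = \<tau> M * s0 * (1 / real M)"
      using bl(2,4) by (simp add: set_integral_const)
    then have "(LINT t:{real j / real M..real (Suc j) / real M}|lborel. (1 - \<tau> M) * f1 t + \<tau> M * s0)
        = (1 - \<tau> M) * (G (real (Suc j) / real M) - G (real j / real M)) + \<tau> M * s0 * (1 / real M)"
      using ii ic f1b by (simp add: set_integral_add)
    then show ?thesis unfolding bl(4) using M by (simp add: z_def a_def field_simps)
  qed
  have zF: "(\<Sum>j<M. supaff b (\<gamma> - z M j) * ennreal (1 / real M)) \<le> ennreal (E + F0 / real M)" if M: "2 \<le> M" for M
  proof -
    have M0: "0 < M" using M by simp
    let ?\<zeta> = "\<lambda>t. (1 - \<tau> M) * f1 t + \<tau> M * s0"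
    have "(\<Sum>j<M. supaff b (\<gamma> - z M j) * ennreal (1 / real M))
        \<le> (\<Sum>j<M. \<integral>\<^sup>+x. supaff b (\<gamma> - ?\<zeta> x) * indicator {real j / real M..real (Suc j) / real M} x \<partial>lborel)"
    proof (rule sum_mono)
      fix j assume "j \<in> {..<M}"
      then have j: "j < M" by simp
      note bl = block[OF j]
      have "set_integrable lborel {0..1} ?\<zeta>" using i1 cint by (intro set_integral_add) auto
      then have "set_integrable lborel {real j / real M..real (Suc j) / real M} ?\<zeta>"
        by (rule set_integrable_subset) (use bl in auto)
      then have "supaff b (\<gamma> - (LINT t:{real j / real M..real (Suc j) / real M}|lborel. ?\<zeta> t) / (real (Suc j) / real M - real j / real M))
            * ennreal (real (Suc j) / real M - real j / real M)
          \<le> (\<integral>\<^sup>+x. supaff b (\<gamma> - ?\<zeta> x) * indicator {real j / real M..real (Suc j) / real M} x \<partial>lborel)"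
        by (rule supaff_Jensen[OF _ _ bl(2), rotated]) measurable
      then show "supaff b (\<gamma> - z M j) * ennreal (1 / real M)
          \<le> (\<integral>\<^sup>+x. supaff b (\<gamma> - ?\<zeta> x) * indicator {real j / real M..real (Suc j) / real M} x \<partial>lborel)"
        unfolding zint[OF M j, symmetric] unfolding bl(4) .
    qed
    also have "\<dots> = (\<integral>\<^sup>+x. supaff b (\<gamma> - ?\<zeta> x) \<partial>U01)" by (rule sum_blocks_nn_integral[OF M0]) measurable
    also have "\<dots> \<le> (\<integral>\<^sup>+x. supaff b (\<gamma> - g x) + ennreal (F0 / real M) \<partial>U01)"
    proof (rule nn_integral_mono)
      fix x
      have "\<gamma> - ?\<zeta> x = (1 - \<tau> M) * (\<gamma> - f1 x) + \<tau> M * (\<gamma> - s0)" by (simp add: algebra_simps)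
      then have "supaff b (\<gamma> - ?\<zeta> x) \<le> ennreal (1 - \<tau> M) * supaff b (\<gamma> - f1 x) + ennreal (\<tau> M) * supaff b (\<gamma> - s0)"
        using supaff_convex[of "\<tau> M" b "\<gamma> - f1 x" "\<gamma> - s0"] \<tau>[OF M] by simp
      also have "\<dots> \<le> 1 * supaff b (\<gamma> - g x) + ennreal (F0 / real M)"
      proof (intro add_mono mult_mono)
        show "ennreal (1 - \<tau> M) \<le> 1" using \<tau>[OF M] by (simp add: ennreal_le_1)
        show "supaff b (\<gamma> - f1 x) \<le> supaff b (\<gamma> - g x)"
          by (cases "g x \<le> \<gamma>") (auto simp: f1_def min_def supaff_0)
        show "ennreal (\<tau> M) * supaff b (\<gamma> - s0) \<le> ennreal (F0 / real M)"
          unfolding F0(1) using F0(2) by (subst ennreal_mult''[symmetric]) (auto simp: \<tau>_def)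
      qed auto
      finally show "supaff b (\<gamma> - ?\<zeta> x) \<le> supaff b (\<gamma> - g x) + ennreal (F0 / real M)" by simp
    qed
    also have "\<dots> = ennreal E + ennreal (F0 / real M)"
      by (subst nn_integral_add) (auto simp: E emeasure_U01)
    also have "\<dots> = ennreal (E + F0 / real M)" using E F0 by (intro ennreal_plus[symmetric]) auto
    finally show ?thesis .
  qed
  have zfin: "supaff b (\<gamma> - z M j) < top" if "2 \<le> M" "j < M" for M j
  proof (rule ccontr)
    assume "\<not> ?thesis"
    then have "supaff b (\<gamma> - z M j) * ennreal (1 / real M) = top"
      using that by (simp add: less_top[symmetric] ennreal_top_mult)
    moreover have "supaff b (\<gamma> - z M j) * ennreal (1 / real M) \<le> (\<Sum>j<M. supaff b (\<gamma> - z M j) * ennreal (1 / real M))"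
      using that by (intro member_le_sum) auto
    ultimately have "top \<le> ennreal (E + F0 / real M)" using zF[OF that(1)] by (metis order_trans)
    then show False by (simp add: top_unique)
  qed
  have zsum: "(\<Sum>j<M. enn2real (supaff b (\<gamma> - z M j))) / real M \<le> E + F0 / real M" if M: "2 \<le> M" for M
  proof -
    have "(\<Sum>j<M. supaff b (\<gamma> - z M j) * ennreal (1 / real M)) = (\<Sum>j<M. ennreal (enn2real (supaff b (\<gamma> - z M j)) * (1 / real M)))"
    proof (intro sum.cong refl)
      fix j assume "j \<in> {..<M}"
      then have e: "ennreal (enn2real (supaff b (\<gamma> - z M j))) = supaff b (\<gamma> - z M j)" using zfin[OF M] by simp
      have "ennreal (enn2real (supaff b (\<gamma> - z M j)) * (1 / real M)) = ennreal (enn2real (supaff b (\<gamma> - z M j))) * ennreal (1 / real M)"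
        by (rule ennreal_mult'') simp
      then show "supaff b (\<gamma> - z M j) * ennreal (1 / real M) = ennreal (enn2real (supaff b (\<gamma> - z M j)) * (1 / real M))"
        by (simp only: e)
    qed
    also have "\<dots> = ennreal (\<Sum>j<M. enn2real (supaff b (\<gamma> - z M j)) * (1 / real M))" by (intro sum_ennreal) auto
    also have "(\<Sum>j<M. enn2real (supaff b (\<gamma> - z M j)) * (1 / real M)) = (\<Sum>j<M. enn2real (supaff b (\<gamma> - z M j))) / real M"
      by (simp add: sum_divide_distrib)
    finally have "ennreal ((\<Sum>j<M. enn2real (supaff b (\<gamma> - z M j))) / real M) \<le> ennreal (E + F0 / real M)"
      using zF[OF M] by simp
    then show ?thesis using E F0 by (subst (asm) ennreal_le_iff) auto
  qed
  have zle: "z M j \<le> \<gamma>" if M: "2 \<le> M" and j: "j < M" for M j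
  proof -
    note bl = block[OF j]
    have ii: "set_integrable lborel {real j / real M..real (Suc j) / real M} f1"
      using i1 by (rule set_integrable_subset) (use bl in auto)
    have ic: "set_integrable lborel {real j / real M..real (Suc j) / real M} (\<lambda>_. \<gamma>)"
      using cint by (rule set_integrable_subset) (use bl in auto)
    have "(LINT t:{real j / real M..real (Suc j) / real M}|lborel. f1 t) \<le> (LINT t:{real j / real M..real (Suc j) / real M}|lborel. \<gamma>)"
      using ii ic by (rule set_integral_mono) (simp add: f1_def)
    also have "\<dots> = \<gamma> * (1 / real M)" using bl(2,4) by (simp add: set_integral_const)
    also have "(LINT t:{real j / real M..real (Suc j) / real M}|lborel. f1 t) = G (real (Suc j) / real M) - G (real j / real M)"
      unfolding G_def using set_integral_Icc_split[OF i1 bl(1) less_imp_le[OF bl(2)] bl(3)] by simp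
    finally have "real M * (G (real (Suc j) / real M) - G (real j / real M)) \<le> real M * (\<gamma> * (1 / real M))"
      by (intro mult_left_mono) auto
    then have "a M j \<le> \<gamma>" unfolding a_def using M by simp
    then have "(1 - \<tau> M) * a M j + \<tau> M * s0 \<le> (1 - \<tau> M) * \<gamma> + \<tau> M * \<gamma>"
      using \<tau>[OF M] s0 by (intro add_mono mult_left_mono) auto
    then show ?thesis by (simp add: z_def algebra_simps)
  qed
  have cpos: "0 < c M j" if M: "2 \<le> M" and j: "1 \<le> j" "j < M" for M j
  proof -
    have jM: "0 \<le> real i / real M" "real i / real M \<le> 1" if "i < M" for i using that by auto
    have "Nh M (j - 1) \<le> Nh M j"
    proof -
      have "real (j - 1) / real M \<le> real j / real M" using j by (intro divide_right_mono) auto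
      then have le: "N (real (j - 1) / real M) \<le> N (real j / real M)" "N (real (j - 1) / real M) \<le> N 1"
        using jM[of j] jM[of "j - 1"] j by (auto intro!: Nmono)
      have "j - 1 \<noteq> M - 1" using j by auto
      then show ?thesis unfolding Nh_def using le N0 j by (auto split: if_splits)
    qed
    then have "0 \<le> (1 - \<tau> M) * (Nh M j - Nh M (j - 1))" using \<tau>[OF M] by (intro mult_nonneg_nonneg) auto
    moreover have "0 < \<tau> M * ((ell - s0) / real (M - 1))" using \<tau>[OF M] s0 M by auto
    ultimately show ?thesis unfolding c_def by (rule add_nonneg_pos)
  qed
  have csum: "(\<Sum>j\<in>{1..k}. c M j) = (1 - \<tau> M) * Nh M k + \<tau> M * ((ell - s0) / real (M - 1) * real k)" for M k
  proof (induction k)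
    case (Suc k)
    have gen: "((1 - t) * A + t * (q * r)) + ((1 - t) * (A' - A) + t * q) = (1 - t) * A' + t * (q * (r + 1))"
      for t A A' q r :: real by (simp add: algebra_simps)
    have "(\<Sum>j\<in>{1..Suc k}. c M j) = (\<Sum>j\<in>{1..k}. c M j) + c M (Suc k)" by simp
    also have "\<dots> = (1 - \<tau> M) * Nh M (Suc k) + \<tau> M * ((ell - s0) / real (M - 1) * (real k + 1))"
      unfolding Suc.IH unfolding c_def diff_Suc_1 by (rule gen)
    finally show ?case by (simp only: of_nat_Suc add.commute)
  qed (simp add: Nh_def)
  have pa: "pwa M (z M) x = (1 - \<tau> M) * pwa M (a M) x + \<tau> M * (s0 * x)" if "2 \<le> M" "0 \<le> x" "x \<le> 1" for M x
    using pwa_mult_add[of M "1 - \<tau> M" "a M" "\<tau> M" "\<lambda>_. s0" x] pwa_const[of M x s0] that unfolding z_def by simp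
  have asum: "(\<Sum>j<k. a M j) / real M = G (real k / real M)" if "2 \<le> M" for M k
  proof -
    have "(\<Sum>j<k. a M j) / real M = (\<Sum>j<k. G (real (Suc j) / real M) - G (real j / real M))"
      unfolding sum_divide_distrib a_def using that by (intro sum.cong) auto
    also have "\<dots> = G (real k / real M) - G (real 0 / real M)" by (rule sum_lessThan_telescope)
    finally show ?thesis using G0 by simp
  qed
  have U1: "blockU M (z M) (c M) 1 = ell" if M: "2 \<le> M" for M
  proof -
    have M0: "0 < M" using M by simp
    have M1: "{1..<M} = {1..M - 1}" using M by auto
    have "pwa M (a M) 1 = G 1" using pwa_node[OF M0 order_refl, of "a M"] asum[OF M, of M] M by simp
    then have "pwa M (z M) 1 = (1 - \<tau> M) * G 1 + \<tau> M * s0" using pa[OF M, of 1] by simp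
    moreover have "pwa M (z M) 1 = (\<Sum>j<M. z M j) / real M" using pwa_node[OF M0 order_refl, of "z M"] M by simp
    moreover have "(\<Sum>j\<in>{1..<M}. c M j) = (1 - \<tau> M) * N 1 + \<tau> M * (ell - s0)"
      unfolding M1 csum using M by (simp add: Nh_def)
    ultimately have "blockU M (z M) (c M) 1 = (1 - \<tau> M) * (G 1 + N 1) + \<tau> M * ell"
      using blockU_1[OF M0, of "z M" "c M"] by (simp add: algebra_simps)
    then show ?thesis unfolding tot by (simp add: algebra_simps)
  qed
  have paval: "pwa M (a M) x = G (real (cell M x) / real M)
      + (real M * x - real (cell M x)) * (G (real (Suc (cell M x)) / real M) - G (real (cell M x) / real M))"
    if M: "2 \<le> M" and x: "0 \<le> x" "x < 1" for M x
  proof -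
    have M0: "0 < M" using M by simp
    note cb = cell_bounds[OF M0 x]
    have "pwa M (a M) x = G (real (cell M x) / real M) + a M (cell M x) * (x - real (cell M x) / real M)"
      using pwa_cell[OF cb(1,2) less_imp_le[OF cb(3)], of "a M"] asum[OF M] by simp
    also have "a M (cell M x) * (x - real (cell M x) / real M)
      = (real M * x - real (cell M x)) * (G (real (Suc (cell M x)) / real M) - G (real (cell M x) / real M))"
      using M0 unfolding a_def by (simp add: field_simps)
    finally show ?thesis .
  qed
  have Uval: "blockU M (z M) (c M) x = (1 - \<tau> M) * (pwa M (a M) x + Nh M (cell M x))
      + \<tau> M * (s0 * x + (ell - s0) * (real (cell M x) / real (M - 1)))"
    if M: "2 \<le> M" and x: "0 \<le> x" "x < 1" for M x
  proof -
    have M0: "0 < M" using M by simp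
    show ?thesis using blockU_cell[OF M0 x, of "z M" "c M"] pa[OF M x(1) less_imp_le[OF x(2)]] unfolding csum
      by (simp add: algebra_simps)
  qed
  have frac: "0 \<le> real M * x - real (cell M x)" "real M * x - real (cell M x) \<le> 1"
    "0 \<le> real (cell M x) / real (M - 1)" "real (cell M x) / real (M - 1) \<le> 1"
    if M: "2 \<le> M" and x: "0 \<le> x" "x < 1" for M x
  proof -
    have M0: "0 < M" using M by simp
    note cb = cell_bounds[OF M0 x]
    show "0 \<le> real M * x - real (cell M x)" "real M * x - real (cell M x) \<le> 1"
      using cb(2,3) M0 by (auto simp: field_simps)
    show "0 \<le> real (cell M x) / real (M - 1)" "real (cell M x) / real (M - 1) \<le> 1"
      using cb(1) M by auto
  qed
  \<comment> \<open>A majorant for dominated convergence: |G| is at most B, interpolation adds at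
    most 2 B, the jumps at most N 1, and the mixed-in function at most 2 \<open>ell\<close>.\<close>
  have Ubound: "\<bar>blockU M (z M) (c M) x\<bar> \<le> 3 * B + N 1 + 2 * ell" if M: "2 \<le> M" and x: "0 \<le> x" "x < 1" for M x
  proof -
    have M0: "0 < M" using M by simp
    note cb = cell_bounds[OF M0 x]
    note fr = frac[OF M x]
    have gb: "\<bar>G (real (cell M x) / real M)\<bar> \<le> B" "\<bar>G (real (Suc (cell M x)) / real M)\<bar> \<le> B"
      using block[OF cb(1)] by (auto intro!: B)
    then have "\<bar>G (real (Suc (cell M x)) / real M) - G (real (cell M x) / real M)\<bar> \<le> 2 * B" by linarith
    then have "\<bar>(real M * x - real (cell M x)) * (G (real (Suc (cell M x)) / real M) - G (real (cell M x) / real M))\<bar> \<le> 1 * (2 * B)"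
      unfolding abs_mult using fr by (intro mult_mono) auto
    from order_trans[OF abs_triangle_ineq add_mono[OF gb(1) this]]
    have 1: "\<bar>pwa M (a M) x\<bar> \<le> 3 * B" unfolding paval[OF M x] by simp
    have 2: "0 \<le> Nh M (cell M x)" "Nh M (cell M x) \<le> N 1"
      using N0 block[OF cb(1)] by (auto simp: Nh_def intro!: Nmono)
    have 3: "\<bar>(1 - \<tau> M) * (pwa M (a M) x + Nh M (cell M x))\<bar> \<le> 1 * (3 * B + N 1)"
      unfolding abs_mult using 1 2 \<tau>[OF M] by (intro mult_mono) auto
    have "0 \<le> s0 * x" using s0 x by simp
    moreover have "s0 * x \<le> ell * 1" using s0 ell x by (intro mult_mono) auto
    moreover have "0 \<le> (ell - s0) * (real (cell M x) / real (M - 1))"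
      using s0 fr by (intro mult_nonneg_nonneg) auto
    moreover have "(ell - s0) * (real (cell M x) / real (M - 1)) \<le> ell * 1" using s0 ell fr by (intro mult_mono) auto
    ultimately have "\<bar>\<tau> M * (s0 * x + (ell - s0) * (real (cell M x) / real (M - 1)))\<bar> \<le> 1 * (2 * ell)"
      unfolding abs_mult using \<tau>[OF M] by (intro mult_mono) auto
    from order_trans[OF abs_triangle_ineq add_mono[OF 3 this]]
    show ?thesis unfolding Uval[OF M x] by simp
  qed
  \<comment> \<open>Convergence holds at the continuity points of N, which leave out only countably
    many points, since G is continuous. The shift by 2 keeps at least two blocks.\<close>
  have lim: "AE x in U01. (\<lambda>M. blockU (M + 2) (z (M + 2)) (c (M + 2)) x) \<longlonglongrightarrow> u x"
  proof -
    have "countable {x \<in> {0<..<1}. \<not> isCont N x}"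
      using Nmono by (intro mono_on_ctble_discont_open) (auto simp: mono_on_def)
    then have "{x \<in> {0<..<1}. \<not> isCont N x} \<in> null_sets lborel" by (rule countable_imp_null_set_lborel)
    then have "AE x in lborel. x \<in> {0<..<1} \<longrightarrow> isCont N x" by (rule AE_I') auto
    then have "AE x in U01. isCont N x" by (simp only: AE_U01)
    then show ?thesis using uGN AE_U01_in
    proof eventually_elim
      case (elim x)
      then have x: "0 < x" "x < 1" by auto
      note cl = cell_limits[OF less_imp_le[OF x(1)]]
      have Gx: "isCont G x"
        using Gcont x by (intro continuous_on_interior[of "{0..1}" G x]) auto
      have g1: "(\<lambda>M. G (real (cell M x) / real M)) \<longlonglongrightarrow> G x" "(\<lambda>M. G (real (Suc (cell M x)) / real M)) \<longlonglongrightarrow> G x"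
        using Gx cl by (auto intro: isCont_tendsto_compose)
      have n1: "(\<lambda>M. N (real (cell M x) / real M)) \<longlonglongrightarrow> N x" using elim(1) cl(1) by (rule isCont_tendsto_compose)
      have e1: "\<forall>\<^sub>F M in sequentially. 0 < real (cell M x) / real M" using cl(1) x by (intro order_tendstoD(1))
      have e2: "\<forall>\<^sub>F M in sequentially. real (Suc (cell M x)) / real M < 1" using cl(2) x by (intro order_tendstoD(2))
      have nh: "(\<lambda>M. Nh M (cell M x)) \<longlonglongrightarrow> N x"
      proof (rule Lim_transform_eventually[OF n1])
        show "\<forall>\<^sub>F M in sequentially. N (real (cell M x) / real M) = Nh M (cell M x)"
          using e1 e2 eventually_ge_at_top[of 2]
        proof eventually_elim
          case (elim M)
          then have "cell M x \<noteq> 0" "cell M x \<noteq> M - 1" by (auto simp: zero_less_divide_iff divide_less_eq_1)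
          then show ?case by (simp add: Nh_def)
        qed
      qed
      have d0: "(\<lambda>M. (real M * x - real (cell M x)) * (G (real (Suc (cell M x)) / real M) - G (real (cell M x) / real M))) \<longlonglongrightarrow> 0"
      proof (rule Lim_null_comparison)
        show "\<forall>\<^sub>F M in sequentially. norm ((real M * x - real (cell M x)) * (G (real (Suc (cell M x)) / real M) - G (real (cell M x) / real M)))
            \<le> \<bar>G (real (Suc (cell M x)) / real M) - G (real (cell M x) / real M)\<bar>"
          using eventually_ge_at_top[of 2]
        proof eventually_elim
          case (elim M)
          note fr = frac[OF elim less_imp_le[OF x(1)] x(2)]
          then have "\<bar>real M * x - real (cell M x)\<bar> \<le> 1" by simp
          then show ?case unfolding real_norm_def abs_mult by (intro mult_left_le_one_le) auto
        qed
        have "(\<lambda>M. \<bar>G (real (Suc (cell M x)) / real M) - G (real (cell M x) / real M)\<bar>) \<longlonglongrightarrow> \<bar>G x - G x\<bar>"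
          by (intro tendsto_intros g1)
        then show "(\<lambda>M. \<bar>G (real (Suc (cell M x)) / real M) - G (real (cell M x) / real M)\<bar>) \<longlonglongrightarrow> 0" by simp
      qed
      have t0: "\<tau> \<longlonglongrightarrow> 0" unfolding \<tau>_def by (rule lim_1_over_n)
      have r0: "(\<lambda>M. \<tau> M * (s0 * x + (ell - s0) * (real (cell M x) / real (M - 1)))) \<longlonglongrightarrow> 0"
      proof (rule Lim_null_comparison)
        show "\<forall>\<^sub>F M in sequentially. norm (\<tau> M * (s0 * x + (ell - s0) * (real (cell M x) / real (M - 1)))) \<le> \<tau> M * (2 * ell)"
          using eventually_ge_at_top[of 2]
        proof eventually_elim
          case (elim M)
          note fr = frac[OF elim less_imp_le[OF x(1)] x(2)]
          have "0 \<le> s0 * x" using s0 x by simp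
    moreover have "s0 * x \<le> ell * 1" using s0 ell x by (intro mult_mono) auto
          moreover have "0 \<le> (ell - s0) * (real (cell M x) / real (M - 1))"
            using s0 fr by (intro mult_nonneg_nonneg) auto
          moreover have "(ell - s0) * (real (cell M x) / real (M - 1)) \<le> ell * 1" using s0 ell fr by (intro mult_mono) auto
          ultimately show ?case
            unfolding real_norm_def abs_mult using \<tau>[OF elim] by (intro mult_mono) auto
        qed
        show "(\<lambda>M. \<tau> M * (2 * ell)) \<longlonglongrightarrow> 0" using tendsto_mult_right[OF t0, of "2 * ell"] by simp
      qed
      have "(\<lambda>M. (1 - \<tau> M) * (G (real (cell M x) / real M)
          + (real M * x - real (cell M x)) * (G (real (Suc (cell M x)) / real M) - G (real (cell M x) / real M)) + Nh M (cell M x))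
          + \<tau> M * (s0 * x + (ell - s0) * (real (cell M x) / real (M - 1)))) \<longlonglongrightarrow> (1 - 0) * (G x + 0 + N x) + 0"
        by (intro tendsto_add tendsto_mult tendsto_diff tendsto_const t0 g1 d0 nh r0)
      then have "(\<lambda>M. blockU M (z M) (c M) x) \<longlonglongrightarrow> (1 - 0) * (G x + 0 + N x) + 0"
      proof (rule Lim_transform_eventually)
        show "\<forall>\<^sub>F M in sequentially. (1 - \<tau> M) * (G (real (cell M x) / real M)
          + (real M * x - real (cell M x)) * (G (real (Suc (cell M x)) / real M) - G (real (cell M x) / real M)) + Nh M (cell M x))
          + \<tau> M * (s0 * x + (ell - s0) * (real (cell M x) / real (M - 1))) = blockU M (z M) (c M) x"
          using eventually_ge_at_top[of 2]
          by eventually_elim (use x in \<open>simp add: Uval paval\<close>)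
      qed
      then have "(\<lambda>M. blockU M (z M) (c M) x) \<longlonglongrightarrow> u x" using elim(2) by simp
      then show ?case by (rule LIMSEQ_ignore_initial_segment)
    qed
  qed
  have ub: "AE x in U01. \<bar>u x\<bar> \<le> B + N 1"
    using uGN AE_U01_in
  proof eventually_elim
    case (elim x)
    then show ?case using B[of x] Nmono[of x 1] N0[of x] by auto
  qed
  have "(\<lambda>M. \<integral>\<^sup>+x. ennreal \<bar>u x - blockU (M + 2) (z (M + 2)) (c (M + 2)) x\<bar> \<partial>U01) \<longlonglongrightarrow> (\<integral>\<^sup>+x. 0 \<partial>U01)"
  proof (rule nn_integral_dominated_convergence[where w="\<lambda>x. ennreal (4 * B + 2 * N 1 + 2 * ell)"])
    show "AE x in U01. ennreal \<bar>u x - blockU (M + 2) (z (M + 2)) (c (M + 2)) x\<bar> \<le> ennreal (4 * B + 2 * N 1 + 2 * ell)" for M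
      using ub AE_U01_in
    proof eventually_elim
      case (elim x)
      then show ?case using Ubound[of "M + 2" x] by (intro ennreal_leI) auto
    qed
    show "(\<integral>\<^sup>+x. ennreal (4 * B + 2 * N 1 + 2 * ell) \<partial>U01) < \<infinity>"
      by (simp add: emeasure_U01 ennreal_mult_less_top)
    show "AE x in U01. (\<lambda>M. ennreal \<bar>u x - blockU (M + 2) (z (M + 2)) (c (M + 2)) x\<bar>) \<longlonglongrightarrow> 0"
      using lim
    proof eventually_elim
      case (elim x)
      have "(\<lambda>M. ennreal \<bar>u x - blockU (M + 2) (z (M + 2)) (c (M + 2)) x\<bar>) \<longlonglongrightarrow> ennreal \<bar>u x - u x\<bar>"
        using elim by (intro tendsto_intros)
      then show ?case by simp
    qed
  qed auto
  then have "\<forall>\<^sub>F M in sequentially. (\<integral>\<^sup>+x. ennreal \<bar>u x - blockU (M + 2) (z (M + 2)) (c (M + 2)) x\<bar> \<partial>U01) < ennreal \<epsilon>"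
    using \<epsilon> by (intro order_tendstoD(2)) auto
  moreover have "(\<lambda>M. F0 * (1 / real M)) \<longlonglongrightarrow> F0 * 0" by (intro tendsto_intros lim_1_over_n)
  then have "(\<lambda>M. F0 * (1 / real (M + 2))) \<longlonglongrightarrow> F0 * 0" by (rule LIMSEQ_ignore_initial_segment)
  then have "\<forall>\<^sub>F M in sequentially. F0 * (1 / real (M + 2)) < \<epsilon>" by (rule order_tendstoD) (use \<epsilon> in simp)
  ultimately have "\<forall>\<^sub>F M in sequentially. (\<integral>\<^sup>+x. ennreal \<bar>u x - blockU (M + 2) (z (M + 2)) (c (M + 2)) x\<bar> \<partial>U01) < ennreal \<epsilon>
      \<and> F0 * (1 / real (M + 2)) < \<epsilon>" by eventually_elim auto
  then obtain M where "\<And>k. k \<ge> M \<Longrightarrow> (\<integral>\<^sup>+x. ennreal \<bar>u x - blockU (k + 2) (z (k + 2)) (c (k + 2)) x\<bar> \<partial>U01) < ennreal \<epsilon>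
      \<and> F0 * (1 / real (k + 2)) < \<epsilon>" by (auto simp: eventually_sequentially)
  then have fin: "(\<integral>\<^sup>+x. ennreal \<bar>u x - blockU (M + 2) (z (M + 2)) (c (M + 2)) x\<bar> \<partial>U01) < ennreal \<epsilon>"
    "F0 * (1 / real (M + 2)) < \<epsilon>" by auto
  have M2: "2 \<le> M + 2" by simp
  show thesis
  proof (rule that[OF M2])
    show "z (M + 2) j \<le> \<gamma>" if "j < M + 2" for j using zle[OF M2 that] .
    show "supaff b (\<gamma> - z (M + 2) j) < top" if "j < M + 2" for j using zfin[OF M2 that] .
    show "0 < c (M + 2) j" if "1 \<le> j" "j < M + 2" for j using cpos[OF M2 that] .
    show "blockU (M + 2) (z (M + 2)) (c (M + 2)) 1 = ell" by (rule U1[OF M2])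
    show "(\<integral>\<^sup>+x. ennreal \<bar>u x - blockU (M + 2) (z (M + 2)) (c (M + 2)) x\<bar> \<partial>U01) \<le> ennreal \<epsilon>"
      using fin by simp
    show "(\<Sum>j<M + 2. enn2real (supaff b (\<gamma> - z (M + 2) j))) / real (M + 2) \<le> E + \<epsilon>"
      using zsum[OF M2] fin(2) by simp
  qed
qed

end

section \<open>Gamma-convergence\<close>

lemma L1_01_measurable:
  "u \<in> L1_01 \<Longrightarrow> (\<lambda>x. indicator {0<..<1} x * u x) \<in> borel_measurable borel"
  unfolding L1_01_def set_integrable_def by (auto dest: borel_measurable_integrable)

lemma nn_integral_U01_L1:
  assumes "w \<in> L1_01" "u \<in> L1_01"
  shows "(\<integral>\<^sup>+x. ennreal \<bar>indicator {0<..<1} x * w x - indicator {0<..<1} x * u x\<bar> \<partial>U01)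
    = ennreal (LINT x:{0<..<1}|lborel. \<bar>w x - u x\<bar>)"
proof -
  have [measurable]: "(\<lambda>x. indicator {0<..<1} x * w x) \<in> borel_measurable borel"
    "(\<lambda>x. indicator {0<..<1} x * u x) \<in> borel_measurable borel"
    using assms by (auto intro: L1_01_measurable)
  have "set_integrable lborel {0<..<1} (\<lambda>x. \<bar>w x - u x\<bar>)"
    using assms by (intro set_integrable_abs set_integral_diff) (auto simp: L1_01_def)
  then have i: "integrable lborel (\<lambda>x. indicator {0<..<1} x *\<^sub>R \<bar>w x - u x\<bar>)" by (simp add: set_integrable_def)
  have "(\<integral>\<^sup>+x. ennreal \<bar>indicator {0<..<1} x * w x - indicator {0<..<1} x * u x\<bar> \<partial>U01)
      = (\<integral>\<^sup>+x. ennreal (indicator {0<..<1} x *\<^sub>R \<bar>w x - u x\<bar>) \<partial>lborel)"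
    by (subst nn_integral_U01, measurable) (auto intro!: nn_integral_cong simp: indicator_def)
  also have "\<dots> = ennreal (LINT x:{0<..<1}|lborel. \<bar>w x - u x\<bar>)"
    unfolding set_lebesgue_integral_def using i by (intro nn_integral_eq_integral) auto
  finally show ?thesis .
qed

text \<open>Members of \<open>L1_01\<close> are known to be measurable only after multiplication by
  the indicator of the open interval; this allows passing to that version.\<close>

lemma BV_rep_cong:
  assumes "\<And>x. 0 < x \<Longrightarrow> x < 1 \<Longrightarrow> u x = u' x" shows "BV_rep ell u g \<mu> \<longleftrightarrow> BV_rep ell u' g \<mu>"
proof -
  have "(AE x in lborel. x \<in> {0<..<1} \<longrightarrow> u x = (LINT t:{0..x}|lborel. g t) + measure \<mu> {0..x}) \<longleftrightarrow>
    (AE x in lborel. x \<in> {0<..<1} \<longrightarrow> u' x = (LINT t:{0..x}|lborel. g t) + measure \<mu> {0..x})"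
    using assms by (intro AE_cong) auto
  then show ?thesis unfolding BV_rep_def by simp
qed

text \<open>\<open>BV_rep\<close> makes g measurable on [0, 1] only; cutting it off gives a Borel
  function on the line with the same representation.\<close>

lemma BV_rep_restrict:
  assumes "BV_rep ell u g \<mu>" shows "BV_rep ell u (\<lambda>x. indicator {0..1} x * g x) \<mu>"
proof -
  have eq: "(LINT t:{0..x}|lborel. indicator {0..1} t * g t) = (LINT t:{0..x}|lborel. g t)" if "x \<le> 1" for x
    using that by (intro set_lebesgue_integral_cong) auto
  have "set_integrable lborel {0..1} (\<lambda>x. indicator {0..1} x * g x) \<longleftrightarrow> set_integrable lborel {0..1} g"
    by (intro set_integrable_cong) auto
  moreover have "(AE x in lborel. x \<in> {0<..<1} \<longrightarrow> u x = (LINT t:{0..x}|lborel. indicator {0..1} t * g t) + measure \<mu> {0..x})"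
    if "(AE x in lborel. x \<in> {0<..<1} \<longrightarrow> u x = (LINT t:{0..x}|lborel. g t) + measure \<mu> {0..x})"
    using that by eventually_elim (auto simp: eq)
  ultimately show ?thesis using assms eq[of 1] unfolding BV_rep_def by simp
qed

text \<open>Stage n uses the best attainable tolerance 1/(k+1) with k \<le> n; capping k by n makes
  the maximum exist. A fixed tolerance is attainable for all large n, so the one used eventually
  lies below it. The default v0 serves the stages at which none is attainable.\<close>

lemma diagonal_selection:
  fixes P :: "real \<Rightarrow> nat \<Rightarrow> 'a \<Rightarrow> bool"
  assumes ex: "\<And>\<epsilon>. 0 < \<epsilon> \<Longrightarrow> \<forall>\<^sub>F n in sequentially. \<exists>v. P \<epsilon> n v"
    and mono: "\<And>\<epsilon> \<epsilon>' n v. \<epsilon> \<le> \<epsilon>' \<Longrightarrow> P \<epsilon> n v \<Longrightarrow> P \<epsilon>' n v"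
  obtains v where "\<And>n. v n = v0 \<or> (\<exists>\<epsilon>. P \<epsilon> n (v n))" "\<And>\<epsilon>. 0 < \<epsilon> \<Longrightarrow> \<forall>\<^sub>F n in sequentially. P \<epsilon> n (v n)"
proof -
  define A where "A n = {k. k \<le> n \<and> (\<exists>v. P (1 / real (Suc k)) n v)}" for n
  have fin: "finite (A n)" for n unfolding A_def by auto
  define v where "v n = (if A n = {} then v0 else SOME v. P (1 / real (Suc (Max (A n)))) n v)" for n
  have vP: "P (1 / real (Suc (Max (A n)))) n (v n)" if "A n \<noteq> {}" for n
  proof -
    have "Max (A n) \<in> A n" using fin that by (rule Max_in)
    then have "\<exists>v. P (1 / real (Suc (Max (A n)))) n v" by (simp add: A_def)
    then show ?thesis using that by (simp add: v_def someI_ex)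
  qed
  have 1: "v n = v0 \<or> (\<exists>\<epsilon>. P \<epsilon> n (v n))" for n
    using vP[of n] by (cases "A n = {}") (auto simp: v_def)
  have 2: "\<forall>\<^sub>F n in sequentially. P \<epsilon> n (v n)" if \<epsilon>: "0 < \<epsilon>" for \<epsilon>
  proof -
    obtain K where K: "1 / real (Suc K) < \<epsilon>" using nat_approx_posE[OF \<epsilon>] by auto
    have "\<forall>\<^sub>F n in sequentially. \<exists>v. P (1 / real (Suc K)) n v" by (rule ex) simp
    then show ?thesis using eventually_ge_at_top[of K]
    proof eventually_elim
      case (elim n)
      then have KA: "K \<in> A n" by (simp add: A_def)
      then have "K \<le> Max (A n)" using fin by (intro Max_ge) auto
      then have "1 / real (Suc (Max (A n))) \<le> 1 / real (Suc K)" by (intro divide_left_mono) auto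
      then have "1 / real (Suc (Max (A n))) \<le> \<epsilon>" using K by linarith
      then show ?case using vP[of n] KA by (intro mono[of _ \<epsilon>]) auto
    qed
  qed
  show thesis using that[of v] 1 2 by blast
qed

section \<open>The limit energy and the two inequalities\<close>

context lennard_jones
begin

text \<open>\<open>eint01\<close> integrates positive and negative parts separately. As
  \<open>supaff\<close> is nonnegative, the negative part is at most max(-m, 0) and has a finite
  integral. The pointwise identity is arranged as a sum on both sides because subtraction in
  \<open>ennreal\<close> is truncated.\<close>

lemma eint01_envelope:
  assumes [measurable]: "g \<in> borel_measurable borel"
  shows "eint01 (\<lambda>x. biconj (J0_of J1 J2) (g x)) = ereal m + enn2ereal (\<integral>\<^sup>+x. supaff b (\<gamma> - g x) \<partial>U01)"
proof -
  define D where "D x = supaff b (\<gamma> - g x)" for x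
  define A where "A x = e2ennreal (ereal m + enn2ereal (D x))" for x
  define B where "B x = e2ennreal (- (ereal m + enn2ereal (D x)))" for x
  have [measurable]: "D \<in> borel_measurable borel" unfolding D_def by measurable
  have [measurable]: "A \<in> borel_measurable borel" "B \<in> borel_measurable borel" unfolding A_def B_def by measurable
  have id: "A x + ennreal (- m) = D x + ennreal m + B x \<and> B x \<le> ennreal (- m)" for x
  proof (cases "D x")
    case (real d)
    have AB: "A x = ennreal (m + d)" "B x = ennreal (- m - d)"
      using real by (auto simp: A_def B_def enn2ereal_ennreal e2ennreal_ereal)
    have le: "ennreal (- m - d) \<le> ennreal (- m)" using real by (intro ennreal_leI) auto
    consider "0 \<le> m" | "m < 0" "0 \<le> m + d" | "m < 0" "m + d < 0" by linarith
    then have "ennreal (m + d) + ennreal (- m) = ennreal d + ennreal m + ennreal (- m - d)"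
    proof cases
      case 1
      then show ?thesis using real by (simp add: ennreal_neg add.commute)
    next
      case 2
      then have "ennreal (m + d) + ennreal (- m) = ennreal (m + d + - m)" by (intro ennreal_plus[symmetric]) auto
      then show ?thesis using 2 by (simp add: ennreal_neg)
    next
      case 3
      then have "ennreal d + ennreal (- m - d) = ennreal (d + (- m - d))" using real by (intro ennreal_plus[symmetric]) auto
      then show ?thesis using 3 by (simp add: ennreal_neg)
    qed
    then show ?thesis using AB le real by simp
  next
    case top
    then show ?thesis by (simp add: A_def B_def e2ennreal_neg)
  qed
  have "(\<integral>\<^sup>+x. A x + ennreal (- m) \<partial>U01) = (\<integral>\<^sup>+x. D x + ennreal m + B x \<partial>U01)"
    using id by (intro nn_integral_cong) auto
  then have I: "(\<integral>\<^sup>+x. A x \<partial>U01) + ennreal (- m) = (\<integral>\<^sup>+x. D x \<partial>U01) + ennreal m + (\<integral>\<^sup>+x. B x \<partial>U01)"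
    by (simp add: nn_integral_add emeasure_U01)
  have "(\<integral>\<^sup>+x. B x \<partial>U01) \<le> (\<integral>\<^sup>+x. ennreal (- m) \<partial>U01)" using id by (intro nn_integral_mono) auto
  also have "\<dots> = ennreal (- m)" by (simp add: emeasure_U01)
  finally have "(\<integral>\<^sup>+x. B x \<partial>U01) < top" by (rule le_less_trans) simp
  then obtain ib where ib: "(\<integral>\<^sup>+x. B x \<partial>U01) = ennreal ib" "0 \<le> ib" by (cases "\<integral>\<^sup>+x. B x \<partial>U01") auto
  have "enn2ereal (\<integral>\<^sup>+x. A x \<partial>U01) - enn2ereal (\<integral>\<^sup>+x. B x \<partial>U01) = ereal m + enn2ereal (\<integral>\<^sup>+x. D x \<partial>U01)"
  proof (cases "\<integral>\<^sup>+x. D x \<partial>U01")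
    case (real dd)
    then have "(\<integral>\<^sup>+x. A x \<partial>U01) + ennreal (- m) < top" using I ib by simp
    then obtain ia where ia: "(\<integral>\<^sup>+x. A x \<partial>U01) = ennreal ia" "0 \<le> ia" by (cases "\<integral>\<^sup>+x. A x \<partial>U01") auto
    have mx: "ennreal (max 0 x) = ennreal x" for x by (auto simp: max_def ennreal_neg)
    have "ennreal ia + ennreal (max 0 (- m)) = ennreal dd + ennreal (max 0 m) + ennreal ib"
      unfolding mx using I real ia ib by simp
    then have "ennreal (ia + max 0 (- m)) = ennreal (dd + max 0 m + ib)" using real ia ib by simp
    then have "ia + max 0 (- m) = dd + max 0 m + ib" using real ia ib by (subst (asm) ennreal_inj) auto
    then have "ia - ib = m + dd" by (simp add: max_def split: if_splits)
    then show ?thesis using real ia ib by (simp add: enn2ereal_ennreal)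
  next
    case top
    then have "(\<integral>\<^sup>+x. A x \<partial>U01) = top" using I by (cases "\<integral>\<^sup>+x. A x \<partial>U01") auto
    then show ?thesis using top ib by (simp add: enn2ereal_ennreal)
  qed
  then show ?thesis unfolding eint01_def envelope A_def[symmetric] B_def[symmetric] D_def[symmetric]
    by (simp add: nn_integral_U01)
qed

text \<open>If the inequality failed, a real C would separate the two sides and infinitely many
  energies would lie below C. For each \<delta> a late one supplies a competitor with excess energy
  C - m up to \<delta>, and the limit of the competitors represents u with energy at most C.\<close>

theorem Gamma_liminf:
  assumes u: "u \<in> L1_01" and v: "\<And>n. v n \<in> L1_01" and conv: "L1_tendsto v u"
    and pos: "0 < u0" "0 < u1"
    and k_range: "\<forall>\<^sub>F n in sequentially. 0 < k1 n \<and> k1 n < k2 n \<and> k2 n < n - 2"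
    and T: "\<And>n. atoms_ok n (T n)"
  shows "H_lim J1 J2 ell u \<le> liminf (\<lambda>n. H_disc J1 J2 ell u0 u1 n (k1 n) (k2 n) (T n) (v n))"
proof (rule ccontr)
  let ?H = "\<lambda>n. H_disc J1 J2 ell u0 u1 n (k1 n) (k2 n) (T n) (v n)"
  assume "\<not> ?thesis"
  then obtain C where C: "liminf ?H < ereal C" "ereal C < H_lim J1 J2 ell u"
    using ereal_dense2 by (meson not_le)
  define u' where "u' x = indicator {0<..<1} x * u x" for x
  have u' [measurable]: "u' \<in> borel_measurable borel" unfolding u'_def by (rule L1_01_measurable[OF u])
  define V where "V = ell + 2 * (C + 2 * c1)"
  have key: "competitors b ell \<gamma> (C - m) u' \<delta> \<noteq> {} \<and> 0 \<le> C - m + \<delta>" if \<delta>: "0 < \<delta>" for \<delta>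
  proof -
    have "(\<lambda>n. (2 * \<bar>V\<bar> + 2 * \<gamma> + c1 + \<bar>m\<bar>) * (1 / real n)) \<longlonglongrightarrow> (2 * \<bar>V\<bar> + 2 * \<gamma> + c1 + \<bar>m\<bar>) * 0"
      by (intro tendsto_intros lim_1_over_n)
    then have e1: "\<forall>\<^sub>F n in sequentially. (2 * \<bar>V\<bar> + 2 * \<gamma> + c1 + \<bar>m\<bar>) * (1 / real n) < \<delta> / 2"
      by (rule order_tendstoD) (use \<delta> in simp)
    have e2: "\<forall>\<^sub>F n in sequentially. (LINT x:{0<..<1}|lborel. \<bar>v n x - u x\<bar>) < \<delta> / 2"
      using conv unfolding L1_tendsto_def by (rule order_tendstoD) (use \<delta> in simp)
    have "\<exists>\<^sub>F n in sequentially. ?H n < ereal C"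
    proof (rule ccontr)
      assume "\<not> ?thesis"
      then have "\<forall>\<^sub>F n in sequentially. ereal C \<le> ?H n" by (simp add: frequently_def not_less)
      then have "ereal C \<le> liminf ?H" by (rule Liminf_bounded)
      then show False using C(1) by simp
    qed
    then have "\<exists>\<^sub>F n in sequentially. ?H n < ereal C \<and> (0 < k1 n \<and> k1 n < k2 n \<and> k2 n < n - 2) \<and>
        (2 * \<bar>V\<bar> + 2 * \<gamma> + c1 + \<bar>m\<bar>) * (1 / real n) < \<delta> / 2 \<and> (LINT x:{0<..<1}|lborel. \<bar>v n x - u x\<bar>) < \<delta> / 2"
      by (rule frequently_rev_mp) (use k_range e1 e2 in eventually_elim, auto)
    then obtain n where n: "?H n < ereal C" "0 < k1 n" "k1 n < k2 n" "k2 n < n - 2"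
      "(2 * \<bar>V\<bar> + 2 * \<gamma> + c1 + \<bar>m\<bar>) * (1 / real n) < \<delta> / 2" "(LINT x:{0<..<1}|lborel. \<bar>v n x - u x\<bar>) < \<delta> / 2"
      by (auto dest: frequently_ex)
    have n3: "3 < n" and n0: "0 < n" using n by auto
    obtain w where w: "w \<in> A_T n (T n)" "BC n ell u0 u1 w" "AE x in lborel. x \<in> {0<..<1} \<longrightarrow> v n x = w x"
      "QC_energy J1 J2 n (k1 n) (k2 n) w < ereal C"
      using n(1) unfolding H_disc_def INF_less_iff by auto
    define s where "s i = (node n w (i + 1) - node n w i) / (1 / real n)" for i
    have w0: "node n w 0 = 0" using w(2) by (simp add: BC_def)
    have ws: "w x = pwa n s x" if "0 \<le> x" "x \<le> 1" for x
      using A_T_eq_pwa[OF w(1) T n0 w0 that] unfolding s_def[abs_def] .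
    have wd: "node n w 1 = u0 / real n" "node n w (n - 1) = ell - u1 / real n" "node n w n = ell"
      using w(2) by (auto simp: BC_def)
    have s0: "0 \<le> s 0" using w0 wd n0 pos by (simp add: s_def)
    have s1: "0 \<le> s (n - 1)" using wd n0 pos by (simp add: s_def)
    have st: "(\<Sum>i<n. s i) / real n = ell"
      using pwa_node[OF n0 order_refl, of s] ws[of 1] wd(3) n0 by (simp add: node_def)
    have QC: "(\<Sum>i<n. ereal (1 / real n) * J1 (s i)) + (\<Sum>i<n-1. ereal (1 / real n) * nnn_term J2 (k1 n) (k2 n) s i) < ereal C"
      using QC_energy_slopes[OF n0 n(2-4) s_def, of J1 J2] w(4) by simp
    have near: "(\<integral>\<^sup>+x. ennreal \<bar>u' x - pwa n s x\<bar> \<partial>U01) \<le> ennreal (\<delta> / 2)"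
    proof -
      have "(\<integral>\<^sup>+x. ennreal \<bar>u' x - pwa n s x\<bar> \<partial>U01)
          = (\<integral>\<^sup>+x. ennreal \<bar>indicator {0<..<1} x * v n x - indicator {0<..<1} x * u x\<bar> \<partial>U01)"
      proof (rule nn_integral_cong_AE)
        show "AE x in U01. ennreal \<bar>u' x - pwa n s x\<bar> = ennreal \<bar>indicator {0<..<1} x * v n x - indicator {0<..<1} x * u x\<bar>"
          using w(3)[folded AE_U01] AE_U01_in
          by eventually_elim (auto simp: ws u'_def abs_minus_commute)
      qed
      also have "\<dots> = ennreal (LINT x:{0<..<1}|lborel. \<bar>v n x - u x\<bar>)" by (rule nn_integral_U01_L1[OF v u])
      also have "\<dots> \<le> ennreal (\<delta> / 2)" using n(6) by (intro ennreal_leI) simp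
      finally show ?thesis .
    qed
    have d2: "0 \<le> \<delta> / 2" using \<delta> by simp
    have "(2 * \<bar>V\<bar> + 2 * \<gamma> + c1 + \<bar>m\<bar>) / real n \<le> \<delta> / 2"
      using n(5) by (simp only: times_divide_eq_right mult_1_right less_imp_le)
    from add_left_mono[OF this, of "\<delta> / 2"]
    have "\<delta> / 2 + (2 * \<bar>V\<bar> + 2 * \<gamma> + c1 + \<bar>m\<bar>) / real n \<le> \<delta>" by (simp only: field_sum_of_halves)
    from slopes_competitor[OF n3 QC s0 s1 st u' near d2 V_def this] show ?thesis by simp
  qed
  have D0: "0 \<le> C - m"
  proof (rule field_le_epsilon)
    show "0 \<le> C - m + e" if "0 < e" for e using key[OF that] by simp
  qed
  obtain g \<mu> where g: "g \<in> borel_measurable borel" "BV_rep ell u' g \<mu>"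
    "(\<integral>\<^sup>+x. supaff b (\<gamma> - g x) \<partial>U01) \<le> ennreal (C - m)"
    using competitors_limit[OF u' D0] key by blast
  have "BV_rep ell u g \<mu>" using g(2) BV_rep_cong[of u u' ell g \<mu>] by (simp add: u'_def)
  then have "H_lim J1 J2 ell u \<le> eint01 (\<lambda>x. biconj (J0_of J1 J2) (g x))"
    unfolding H_lim_def by (intro INF_lower) auto
  also have "\<dots> = ereal m + enn2ereal (\<integral>\<^sup>+x. supaff b (\<gamma> - g x) \<partial>U01)" by (rule eint01_envelope[OF g(1)])
  also have "\<dots> \<le> ereal C" unfolding envelope_le_iff using g(3) D0 by simp
  finally show False using C(2) by simp
qed

text \<open>The tolerance is shared in thirds between the choice of a nearly optimal g, its
  replacement by a block function, and the interpolation for large n. The diagonal choice then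
  removes it.\<close>

theorem Gamma_limsup:
  assumes u: "u \<in> L1_01" and pos: "0 < ell" "0 < u0" "0 < u1"
    and k_range: "\<forall>\<^sub>F n in sequentially. 0 < k1 n \<and> k1 n < k2 n \<and> k2 n < n - 2"
    and K: "(\<lambda>n. real (k1 n) / real n) \<longlonglongrightarrow> 0" "(\<lambda>n. real (n - k2 n) / real n) \<longlonglongrightarrow> 0"
    and T: "\<And>n. atoms_ok n (T n)"
    and p: "(\<lambda>n. real (p n) / real n) \<longlonglongrightarrow> 0" "\<And>n a b. consecutive (T n) a b \<Longrightarrow> b - a \<le> p n"
  shows "\<exists>v. (\<forall>n. v n \<in> L1_01) \<and> L1_tendsto v u \<and>
    limsup (\<lambda>n. H_disc J1 J2 ell u0 u1 n (k1 n) (k2 n) (T n) (v n)) \<le> H_lim J1 J2 ell u"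
proof (cases "H_lim J1 J2 ell u = \<infinity>")
  case True
  then show ?thesis using u by (intro exI[of _ "\<lambda>_. u"]) (simp add: L1_tendsto_def)
next
  case False
  let ?f = "biconj (J0_of J1 J2)"
  let ?F = "\<lambda>n. H_disc J1 J2 ell u0 u1 n (k1 n) (k2 n) (T n)"
  have restrict: "eint01 (\<lambda>x. ?f (indicator {0..1} x * g x)) = eint01 (\<lambda>x. ?f (g x))" for g :: "real \<Rightarrow> real"
    unfolding eint01_def by (intro arg_cong2[where f="(-)"] arg_cong[where f=enn2ereal] nn_integral_cong) (auto simp: indicator_def)
  have gm: "(\<lambda>x. indicator {0..1} x * g x) \<in> borel_measurable borel" if "BV_rep ell u g \<mu>" for g \<mu>
    using that unfolding BV_rep_def set_integrable_def by (auto dest: borel_measurable_integrable)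
  have ge: "ereal m \<le> eint01 (\<lambda>x. ?f (g x))" if "BV_rep ell u g \<mu>" for g \<mu>
    using eint01_envelope[OF gm[OF that]] unfolding restrict by (simp add: add_increasing2)
  \<comment> \<open>The lower bound excludes -\<infinity>, so the limit energy is a real number h to
    which a tolerance can be added.\<close>
  have "ereal m \<le> H_lim J1 J2 ell u" unfolding H_lim_def using ge by (intro INF_greatest) auto
  then obtain h where h: "H_lim J1 J2 ell u = ereal h" using False by (cases "H_lim J1 J2 ell u") auto
  define u' where "u' x = indicator {0<..<1} x * u x" for x
  have u' [measurable]: "u' \<in> borel_measurable borel" unfolding u'_def by (rule L1_01_measurable[OF u])
  define P where "P \<epsilon> n v \<longleftrightarrow> v \<in> L1_01 \<and> (LINT x:{0<..<1}|lborel. \<bar>v x - u x\<bar>) \<le> \<epsilon> \<and> ?F n v \<le> ereal (h + \<epsilon>)" for \<epsilon> n v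
  have ex: "\<forall>\<^sub>F n in sequentially. \<exists>v. P \<epsilon> n v" if \<epsilon>: "0 < \<epsilon>" for \<epsilon>
  proof -
    have "H_lim J1 J2 ell u < ereal (h + \<epsilon> / 3)" using \<epsilon> h by simp
    then obtain g0 \<mu> where g0: "BV_rep ell u g0 \<mu>" "eint01 (\<lambda>x. ?f (g0 x)) < ereal (h + \<epsilon> / 3)"
      unfolding H_lim_def INF_less_iff by auto
    define g where "g x = indicator {0..1} x * g0 x" for x
    have g [measurable]: "g \<in> borel_measurable borel" unfolding g_def by (rule gm[OF g0(1)])
    have rep: "BV_rep ell u' g \<mu>"
      using BV_rep_restrict[OF g0(1)] BV_rep_cong[of u u' ell g \<mu>] by (simp add: u'_def g_def[abs_def])
    have "eint01 (\<lambda>x. ?f (g x)) < ereal (h + \<epsilon> / 3)" using g0(2) restrict[of g0] by (simp add: g_def)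
    then have lt: "ereal m + enn2ereal (\<integral>\<^sup>+x. supaff b (\<gamma> - g x) \<partial>U01) < ereal (h + \<epsilon> / 3)"
      by (simp add: eint01_envelope)
    then obtain E where E: "(\<integral>\<^sup>+x. supaff b (\<gamma> - g x) \<partial>U01) = ennreal E" "0 \<le> E"
      by (cases "\<integral>\<^sup>+x. supaff b (\<gamma> - g x) \<partial>U01") auto
    then have mE: "m + E < h + \<epsilon> / 3" using lt by (simp add: enn2ereal_ennreal)
    have \<epsilon>3: "0 < \<epsilon> / 3" using \<epsilon> by simp
    obtain M z c where M: "2 \<le> M" "\<And>j. j < M \<Longrightarrow> z j \<le> \<gamma>" "\<And>j. j < M \<Longrightarrow> supaff b (\<gamma> - z j) < top"
      "\<And>j. 1 \<le> j \<Longrightarrow> j < M \<Longrightarrow> 0 < c j" "blockU M z c 1 = ell"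
      "(\<integral>\<^sup>+x. ennreal \<bar>u' x - blockU M z c x\<bar> \<partial>U01) \<le> ennreal (\<epsilon> / 3)"
      "(\<Sum>j<M. enn2real (supaff b (\<gamma> - z j))) / real M \<le> E + \<epsilon> / 3"
      by (rule block_approximation[OF g u' rep pos(1) E \<epsilon>3]) (rule that; assumption)
    have "\<forall>\<^sub>F n in sequentially. \<exists>s. pwa n s \<in> A_T n (T n) \<and> BC n ell u0 u1 (pwa n s) \<and>
      (\<integral>\<^sup>+x. ennreal \<bar>blockU M z c x - pwa n s x\<bar> \<partial>U01) \<le> ennreal (\<epsilon> / 3) \<and>
      QC_energy J1 J2 n (k1 n) (k2 n) (pwa n s) \<le> ereal (m + (\<Sum>j<M. enn2real (supaff b (\<gamma> - z j))) / real M + \<epsilon> / 3)"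
      by (rule recovery_sequence_blocks[OF M(1-5) pos k_range K T p \<epsilon>3]) assumption+
    then show ?thesis
    proof eventually_elim
      case (elim n)
      then obtain s where s: "pwa n s \<in> A_T n (T n)" "BC n ell u0 u1 (pwa n s)"
        "(\<integral>\<^sup>+x. ennreal \<bar>blockU M z c x - pwa n s x\<bar> \<partial>U01) \<le> ennreal (\<epsilon> / 3)"
        "QC_energy J1 J2 n (k1 n) (k2 n) (pwa n s) \<le> ereal (m + (\<Sum>j<M. enn2real (supaff b (\<gamma> - z j))) / real M + \<epsilon> / 3)"
        by blast
      have [measurable]: "pwa n s \<in> borel_measurable borel"
        by (intro borel_measurable_continuous_onI continuous_on_pwa)
      have "set_integrable lborel {0..1} (pwa n s)" by (intro borel_integrable_atLeastAtMost' continuous_on_pwa)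
      then have L1: "pwa n s \<in> L1_01" unfolding L1_01_def mem_Collect_eq by (rule set_integrable_subset) auto
      have "ennreal (LINT x:{0<..<1}|lborel. \<bar>pwa n s x - u x\<bar>)
          = (\<integral>\<^sup>+x. ennreal \<bar>indicator {0<..<1} x * pwa n s x - indicator {0<..<1} x * u x\<bar> \<partial>U01)"
        by (rule nn_integral_U01_L1[OF L1 u, symmetric])
      also have "\<dots> \<le> (\<integral>\<^sup>+x. ennreal \<bar>u' x - blockU M z c x\<bar> + ennreal \<bar>blockU M z c x - pwa n s x\<bar> \<partial>U01)"
      proof (rule nn_integral_mono_AE)
        show "AE x in U01. ennreal \<bar>indicator {0<..<1} x * pwa n s x - indicator {0<..<1} x * u x\<bar>
            \<le> ennreal \<bar>u' x - blockU M z c x\<bar> + ennreal \<bar>blockU M z c x - pwa n s x\<bar>"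
          using AE_U01_in
        proof eventually_elim
          case (elim x)
          have "\<bar>indicator {0<..<1} x * pwa n s x - indicator {0<..<1} x * u x\<bar>
              \<le> \<bar>u' x - blockU M z c x\<bar> + \<bar>blockU M z c x - pwa n s x\<bar>"
            using elim by (simp add: u'_def)
          then show ?case unfolding ennreal_plus[OF abs_ge_zero abs_ge_zero, symmetric] by (rule ennreal_leI)
        qed
      qed
      also have "\<dots> = (\<integral>\<^sup>+x. ennreal \<bar>u' x - blockU M z c x\<bar> \<partial>U01) + (\<integral>\<^sup>+x. ennreal \<bar>blockU M z c x - pwa n s x\<bar> \<partial>U01)"
        by (intro nn_integral_add) auto
      also have "\<dots> \<le> ennreal (\<epsilon> / 3) + ennreal (\<epsilon> / 3)" by (intro add_mono M(6) s(3))
      also have "\<dots> = ennreal (\<epsilon> / 3 + \<epsilon> / 3)" using \<epsilon> by (intro ennreal_plus[symmetric]) auto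
      also have "\<dots> \<le> ennreal \<epsilon>" using \<epsilon> by (intro ennreal_leI) auto
      finally have d: "(LINT x:{0<..<1}|lborel. \<bar>pwa n s x - u x\<bar>) \<le> \<epsilon>" using \<epsilon> by (simp add: ennreal_le_iff)
      have "?F n (pwa n s) \<le> QC_energy J1 J2 n (k1 n) (k2 n) (pwa n s)"
        unfolding H_disc_def using s(1,2) by (intro INF_lower) auto
      also have "\<dots> \<le> ereal (m + (\<Sum>j<M. enn2real (supaff b (\<gamma> - z j))) / real M + \<epsilon> / 3)" by (rule s(4))
      also have "\<dots> \<le> ereal (h + \<epsilon>)" using M(7) mE unfolding ereal_less_eq(3) by linarith
      finally show ?case using L1 d unfolding P_def by blast
    qed
  qed
  have mono: "P \<epsilon>' n v" if "\<epsilon> \<le> \<epsilon>'" "P \<epsilon> n v" for \<epsilon> \<epsilon>' n v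
    using that unfolding P_def by (auto intro: order_trans)
  obtain v where v: "\<And>n. v n = u \<or> (\<exists>\<epsilon>. P \<epsilon> n (v n))" "\<And>\<epsilon>. 0 < \<epsilon> \<Longrightarrow> \<forall>\<^sub>F n in sequentially. P \<epsilon> n (v n)"
  proof (rule diagonal_selection[of P u])
    show "\<forall>\<^sub>F n in sequentially. \<exists>v. P \<epsilon> n v" if "0 < \<epsilon>" for \<epsilon> using that by (rule ex)
    show "P \<epsilon>' n v" if "\<epsilon> \<le> \<epsilon>'" "P \<epsilon> n v" for \<epsilon> \<epsilon>' n v using that by (rule mono)
  qed (rule that; assumption)
  have "v n \<in> L1_01" for n using v(1)[of n] u by (auto simp: P_def)
  moreover have "L1_tendsto v u"
    unfolding L1_tendsto_def
  proof (rule LIMSEQ_I)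
    fix r :: real assume r: "0 < r"
    have "\<forall>\<^sub>F n in sequentially. P (r / 2) n (v n)" using r by (intro v) simp
    then have "\<forall>\<^sub>F n in sequentially. norm ((LINT x:{0<..<1}|lborel. \<bar>v n x - u x\<bar>) - 0) < r"
    proof eventually_elim
      case (elim n)
      have "0 \<le> (LINT x:{0<..<1}|lborel. \<bar>v n x - u x\<bar>)"
        unfolding set_lebesgue_integral_def by (intro Bochner_Integration.integral_nonneg) auto
      then show ?case using elim r unfolding P_def by auto
    qed
    then show "\<exists>no. \<forall>n\<ge>no. norm ((LINT x:{0<..<1}|lborel. \<bar>v n x - u x\<bar>) - 0) < r"
      by (simp add: eventually_sequentially)
  qed
  moreover have "limsup (\<lambda>n. ?F n (v n)) \<le> ereal h"
  proof (rule ereal_le_epsilon2)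
    fix e :: real assume "0 < e"
    then have "\<forall>\<^sub>F n in sequentially. ?F n (v n) \<le> ereal (h + e)"
      using v(2)[of e] by (auto elim: eventually_mono simp: P_def)
    then have "limsup (\<lambda>n. ?F n (v n)) \<le> ereal (h + e)" by (rule Limsup_bounded)
    then show "limsup (\<lambda>n. ?F n (v n)) \<le> ereal h + ereal e" by simp
  qed
  ultimately show ?thesis using h by auto
qed

end

theorem theorem3p1:
  fixes J1 J2 :: "real \<Rightarrow> ereal" and ell u0 u1 :: real
    and k1 k2 :: "nat \<Rightarrow> nat" and T :: "nat \<Rightarrow> nat set"
  assumes LJ: "LJ_hyps J1 J2"
    and pos: "ell > 0" "u0 > 0" "u1 > 0"
    and k_range: "\<forall>\<^sub>F n in sequentially. 0 < k1 n \<and> k1 n < k2 n \<and> k2 n < n - 2"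
    and K: "filterlim k1 at_top sequentially"
           "filterlim (\<lambda>n. n - k2 n) at_top sequentially"
           "(\<lambda>n. real (k1 n) / real n) \<longlonglongrightarrow> 0"
           "(\<lambda>n. real (n - k2 n) / real n) \<longlonglongrightarrow> 0"
    and T_ok: "\<forall>n. atoms_ok n (T n)"
    and mesh: "\<exists>p :: nat \<Rightarrow> nat. (\<lambda>n. real (p n) / real n) \<longlonglongrightarrow> 0 \<and>
                 (\<forall>n a b. consecutive (T n) a b \<longrightarrow> b - a \<le> p n)"
  shows "Gamma_L1 (\<lambda>n. H_disc J1 J2 ell u0 u1 n (k1 n) (k2 n) (T n)) (H_lim J1 J2 ell)"
proof -
  obtain \<gamma> m c1 b where "lennard_jones J1 J2 \<gamma> m c1 b" using LJ_hyps_lennard_jones[OF LJ] .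
  then interpret lennard_jones J1 J2 \<gamma> m c1 b .
  obtain p :: "nat \<Rightarrow> nat" where p: "(\<lambda>n. real (p n) / real n) \<longlonglongrightarrow> 0"
    "\<And>n a b. consecutive (T n) a b \<Longrightarrow> b - a \<le> p n" using mesh by blast
  have T: "\<And>n. atoms_ok n (T n)" using T_ok by simp
  show ?thesis unfolding Gamma_L1_def
  proof (intro conjI ballI allI impI)
    fix u v assume "u \<in> L1_01" "(\<forall>n. v n \<in> L1_01) \<and> L1_tendsto v u"
    then show "H_lim J1 J2 ell u \<le> liminf (\<lambda>n. H_disc J1 J2 ell u0 u1 n (k1 n) (k2 n) (T n) (v n))"
      using pos k_range T by (intro Gamma_liminf) auto
  next
    fix u assume "u \<in> L1_01"
    then show "\<exists>v. (\<forall>n. v n \<in> L1_01) \<and> L1_tendsto v u \<and>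
        limsup (\<lambda>n. H_disc J1 J2 ell u0 u1 n (k1 n) (k2 n) (T n) (v n)) \<le> H_lim J1 J2 ell u"
      by (rule Gamma_limsup[OF _ pos k_range K(3,4) T p])
  qed
qed

end
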